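(* Let $X$ be an oriented $(n+1)$-dimensional manifold and $Y=V\times_XB$ a configuration bundle over $X$ whose sections are pairs $(\psi\,;\chi)$, with $\psi$ (sections of $V$) the variational fields and $\chi$ (sections of $B$) the background fields. Suppose $\operatorname{Diff}(X)$ acts on $V$ and on $B$ by bundle automorphisms $\sigma_V,\sigma_B$ covering $\sigma$. Let $\mathcal L(j^r\psi\,;\chi)$ be an $r$-th order Lagrangian density in which (A1) the background fields $\chi$ appear only to zeroth order, assume that (A2) the background fields have differential index at most $1$, and assume that $\mathcal L$ is $\operatorname{Diff}(X)$-covariant: $$\mathcal L\big(j^r(\sigma\cdot\psi)\,;\sigma\cdot\chi\big)=\sigma_*\big[\mathcal L(j^r\psi\,;\chi)\big]\qquad\text{for all }\sigma\in\operatorname{Diff}(X).$$ Let $\bar X=X$, let $\bar\chi:\bar X\to B$ be a given section, let $\tilde V=(X\times\bar X)\times_XV$, and define a Lagrangian density on $J^r\tilde V$ by $$\tilde{\mathcal L}\big(j^r(\eta,\psi)\big)=\mathcal L\big(j^r\psi\,;\eta^{-1}\cdot\bar\chi\big).$$ Let $(\eta,\psi)$ be a section of $\tilde V$ with $\eta\in\operatorname{Diff}(X)$. Then: (i) $(\eta,\psi)$ satisfies the Euler--Lagrange equations of $\tilde{\mathcal L}$ with respect to $\psi$ if and only if $(\psi\,;\eta^{-1}\cdot\bar\chi)$ satisfies the Euler--Lagrange equations of $\mathcal L$ with respect to $\psi$: $$\frac{\delta\tilde{\mathcal L}}{\delta\psi}(\eta,\psi)=0\iff\frac{\delta\mathcal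 L}{\delta\psi}(\psi\,;\eta^{-1}\cdot\bar\chi)=0.$$ (ii) If $(\eta,\psi)$ satisfies the Euler--Lagrange equations of $\tilde{\mathcal L}$ with respect to $\psi$, then the Euler--Lagrange equations of $\tilde{\mathcal L}$ with respect to the covariance field $\eta$ are satisfied at $(\eta,\psi)$: $$\frac{\delta\tilde{\mathcal L}}{\delta\psi}(\eta,\psi)=0\Longrightarrow\frac{\delta\tilde{\mathcal L}}{\delta\eta}(\eta,\psi)=0.$$
   Context: All objects are smooth. A Lagrangian density is a bundle map over $X$ into the bundle $\Lambda^{n+1}X$ of top forms; by (A1), $\mathcal L$ is a map $J^rV\times_XB\to\Lambda^{n+1}X$. The assignments $\sigma\mapsto\sigma_V$ and $\sigma\mapsto\sigma_B$ are group homomorphisms; each of $V,B$ has finite differential index, i.e. $\sigma_V(v)$ (resp. $\sigma_B(b)$) over $x$ depends smoothly on finitely many derivatives of $\sigma$ at $x$, and for $B$ only on derivatives of order at most $1$ (this is (A2)). On sections the action is $\sigma\cdot\psi=\sigma_V\circ\psi\circ\sigma^{-1}$ and $\sigma\cdot\chi=\sigma_B\circ\chi\circ\sigma^{-1}$; in particular $\eta^{-1}\cdot\bar\chi=(\eta^{-1})_B\circ\bar\chi\circ\eta$. $\sigma_*$ denotes push-forward of top forms. The covariance fields are diffeomorphisms $\eta:X\to\bar X$, where $\bar X=X$ is a second copy of $X$, regarded as sections $x\mapsto(x,\eta(x))$ of $X\times\bar X\to X$. The background $\bar\chi$ is regarded not as a field but as a fixed geometric object on $\bar X$; it is never varied.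 Euler--Lagrange equations are understood variationally. $\frac{\delta\mathcal L}{\delta\psi}(\psi\,;\chi)=0$ means $\frac{d}{d\epsilon}\big|_{\epsilon=0}\int_X\mathcal L(j^r\psi_\epsilon\,;\chi)=0$ for every compactly supported vertical variation $\psi_\epsilon$ of $\psi$ (a smooth family of sections with $\psi_0=\psi$ and $\psi_\epsilon=\psi$ outside a fixed compact subset of $X$; the integral may be taken over that compact set), with $\chi$ fixed. $\frac{\delta\tilde{\mathcal L}}{\delta\psi}(\eta,\psi)=0$ is the same for $\int_X\tilde{\mathcal L}(j^r(\eta,\psi_\epsilon))$ with $\eta$ fixed, and $\frac{\delta\tilde{\mathcal L}}{\delta\eta}(\eta,\psi)=0$ is the same for $\int_X\tilde{\mathcal L}(j^r(\eta_\epsilon,\psi))$ with $\psi$ fixed and $\eta_\epsilon$ any compactly supported variation of $\eta$ within $\operatorname{Diff}(X)$. *)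

theory Defs
  imports "HOL-Analysis.Analysis"
begin

section \<open>Smooth manifolds and smooth maps\<close>

text \<open>
  \<open>C\<^sup>k\<close> functions on open subsets of finite-dimensional normed spaces: all iterated directional
  derivatives up to order \<open>k\<close> exist (as values of Frechet derivatives) and are continuous.
\<close>

primrec Ck_on :: "nat \<Rightarrow> 'a::real_normed_vector set \<Rightarrow> ('a \<Rightarrow> 'b::real_normed_vector) \<Rightarrow> bool" where
  "Ck_on 0 S f \<longleftrightarrow> continuous_on S f"
| "Ck_on (Suc k) S f \<longleftrightarrow>
     (\<forall>x\<in>S. f differentiable (at x)) \<and> (\<forall>v. Ck_on k S (\<lambda>x. frechet_derivative f (at x) v))"

definition smooth_on :: "'a::real_normed_vector set \<Rightarrow> ('a \<Rightarrow> 'b::real_normed_vector) \<Rightarrow> bool" where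
  "smooth_on S f \<longleftrightarrow> (\<forall>k. Ck_on k S f)"

text \<open>
  A chart is a domain together with a coordinate map; the coordinate map is only meaningful on the
  domain. A manifold is the whole of a Hausdorff, second countable type with an atlas. The model
  space is any finite-dimensional normed space, so that (for typical fibres) dimension \<open>0\<close> is
  included.
\<close>

type_synonym ('m, 'e) chart = "'m set \<times> ('m \<Rightarrow> 'e)"
type_synonym ('m, 'e) atlas = "('m, 'e) chart set"

abbreviation chart_inv :: "('m, 'e) chart \<Rightarrow> 'e \<Rightarrow> 'm" where
  "chart_inv c \<equiv> inv_into (fst c) (snd c)"

definition loc_rep :: "('m, 'e) chart \<Rightarrow> ('p, 'f) chart \<Rightarrow> ('m \<Rightarrow> 'p) \<Rightarrow> 'e \<Rightarrow> 'f" where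
  "loc_rep c d f = snd d \<circ> f \<circ> chart_inv c"

definition smooth_manifold ::
    "('m::{t2_space,second_countable_topology}, 'e::real_normed_vector) atlas \<Rightarrow> bool" where
  "smooth_manifold A \<longleftrightarrow>
     (\<exists>S::'e set. finite S \<and> span S = UNIV) \<and>
     \<Union> (fst ` A) = UNIV \<and>
     (\<forall>c\<in>A. open (fst c) \<and> open (snd c ` fst c) \<and>
        homeomorphism (fst c) (snd c ` fst c) (snd c) (chart_inv c)) \<and>
     (\<forall>c\<in>A. \<forall>d\<in>A. smooth_on (snd c ` (fst c \<inter> fst d)) (loc_rep c d id))"

text \<open>
  An oriented manifold of dimension \<open>CARD('n) = n + 1\<close> is given by an oriented atlas.
\<close>

definition jacobian :: "(real^'n \<Rightarrow> real^'n) \<Rightarrow> real^'n \<Rightarrow> real" where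
  "jacobian f z = det (matrix (frechet_derivative f (at z)))"

definition oriented_manifold ::
    "('x::{t2_space,second_countable_topology}, real^'n) atlas \<Rightarrow> bool" where
  "oriented_manifold A \<longleftrightarrow> smooth_manifold A \<and>
     (\<forall>c\<in>A. \<forall>d\<in>A. \<forall>x \<in> fst c \<inter> fst d. jacobian (loc_rep c d id) (snd c x) > 0)"

text \<open>Smoothness of \<open>f\<close> on an open subset \<open>U\<close> of a manifold.\<close>

definition smooth_map ::
    "('m::topological_space, 'e::real_normed_vector) atlas \<Rightarrow>
     ('p, 'f::real_normed_vector) atlas \<Rightarrow> 'm set \<Rightarrow> ('m \<Rightarrow> 'p) \<Rightarrow> bool" where
  "smooth_map A B U f \<longleftrightarrow>
     (\<forall>x\<in>U. \<exists>c\<in>A. \<exists>d\<in>B. \<exists>W. open W \<and> x \<in> W \<and> W \<subseteq> U \<inter> fst c \<and> f ` W \<subseteq> fst d \<and>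
        smooth_on (snd c ` W) (loc_rep c d f))"

definition prod_atlas :: "('m, 'e) atlas \<Rightarrow> ('p, 'f) atlas \<Rightarrow> ('m \<times> 'p, 'e \<times> 'f) atlas" where
  "prod_atlas A B = (\<lambda>(c, d). (fst c \<times> fst d, map_prod (snd c) (snd d))) ` (A \<times> B)"

definition real_atlas :: "(real, real) atlas" where
  "real_atlas = {(UNIV, id)}"

definition Diff :: "('m::topological_space, 'e::real_normed_vector) atlas \<Rightarrow> ('m \<Rightarrow> 'm) set" where
  "Diff A = {\<sigma>. bij \<sigma> \<and> smooth_map A A UNIV \<sigma> \<and> smooth_map A A UNIV (inv \<sigma>)}"

section \<open>Fibre bundles, sections and jets\<close>

text \<open>Smooth, locally trivial bundles with typical fibre the manifold with atlas \<open>AF\<close>.\<close>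

definition fibre_bundle ::
    "('x::{t2_space,second_countable_topology}, 'e::real_normed_vector) atlas \<Rightarrow>
     ('v::{t2_space,second_countable_topology}, 'ev::real_normed_vector) atlas \<Rightarrow>
     ('f::{t2_space,second_countable_topology}, 'ef::real_normed_vector) atlas \<Rightarrow>
     ('v \<Rightarrow> 'x) \<Rightarrow> bool" where
  "fibre_bundle AX AV AF p \<longleftrightarrow>
     smooth_manifold AX \<and> smooth_manifold AV \<and> smooth_manifold AF \<and>
     smooth_map AV AX UNIV p \<and>
     (\<forall>x. \<exists>U \<Phi>. open U \<and> x \<in> U \<and> bij_betw \<Phi> (p -` U) (U \<times> UNIV) \<and>
        (\<forall>v \<in> p -` U. fst (\<Phi> v) = p v) \<and>
        smooth_map AV (prod_atlas AX AF) (p -` U) \<Phi> \<and>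
        smooth_map (prod_atlas AX AF) AV (U \<times> UNIV) (inv_into (p -` U) \<Phi>))"

definition smooth_section ::
    "('x::topological_space, 'e::real_normed_vector) atlas \<Rightarrow>
     ('v, 'ev::real_normed_vector) atlas \<Rightarrow> ('v \<Rightarrow> 'x) \<Rightarrow> ('x \<Rightarrow> 'v) \<Rightarrow> bool" where
  "smooth_section AX AV p s \<longleftrightarrow> smooth_map AX AV UNIV s \<and> (\<forall>x. p (s x) = x)"

definition local_section ::
    "('x::topological_space, 'e::real_normed_vector) atlas \<Rightarrow>
     ('v, 'ev::real_normed_vector) atlas \<Rightarrow> ('v \<Rightarrow> 'x) \<Rightarrow> 'x \<Rightarrow> ('x \<Rightarrow> 'v) \<Rightarrow> bool" where
  "local_section AX AV p x s \<longleftrightarrow>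
     (\<exists>U. open U \<and> x \<in> U \<and> smooth_map AX AV U s \<and> (\<forall>y\<in>U. p (s y) = y))"

text \<open>Iterated partial derivatives \<open>\<partial>\<^sub>\<alpha> f\<close>; the list \<open>\<alpha>\<close> contains the directions.\<close>

primrec partials :: "'n list \<Rightarrow> (real^'n::finite \<Rightarrow> 'b::real_normed_vector) \<Rightarrow> real^'n \<Rightarrow> 'b" where
  "partials [] f = f"
| "partials (i # \<alpha>) f = partials \<alpha> (\<lambda>z. frechet_derivative f (at z) (axis i 1))"

text \<open>
  The \<open>r\<close>-jet at \<open>x\<close> of a section \<open>s\<close> is the point \<open>x\<close> together with the class of all local
  sections near \<open>x\<close> whose coordinate representatives have the same partial derivatives at \<open>x\<close> as
  \<open>s\<close>, up to order \<open>r\<close>.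
\<close>

type_synonym ('x, 'v) jet = "'x \<times> ('x \<Rightarrow> 'v) set"

definition jet_agree ::
    "('x, real^'n) atlas \<Rightarrow> ('v, 'ev::real_normed_vector) atlas \<Rightarrow> nat \<Rightarrow> 'x \<Rightarrow>
     ('x \<Rightarrow> 'v) \<Rightarrow> ('x \<Rightarrow> 'v) \<Rightarrow> bool" where
  "jet_agree AX AV r x s t \<longleftrightarrow> s x = t x \<and>
     (\<forall>c\<in>AX. \<forall>d\<in>AV. x \<in> fst c \<and> s x \<in> fst d \<longrightarrow>
        (\<forall>\<alpha>. length \<alpha> \<le> r \<longrightarrow>
           partials \<alpha> (loc_rep c d s) (snd c x) = partials \<alpha> (loc_rep c d t) (snd c x)))"

definition jet ::
    "('x::topological_space, real^'n) atlas \<Rightarrow> ('v, 'ev::real_normed_vector) atlas \<Rightarrow>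
     ('v \<Rightarrow> 'x) \<Rightarrow> nat \<Rightarrow> ('x \<Rightarrow> 'v) \<Rightarrow> 'x \<Rightarrow> ('x, 'v) jet" where
  "jet AX AV p r s x = (x, {t. local_section AX AV p x t \<and> jet_agree AX AV r x s t})"

section \<open>Smooth dependence on jets\<close>

text \<open>
  The number of jet coordinates depends on the order of the jets, so functions of jet coordinates
  are functions on \<open>'i \<Rightarrow> real\<close> that depend only on the coordinates in a finite index set \<open>I\<close>.
  Smoothness: all iterated partial derivatives with respect to these coordinates exist and are
  continuous (the function space carries the product topology).
\<close>

definition coord_deriv :: "'i \<Rightarrow> (('i \<Rightarrow> real) \<Rightarrow> 'b::real_normed_vector) \<Rightarrow> ('i \<Rightarrow> real) \<Rightarrow> 'b" where
  "coord_deriv i f z = vector_derivative (\<lambda>t. f (z(i := t))) (at (z i))"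

primrec Ck_coords ::
    "nat \<Rightarrow> 'i set \<Rightarrow> ('i \<Rightarrow> real) set \<Rightarrow> (('i \<Rightarrow> real) \<Rightarrow> 'b::real_normed_vector) \<Rightarrow> bool" where
  "Ck_coords 0 I S f \<longleftrightarrow> continuous_on S f"
| "Ck_coords (Suc k) I S f \<longleftrightarrow> continuous_on S f \<and>
     (\<forall>i\<in>I. (\<forall>z\<in>S. (\<lambda>t. f (z(i := t))) differentiable (at (z i))) \<and>
        Ck_coords k I S (coord_deriv i f))"

definition smooth_coords ::
    "'i set \<Rightarrow> ('i \<Rightarrow> real) set \<Rightarrow> (('i \<Rightarrow> real) \<Rightarrow> 'b::real_normed_vector) \<Rightarrow> bool" where
  "smooth_coords I S f \<longleftrightarrow> finite I \<and> open S \<and>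
     (\<forall>z\<in>S. \<forall>w. (\<forall>i\<in>I. w i = z i) \<longrightarrow> w \<in> S \<and> f w = f z) \<and>
     (\<forall>k. Ck_coords k I S f)"

text \<open>
  Coordinates of a pair consisting of the \<open>k\<close>-jet of a map \<open>f\<close> at \<open>x\<close> and a point \<open>y\<close> of a further
  manifold: all partial derivatives up to order \<open>k\<close> of \<open>f\<close> in the charts \<open>c\<close>, \<open>d\<close>, and the
  coordinates of \<open>y\<close> in the chart \<open>e\<close>. Mixed partials are listed once for every order of
  differentiation; as only the existence of a smooth function of these coordinates is ever
  required, this redundancy is harmless.
\<close>

definition jet_index :: "nat \<Rightarrow> ('n list \<times> 'ev::euclidean_space + 'eb::euclidean_space) set" where
  "jet_index k = Inl ` ({\<alpha>. length \<alpha> \<le> k} \<times> Basis) \<union> Inr ` Basis"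

definition jet_coords ::
    "('x, real^'n) chart \<Rightarrow> ('v, 'ev::euclidean_space) chart \<Rightarrow> ('b, 'eb::euclidean_space) chart \<Rightarrow>
     ('x \<Rightarrow> 'v) \<Rightarrow> 'x \<Rightarrow> 'b \<Rightarrow> ('n list \<times> 'ev + 'eb \<Rightarrow> real)" where
  "jet_coords c d e f x y =
     case_sum (\<lambda>(\<alpha>, u). partials \<alpha> (loc_rep c d f) (snd c x) \<bullet> u) (\<lambda>u. snd e y \<bullet> u)"

section \<open>Actions of the diffeomorphism group\<close>

definition bundle_action ::
    "('x::topological_space, 'e::real_normed_vector) atlas \<Rightarrow>
     ('v::topological_space, 'ev::real_normed_vector) atlas \<Rightarrow> ('v \<Rightarrow> 'x) \<Rightarrow>
     (('x \<Rightarrow> 'x) \<Rightarrow> 'v \<Rightarrow> 'v) \<Rightarrow> bool" where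
  "bundle_action AX AV p act \<longleftrightarrow>
     (\<forall>\<sigma>\<in>Diff AX. act \<sigma> \<in> Diff AV \<and> (\<forall>v. p (act \<sigma> v) = \<sigma> (p v))) \<and>
     (\<forall>\<sigma>\<in>Diff AX. \<forall>\<tau>\<in>Diff AX. act (\<sigma> \<circ> \<tau>) = act \<sigma> \<circ> act \<tau>)"

text \<open>
  Differential index at most \<open>k\<close>: near every diffeomorphism \<open>\<sigma>\<^sub>0\<close> and point \<open>v\<^sub>0\<close>, in suitable charts,
  \<open>\<sigma>\<^sub>V v\<close> is a smooth function of \<open>v\<close> and of the derivatives of \<open>\<sigma>\<close> up to order \<open>k\<close> at the base point
  of \<open>v\<close>.
\<close>

definition differential_index_le ::
    "('x::topological_space, real^'n) atlas \<Rightarrow> ('v, 'ev::euclidean_space) atlas \<Rightarrow>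
     ('v \<Rightarrow> 'x) \<Rightarrow> (('x \<Rightarrow> 'x) \<Rightarrow> 'v \<Rightarrow> 'v) \<Rightarrow> nat \<Rightarrow> bool" where
  "differential_index_le AX AV p act k \<longleftrightarrow>
     (\<forall>\<sigma>\<^sub>0\<in>Diff AX. \<forall>v\<^sub>0. \<exists>c\<in>AX. \<exists>d\<in>AX. \<exists>e\<in>AV. \<exists>e'\<in>AV. \<exists>S G.
        p v\<^sub>0 \<in> fst c \<and> \<sigma>\<^sub>0 (p v\<^sub>0) \<in> fst d \<and> v\<^sub>0 \<in> fst e \<and> act \<sigma>\<^sub>0 v\<^sub>0 \<in> fst e' \<and>
        smooth_coords (jet_index k) S (G :: _ \<Rightarrow> 'ev) \<and>
        jet_coords c d e \<sigma>\<^sub>0 (p v\<^sub>0) v\<^sub>0 \<in> S \<and>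
        (\<forall>\<sigma>\<in>Diff AX. \<forall>v.
           p v \<in> fst c \<and> \<sigma> (p v) \<in> fst d \<and> v \<in> fst e \<and> jet_coords c d e \<sigma> (p v) v \<in> S \<longrightarrow>
           act \<sigma> v \<in> fst e' \<and> snd e' (act \<sigma> v) = G (jet_coords c d e \<sigma> (p v) v)))"

definition act_section ::
    "(('x \<Rightarrow> 'x) \<Rightarrow> 'v \<Rightarrow> 'v) \<Rightarrow> ('x \<Rightarrow> 'x) \<Rightarrow> ('x \<Rightarrow> 'v) \<Rightarrow> ('x \<Rightarrow> 'v)" where
  "act_section act \<sigma> s = act \<sigma> \<circ> s \<circ> inv \<sigma>"

section \<open>Top forms and their integrals\<close>

text \<open>
  An element \<open>w\<close> of the fibre of the bundle of top forms over \<open>x\<close> is given by its components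
  \<open>w c\<close> in the charts \<open>c\<close> around \<open>x\<close>, i.e. it stands for \<open>w c \<cdot> dc\<^sup>0 \<and> \<dots> \<and> dc\<^sup>n\<close>; the components
  transform with the Jacobian determinant. For all other \<open>c\<close> we put \<open>w c = 0\<close>, so that equality of
  forms is equality of functions.
\<close>

type_synonym ('x, 'n) top_form = "('x, real^'n) chart \<Rightarrow> real"

definition top_forms_at :: "('x, real^'n) atlas \<Rightarrow> 'x \<Rightarrow> ('x, 'n) top_form set" where
  "top_forms_at A x = {w.
     (\<forall>c. \<not> (c \<in> A \<and> x \<in> fst c) \<longrightarrow> w c = 0) \<and>
     (\<forall>c\<in>A. \<forall>d\<in>A. x \<in> fst c \<and> x \<in> fst d \<longrightarrow>
        w c = w d * jacobian (loc_rep c d id) (snd c x))}"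

text \<open>
  \<open>\<sigma>\<^sub>* \<omega> = (\<sigma>\<^sup>-\<^sup>1)\<^sup>* \<omega>\<close>; the value does not depend on the choice of the chart around
  \<open>\<sigma>\<^sup>-\<^sup>1(y)\<close>.
\<close>

definition push_forward ::
    "('x, real^'n) atlas \<Rightarrow> ('x \<Rightarrow> 'x) \<Rightarrow> ('x \<Rightarrow> ('x, 'n) top_form) \<Rightarrow> 'x \<Rightarrow> ('x, 'n) top_form" where
  "push_forward A \<sigma> \<omega> y = (\<lambda>d.
     if d \<in> A \<and> y \<in> fst d then
       (let c = (SOME c. c \<in> A \<and> inv \<sigma> y \<in> fst c)
        in \<omega> (inv \<sigma> y) c * jacobian (loc_rep d c (inv \<sigma>)) (snd d y))
     else 0)"

text \<open>
  Integral of a top form over a compact set with respect to an oriented atlas: cut the set into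
  finitely many disjoint Borel pieces, each contained in a chart domain, and add up the integrals
  of the components.
\<close>

definition has_form_integral ::
    "('x::topological_space, real^'n) atlas \<Rightarrow> 'x set \<Rightarrow> ('x \<Rightarrow> ('x, 'n) top_form) \<Rightarrow> real \<Rightarrow> bool" where
  "has_form_integral A K \<omega> J \<longleftrightarrow>
     (\<exists>P. finite P \<and> disjoint_family_on snd P \<and> (\<Union>(c, E)\<in>P. E) = K \<and>
        (\<forall>(c, E)\<in>P. c \<in> A \<and> E \<in> sets borel \<and> E \<subseteq> fst c \<and>
           (\<lambda>z. \<omega> (chart_inv c z) c) absolutely_integrable_on (snd c ` E)) \<and>
        J = (\<Sum>(c, E)\<in>P. integral (snd c ` E) (\<lambda>z. \<omega> (chart_inv c z) c)))"

definition form_integral ::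
    "('x::topological_space, real^'n) atlas \<Rightarrow> 'x set \<Rightarrow> ('x \<Rightarrow> ('x, 'n) top_form) \<Rightarrow> real" where
  "form_integral A K \<omega> = (THE J. has_form_integral A K \<omega> J)"

section \<open>Lagrangian densities\<close>

text \<open>
  A Lagrangian density as in (A1): a smooth bundle map over \<open>X\<close> from \<open>J\<^sup>rV \<times>\<^sub>X B\<close> to the top forms.
  Smoothness is expressed in local coordinates.
\<close>

definition lagrangian ::
    "('x::topological_space, real^'n) atlas \<Rightarrow>
     ('v, 'ev::euclidean_space) atlas \<Rightarrow> ('v \<Rightarrow> 'x) \<Rightarrow>
     ('b, 'eb::euclidean_space) atlas \<Rightarrow> ('b \<Rightarrow> 'x) \<Rightarrow> nat \<Rightarrow>
     (('x, 'v) jet \<Rightarrow> 'b \<Rightarrow> ('x, 'n) top_form) \<Rightarrow> bool" where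
  "lagrangian AX AV pV AB pB r L \<longleftrightarrow>
     (\<forall>x s b. local_section AX AV pV x s \<and> pB b = x \<longrightarrow>
        L (jet AX AV pV r s x) b \<in> top_forms_at AX x) \<and>
     (\<forall>x\<^sub>0 s\<^sub>0 b\<^sub>0. local_section AX AV pV x\<^sub>0 s\<^sub>0 \<and> pB b\<^sub>0 = x\<^sub>0 \<longrightarrow>
        (\<exists>c\<in>AX. \<exists>d\<in>AV. \<exists>e\<in>AB. \<exists>S G.
           x\<^sub>0 \<in> fst c \<and> s\<^sub>0 x\<^sub>0 \<in> fst d \<and> b\<^sub>0 \<in> fst e \<and>
           smooth_coords (jet_index r) S (G :: _ \<Rightarrow> real) \<and>
           jet_coords c d e s\<^sub>0 x\<^sub>0 b\<^sub>0 \<in> S \<and>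
           (\<forall>x s b. local_section AX AV pV x s \<and> pB b = x \<and>
              x \<in> fst c \<and> s x \<in> fst d \<and> b \<in> fst e \<and> jet_coords c d e s x b \<in> S \<longrightarrow>
              L (jet AX AV pV r s x) b c = G (jet_coords c d e s x b))))"

definition covariant ::
    "('x::topological_space, real^'n) atlas \<Rightarrow>
     ('v, 'ev::euclidean_space) atlas \<Rightarrow> ('v \<Rightarrow> 'x) \<Rightarrow> (('x \<Rightarrow> 'x) \<Rightarrow> 'v \<Rightarrow> 'v) \<Rightarrow>
     ('b, 'eb::euclidean_space) atlas \<Rightarrow> ('b \<Rightarrow> 'x) \<Rightarrow> (('x \<Rightarrow> 'x) \<Rightarrow> 'b \<Rightarrow> 'b) \<Rightarrow> nat \<Rightarrow>
     (('x, 'v) jet \<Rightarrow> 'b \<Rightarrow> ('x, 'n) top_form) \<Rightarrow> bool" where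
  "covariant AX AV pV actV AB pB actB r L \<longleftrightarrow>
     (\<forall>\<sigma>\<in>Diff AX. \<forall>\<psi> chi. smooth_section AX AV pV \<psi> \<and> smooth_section AX AB pB chi \<longrightarrow>
        (\<lambda>x. L (jet AX AV pV r (act_section actV \<sigma> \<psi>) x) (act_section actB \<sigma> chi x)) =
        push_forward AX \<sigma> (\<lambda>x. L (jet AX AV pV r \<psi> x) (chi x)))"

text \<open>
  The bundle \<open>(X \<times> X') \<times>\<^sub>X V\<close>, where \<open>X'\<close> is the second copy of \<open>X\<close>, is identified with
  \<open>X' \<times> V\<close>, via \<open>((x, x'), v) \<mapsto> (x', v)\<close> where \<open>x\<close> is the base point of \<open>v\<close>. Its projection to \<open>X\<close>
  is \<open>(x', v) \<mapsto> p v\<close>, and a pair \<open>(\<eta>, \<psi>)\<close> is the section \<open>x \<mapsto> (\<eta> x, \<psi> x)\<close>.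
\<close>

abbreviation tilde_jet ::
    "('x::topological_space, real^'n) atlas \<Rightarrow> ('v, 'ev::real_normed_vector) atlas \<Rightarrow>
     ('v \<Rightarrow> 'x) \<Rightarrow> nat \<Rightarrow> ('x \<Rightarrow> 'x) \<Rightarrow> ('x \<Rightarrow> 'v) \<Rightarrow> 'x \<Rightarrow> ('x, 'x \<times> 'v) jet" where
  "tilde_jet AX AV pV r \<eta> \<psi> \<equiv> jet AX (prod_atlas AX AV) (pV \<circ> snd) r (\<lambda>x. (\<eta> x, \<psi> x))"

text \<open>
  As \<open>\<eta>\<^sup>-\<^sup>1 \<cdot> chi\<close> involves first derivatives of \<open>\<eta>\<close>, the modified Lagrangian has order \<open>max 1 r\<close>, which
  is \<open>r\<close> unless \<open>r = 0\<close>. It is only specified on jets of pairs \<open>(\<eta>, \<psi>)\<close> with \<open>\<eta>\<close> a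
  diffeomorphism.
\<close>

definition tilde_order :: "nat \<Rightarrow> nat" where
  "tilde_order r = max 1 r"

definition tilde_lagrangian ::
    "('x::topological_space, real^'n) atlas \<Rightarrow>
     ('v, 'ev::euclidean_space) atlas \<Rightarrow> ('v \<Rightarrow> 'x) \<Rightarrow> (('x \<Rightarrow> 'x) \<Rightarrow> 'b \<Rightarrow> 'b) \<Rightarrow> nat \<Rightarrow>
     (('x, 'v) jet \<Rightarrow> 'b \<Rightarrow> ('x, 'n) top_form) \<Rightarrow> ('x \<Rightarrow> 'b) \<Rightarrow>
     ('x, 'x \<times> 'v) jet \<Rightarrow> ('x, 'n) top_form" where
  "tilde_lagrangian AX AV pV actB r L chi j =
     (THE w. \<exists>x \<eta> \<psi>. \<eta> \<in> Diff AX \<and> local_section AX AV pV x \<psi> \<and>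
        j = tilde_jet AX AV pV (tilde_order r) \<eta> \<psi> x \<and>
        w = L (jet AX AV pV r \<psi> x) (act_section actB (inv \<eta>) chi x))"

section \<open>Euler--Lagrange equations\<close>

definition section_variation ::
    "('x::topological_space, 'e::real_normed_vector) atlas \<Rightarrow>
     ('v, 'ev::real_normed_vector) atlas \<Rightarrow> ('v \<Rightarrow> 'x) \<Rightarrow> ('x \<Rightarrow> 'v) \<Rightarrow>
     real \<Rightarrow> 'x set \<Rightarrow> (real \<Rightarrow> 'x \<Rightarrow> 'v) \<Rightarrow> bool" where
  "section_variation AX AV p \<psi> \<delta> K \<Psi> \<longleftrightarrow>
     0 < \<delta> \<and> compact K \<and> \<Psi> 0 = \<psi> \<and>
     (\<forall>\<epsilon>\<in>{-\<delta><..<\<delta>}. smooth_section AX AV p (\<Psi> \<epsilon>) \<and> (\<forall>x. x \<notin> K \<longrightarrow> \<Psi> \<epsilon> x = \<psi> x)) \<and>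
     smooth_map (prod_atlas real_atlas AX) AV ({-\<delta><..<\<delta>} \<times> UNIV) (\<lambda>(\<epsilon>, x). \<Psi> \<epsilon> x)"

definition diff_variation ::
    "('x::topological_space, 'e::real_normed_vector) atlas \<Rightarrow> ('x \<Rightarrow> 'x) \<Rightarrow>
     real \<Rightarrow> 'x set \<Rightarrow> (real \<Rightarrow> 'x \<Rightarrow> 'x) \<Rightarrow> bool" where
  "diff_variation AX \<eta> \<delta> K H \<longleftrightarrow>
     0 < \<delta> \<and> compact K \<and> H 0 = \<eta> \<and>
     (\<forall>\<epsilon>\<in>{-\<delta><..<\<delta>}. H \<epsilon> \<in> Diff AX \<and> (\<forall>x. x \<notin> K \<longrightarrow> H \<epsilon> x = \<eta> x)) \<and>
     smooth_map (prod_atlas real_atlas AX) AX ({-\<delta><..<\<delta>} \<times> UNIV) (\<lambda>(\<epsilon>, x). H \<epsilon> x)"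

definition EL_psi ::
    "('x::topological_space, real^'n) atlas \<Rightarrow>
     ('v, 'ev::euclidean_space) atlas \<Rightarrow> ('v \<Rightarrow> 'x) \<Rightarrow> nat \<Rightarrow>
     (('x, 'v) jet \<Rightarrow> 'b \<Rightarrow> ('x, 'n) top_form) \<Rightarrow> ('x \<Rightarrow> 'v) \<Rightarrow> ('x \<Rightarrow> 'b) \<Rightarrow> bool" where
  "EL_psi AX AV pV r L \<psi> chi \<longleftrightarrow>
     (\<forall>\<delta> K \<Psi>. section_variation AX AV pV \<psi> \<delta> K \<Psi> \<longrightarrow>
        ((\<lambda>\<epsilon>. form_integral AX K (\<lambda>x. L (jet AX AV pV r (\<Psi> \<epsilon>) x) (chi x)))
           has_real_derivative 0) (at 0))"

text \<open>In the next two definitions \<open>L\<close> is a Lagrangian on \<open>r\<close>-jets of pairs \<open>(\<eta>, \<psi>)\<close>.\<close>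

definition tilde_EL_psi ::
    "('x::topological_space, real^'n) atlas \<Rightarrow>
     ('v, 'ev::euclidean_space) atlas \<Rightarrow> ('v \<Rightarrow> 'x) \<Rightarrow> nat \<Rightarrow>
     (('x, 'x \<times> 'v) jet \<Rightarrow> ('x, 'n) top_form) \<Rightarrow> ('x \<Rightarrow> 'x) \<Rightarrow> ('x \<Rightarrow> 'v) \<Rightarrow> bool" where
  "tilde_EL_psi AX AV pV r L \<eta> \<psi> \<longleftrightarrow>
     (\<forall>\<delta> K \<Psi>. section_variation AX AV pV \<psi> \<delta> K \<Psi> \<longrightarrow>
        ((\<lambda>\<epsilon>. form_integral AX K (\<lambda>x. L (tilde_jet AX AV pV r \<eta> (\<Psi> \<epsilon>) x)))
           has_real_derivative 0) (at 0))"

definition tilde_EL_eta ::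
    "('x::topological_space, real^'n) atlas \<Rightarrow>
     ('v, 'ev::euclidean_space) atlas \<Rightarrow> ('v \<Rightarrow> 'x) \<Rightarrow> nat \<Rightarrow>
     (('x, 'x \<times> 'v) jet \<Rightarrow> ('x, 'n) top_form) \<Rightarrow> ('x \<Rightarrow> 'x) \<Rightarrow> ('x \<Rightarrow> 'v) \<Rightarrow> bool" where
  "tilde_EL_eta AX AV pV r L \<eta> \<psi> \<longleftrightarrow>
     (\<forall>\<delta> K H. diff_variation AX \<eta> \<delta> K H \<longrightarrow>
        ((\<lambda>\<epsilon>. form_integral AX K (\<lambda>x. L (tilde_jet AX AV pV r (H \<epsilon>) \<psi> x)))
           has_real_derivative 0) (at 0))"

end

theory Submission
  imports Defs
begin

text \<open>
  Part (i): the modified Lagrangian at \<open>(\<eta>, \<psi>)\<close> is \<open>L(j\<psi>; \<eta>\<^sup>-\<^sup>1 \<cdot> chi)\<close>. It is a well-defined function of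
  jets because, the differential index being at most \<open>1\<close>, the value of \<open>\<eta>\<^sup>-\<^sup>1 \<cdot> chi\<close> at \<open>x\<close> is determined by
  the \<open>1\<close>-jet of \<open>\<eta>\<close> at \<open>x\<close>. So both Euler--Lagrange equations for \<open>\<psi>\<close> are about the same integrals.

  Part (ii): let \<open>H\<^sub>\<epsilon>\<close> be a variation of \<open>\<eta>\<close>, \<open>\<sigma>\<^sub>\<epsilon> = \<eta>\<^sup>-\<^sup>1 \<circ> H\<^sub>\<epsilon>\<close> and \<open>chi\<^sub>0 = \<eta>\<^sup>-\<^sup>1 \<cdot> chi\<close>. By covariance
  \<open>L(j\<psi>; H\<^sub>\<epsilon>\<^sup>-\<^sup>1 \<cdot> chi) = L(j\<psi>; \<sigma>\<^sub>\<epsilon>\<^sup>-\<^sup>1 \<cdot> chi\<^sub>0)\<close> is the push-forward along \<open>\<sigma>\<^sub>\<epsilon>\<^sup>-\<^sup>1\<close> of \<open>L(j(\<sigma>\<^sub>\<epsilon> \<cdot> \<psi>); chi\<^sub>0)\<close>.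
  As \<open>\<sigma>\<^sub>\<epsilon>\<close> maps the compact set \<open>K\<close> onto itself and preserves the orientation (it is joined to the identity
  by a path of diffeomorphisms), both forms have the same integral over \<open>K\<close>. Hence varying \<open>\<eta>\<close> amounts to
  the variation \<open>\<sigma>\<^sub>\<epsilon> \<cdot> \<psi>\<close> of \<open>\<psi>\<close>, for which the derivative vanishes. That \<open>\<sigma>\<^sub>\<epsilon> \<cdot> \<psi>\<close> is smooth in \<open>\<epsilon>\<close> and \<open>x\<close>
  jointly follows from the finite differential index and the smoothness of \<open>\<sigma>\<^sub>\<epsilon>\<^sup>-\<^sup>1\<close> in \<open>\<epsilon>\<close> and \<open>x\<close>.
\<close>

section \<open>\<open>C\<^sup>k\<close> calculus\<close>


text \<open>\<open>Diff AX\<close> carries no smooth structure: an action is accessible only through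
  functions \<open>G\<close> of finitely many jet coordinates, which live on a function space with
  the product topology. Hence a chain rule for such \<open>G\<close> is needed, together with joint
  smoothness in (\<epsilon>, x) of the coordinate derivatives of a family of diffeomorphisms and of
  its inverses.

  Finite differential index also makes the action local: where a diffeomorphism is the identity near
  x, it acts as the identity on the fibre over x. This keeps the induced variation of \<psi>
  supported in the same compact set.

  \<open>form_integral\<close> is a definite description. The integrals are therefore compared
  through \<open>has_form_integral\<close>: a partition that witnesses a value \<open>J\<close> for
  one form is transported to a partition that witnesses the same \<open>J\<close> for the other, in
  both directions, so that the descriptions coincide.

  For each small \<epsilon> the two integrals are equal numbers. The vanishing derivative passes
  from one to the other as a property of equal functions near 0, with no differentiation under the
  integral sign.\<close>

lemma Ck_on_subset: "Ck_on k S f \<Longrightarrow> T \<subseteq> S \<Longrightarrow> Ck_on k T f"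
proof (induction k arbitrary: f)
  case 0
  then show ?case using continuous_on_subset by auto
next
  case (Suc k)
  then show ?case unfolding Ck_on.simps(2) by blast
qed

lemma frechet_derivative_cong_open:
  assumes "open S" "x \<in> S" "\<And>y. y \<in> S \<Longrightarrow> f y = g y"
  shows "frechet_derivative f (at x) = frechet_derivative g (at x)"
proof -
  have "(f has_derivative D) (at x) \<longleftrightarrow> (g has_derivative D) (at x)" for D
    using has_derivative_transform_within_open[OF _ assms(1,2), of f D UNIV g]
      has_derivative_transform_within_open[OF _ assms(1,2), of g D UNIV f] assms(3) by auto
  then show ?thesis unfolding frechet_derivative_def by simp
qed

lemma differentiable_cong_open:
  assumes "open S" "x \<in> S" "\<And>y. y \<in> S \<Longrightarrow> f y = g y" "f differentiable (at x)"
  shows "g differentiable (at x)"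
  using has_derivative_transform_within_open[OF _ assms(1,2), of f _ UNIV g] assms(3,4)
  unfolding differentiable_def by blast

lemma Ck_on_cong:
  assumes "open S" "\<And>x. x \<in> S \<Longrightarrow> f x = g x" "Ck_on k S f"
  shows "Ck_on k S g"
  using assms(2,3)
proof (induction k arbitrary: f g)
  case 0
  then show ?case using continuous_on_cong[of S S f g] by simp
next
  case (Suc k)
  have "Ck_on k S (\<lambda>x. frechet_derivative g (at x) v)" for v
  proof (rule Suc.IH)
    show "frechet_derivative f (at x) v = frechet_derivative g (at x) v" if "x \<in> S" for x
      using frechet_derivative_cong_open[OF assms(1) that, of f g] Suc.prems(1) by simp
  qed (use Suc.prems in simp)
  moreover have "g differentiable (at x)" if "x \<in> S" for x
    using differentiable_cong_open[OF assms(1) that, of f g] Suc.prems that by auto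
  ultimately show ?case by simp
qed

lemma Ck_on_local:
  assumes "\<And>x. x \<in> S \<Longrightarrow> \<exists>T. open T \<and> x \<in> T \<and> Ck_on k T f"
  shows "Ck_on k S f"
  using assms
proof (induction k arbitrary: f)
  case 0
  have "isCont f x" if "x \<in> S" for x
    using 0[OF that] by (auto simp: continuous_on_eq_continuous_at)
  then show ?case by (simp add: continuous_at_imp_continuous_on)
next
  case (Suc k)
  have "Ck_on k S (\<lambda>x. frechet_derivative f (at x) v)" for v
    by (rule Suc.IH) (use Suc.prems in fastforce)
  then show ?case unfolding Ck_on.simps(2) using Suc.prems by (metis Ck_on.simps(2))
qed

text \<open>The working form of the step from \<open>k\<close> to \<open>Suc k\<close>: an explicit
  pointwise derivative may stand in for \<open>frechet_derivative\<close>, since both agree on the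
  open set by uniqueness. Most closure rules below follow from it by induction on
  \<open>k\<close>.\<close>

lemma Ck_on_SucI:
  assumes "open S" "\<And>x. x \<in> S \<Longrightarrow> (f has_derivative f' x) (at x)"
    and "\<And>v. Ck_on k S (\<lambda>x. f' x v)"
  shows "Ck_on (Suc k) S f"
proof -
  have "Ck_on k S (\<lambda>x. frechet_derivative f (at x) v)" for v
    by (rule Ck_on_cong[OF assms(1) _ assms(3)[of v]])
      (simp add: frechet_derivative_at[OF assms(2), symmetric])
  then show ?thesis using assms(2) by (auto simp: differentiable_def)
qed

lemma Ck_on_has_derivative:
  assumes "Ck_on (Suc k) S f" "x \<in> S"
  shows "(f has_derivative frechet_derivative f (at x)) (at x)"
  using assms frechet_derivative_works by auto

lemma Ck_on_Suc_imp: "Ck_on (Suc k) S f \<Longrightarrow> Ck_on k S f"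
proof (induction k arbitrary: f)
  case 0
  then show ?case
    by (simp add: continuous_at_imp_continuous_on differentiable_imp_continuous_within)
next
  case (Suc k)
  show ?case unfolding Ck_on.simps(2)
  proof (intro conjI allI)
    show "Ck_on k S (\<lambda>x. frechet_derivative f (at x) v)" for v
      by (rule Suc.IH) (use Suc.prems in simp)
  qed (use Suc.prems in simp)
qed

lemma Ck_on_imp_continuous_on: "Ck_on k S f \<Longrightarrow> continuous_on S f"
proof (induction k)
  case (Suc k)
  then show ?case using Ck_on_Suc_imp by blast
qed simp

lemma Ck_on_const:
  assumes "open S"
  shows "Ck_on k S (\<lambda>x. a)"
proof (induction k arbitrary: a)
  case (Suc k)
  show ?case by (rule Ck_on_SucI[where f'="\<lambda>x v. 0"]) (simp_all add: assms Suc)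
qed simp

lemma Ck_on_bounded_linear:
  assumes "open S" "bounded_linear h" "Ck_on k S f"
  shows "Ck_on k S (\<lambda>x. h (f x))"
  using assms(3)
proof (induction k arbitrary: f)
  case 0
  then show ?case using bounded_linear.continuous_on[OF assms(2)] by simp
next
  case (Suc k)
  show ?case
  proof (rule Ck_on_SucI[where f'="\<lambda>x v. h (frechet_derivative f (at x) v)"])
    show "((\<lambda>x. h (f x)) has_derivative (\<lambda>v. h (frechet_derivative f (at x) v))) (at x)"
      if "x \<in> S" for x
      using bounded_linear.has_derivative[OF assms(2) Ck_on_has_derivative[OF Suc.prems that]] .
    show "Ck_on k S (\<lambda>x. h (frechet_derivative f (at x) v))" for v
      by (rule Suc.IH) (use Suc.prems in simp)
  qed (rule assms(1))
qed

lemma Ck_on_ident: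
  assumes "open S"
  shows "Ck_on k S (\<lambda>x. x)"
proof (cases k)
  case (Suc l)
  show ?thesis unfolding Suc
    by (rule Ck_on_SucI[where f'="\<lambda>x v. v"]) (simp_all add: assms Ck_on_const)
qed simp

lemma Ck_on_linear: "open S \<Longrightarrow> bounded_linear h \<Longrightarrow> Ck_on k S h"
  using Ck_on_bounded_linear[OF _ _ Ck_on_ident] .

lemma Ck_on_add:
  assumes "open S" "Ck_on k S f" "Ck_on k S g"
  shows "Ck_on k S (\<lambda>x. f x + g x)"
  using assms(2,3)
proof (induction k arbitrary: f g)
  case 0
  then show ?case by (auto intro: continuous_intros)
next
  case (Suc k)
  show ?case
  proof (rule Ck_on_SucI[where f'="\<lambda>x v. frechet_derivative f (at x) v + frechet_derivative g (at x) v"])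
    show "((\<lambda>x. f x + g x) has_derivative
        (\<lambda>v. frechet_derivative f (at x) v + frechet_derivative g (at x) v)) (at x)"
      if "x \<in> S" for x
      using has_derivative_add[OF Ck_on_has_derivative[OF Suc.prems(1) that]
          Ck_on_has_derivative[OF Suc.prems(2) that]] .
    show "Ck_on k S (\<lambda>x. frechet_derivative f (at x) v + frechet_derivative g (at x) v)" for v
      by (rule Suc.IH) (use Suc.prems in simp_all)
  qed (rule assms(1))
qed

lemma Ck_on_sum:
  assumes "open S" "\<And>i. i \<in> I \<Longrightarrow> Ck_on k S (f i)"
  shows "Ck_on k S (\<lambda>x. \<Sum>i\<in>I. f i x)"
  using assms
  by (induction I rule: infinite_finite_induct) (auto intro: Ck_on_const Ck_on_add)

lemma Ck_on_bilinear:
  assumes "open S" "bounded_bilinear b" "Ck_on k S f" "Ck_on k S g"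
  shows "Ck_on k S (\<lambda>x. b (f x) (g x))"
  using assms(3,4)
proof (induction k arbitrary: f g)
  case 0
  then show ?case using bounded_bilinear.continuous_on[OF assms(2)] by auto
next
  case (Suc k)
  let ?f' = "\<lambda>x. frechet_derivative f (at x)" and ?g' = "\<lambda>x. frechet_derivative g (at x)"
  show ?case
  proof (rule Ck_on_SucI[where f'="\<lambda>x v. b (f x) (?g' x v) + b (?f' x v) (g x)"])
    show "((\<lambda>x. b (f x) (g x)) has_derivative (\<lambda>v. b (f x) (?g' x v) + b (?f' x v) (g x))) (at x)"
      if "x \<in> S" for x
      using bounded_bilinear.FDERIV[OF assms(2) Ck_on_has_derivative[OF Suc.prems(1) that]
          Ck_on_has_derivative[OF Suc.prems(2) that]] .
    show "Ck_on k S (\<lambda>x. b (f x) (?g' x v) + b (?f' x v) (g x))" for v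
    proof (rule Ck_on_add[OF assms(1)])
      show "Ck_on k S (\<lambda>x. b (f x) (?g' x v))"
        by (rule Suc.IH[OF Ck_on_Suc_imp[OF Suc.prems(1)]]) (use Suc.prems in simp)
      show "Ck_on k S (\<lambda>x. b (?f' x v) (g x))"
        by (rule Suc.IH[OF _ Ck_on_Suc_imp[OF Suc.prems(2)]]) (use Suc.prems in simp)
    qed
  qed (rule assms(1))
qed

lemmas Ck_on_mult = Ck_on_bilinear[OF _ bounded_bilinear_mult]
lemmas Ck_on_scaleR = Ck_on_bilinear[OF _ bounded_bilinear_scaleR]

lemma Ck_on_prod:
  fixes f :: "'i \<Rightarrow> 'a::real_normed_vector \<Rightarrow> real"
  assumes "open S" "\<And>i. i \<in> I \<Longrightarrow> Ck_on k S (f i)"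
  shows "Ck_on k S (\<lambda>x. \<Prod>i\<in>I. f i x)"
  using assms(2)
proof (induction I rule: infinite_finite_induct)
  case (insert i I)
  have "Ck_on k S (\<lambda>x. f i x * (\<Prod>i\<in>I. f i x))"
    using insert by (intro Ck_on_mult assms(1)) simp_all
  then show ?case using insert by simp
qed (simp_all add: Ck_on_const[OF assms(1)])

text \<open>Up to sign, the derivative of \<open>1/f\<close> is the derivative of \<open>f\<close>
  times two factors \<open>1/f\<close>, and the induction hypothesis covers these factors.\<close>

lemma Ck_on_inverse:
  fixes f :: "'a::real_normed_vector \<Rightarrow> real"
  assumes "open S" "Ck_on k S f" "\<And>x. x \<in> S \<Longrightarrow> f x \<noteq> 0"
  shows "Ck_on k S (\<lambda>x. inverse (f x))"
  using assms(2)
proof (induction k)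
  case 0
  then show ?case using assms(3) by (auto intro!: continuous_intros)
next
  case (Suc k)
  let ?f' = "\<lambda>x. frechet_derivative f (at x)"
  show ?case
  proof (rule Ck_on_SucI[where f'="\<lambda>x v. - (inverse (f x) * ?f' x v * inverse (f x))"])
    show "((\<lambda>x. inverse (f x)) has_derivative (\<lambda>v. - (inverse (f x) * ?f' x v * inverse (f x)))) (at x)"
      if "x \<in> S" for x
      using Deriv.has_derivative_inverse[OF assms(3)[OF that] Ck_on_has_derivative[OF Suc.prems that]] .
    show "Ck_on k S (\<lambda>x. - (inverse (f x) * ?f' x v * inverse (f x)))" for v
    proof -
      have "Ck_on k S (\<lambda>x. ?f' x v)" using Suc.prems by simp
      then show ?thesis
        by (intro Ck_on_bounded_linear[where h="\<lambda>x::real. - x"] Ck_on_mult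
          bounded_linear_minus bounded_linear_ident assms(1) Suc.IH Ck_on_Suc_imp[OF Suc.prems])
    qed
  qed (rule assms(1))
qed

lemma Ck_on_Pair:
  assumes "open S" "Ck_on k S f" "Ck_on k S g"
  shows "Ck_on k S (\<lambda>x. (f x, g x))"
proof -
  have "Ck_on k S (\<lambda>x. (f x, 0) + (0, g x))"
    by (intro Ck_on_add assms Ck_on_bounded_linear[OF _ _ assms(2)] Ck_on_bounded_linear[OF _ _ assms(3)]
        bounded_linear_Pair bounded_linear_ident bounded_linear_zero)
  then show ?thesis by simp
qed

text \<open>\<open>Ck_on\<close> controls derivatives of \<open>g\<close> in fixed directions only,
  whereas the chain rule differentiates \<open>g\<close> in the direction \<open>?f' x v\<close>,
  which moves with \<open>x\<close>. Expanding that direction in \<open>Basis\<close> leaves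
  finitely many fixed ones; this is why the intermediate space is Euclidean.\<close>

lemma Ck_on_compose:
  fixes g :: "'b::euclidean_space \<Rightarrow> 'c::real_normed_vector"
  assumes "open S" "Ck_on k S f" "Ck_on k T g" "f ` S \<subseteq> T"
  shows "Ck_on k S (\<lambda>x. g (f x))"
  using assms(2,3)
proof (induction k arbitrary: g)
  case 0
  then show ?case using assms(4) by (auto intro: continuous_on_compose2)
next
  case (Suc k)
  let ?f' = "\<lambda>x. frechet_derivative f (at x)" and ?g' = "\<lambda>x. frechet_derivative g (at x)"
  show ?case
  proof (rule Ck_on_SucI[where f'="\<lambda>x v. \<Sum>b\<in>Basis. (?f' x v \<bullet> b) *\<^sub>R ?g' (f x) b"])
    fix x assume x: "x \<in> S"
    then have fx: "f x \<in> T" using assms(4) by auto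
    have D: "((\<lambda>x. g (f x)) has_derivative (\<lambda>v. ?g' (f x) (?f' x v))) (at x)"
      using diff_chain_at[OF Ck_on_has_derivative[OF Suc.prems(1) x] Ck_on_has_derivative[OF Suc.prems(2) fx]]
      by (simp add: o_def)
    have eq: "?g' (f x) w = (\<Sum>b\<in>Basis. (w \<bullet> b) *\<^sub>R ?g' (f x) b)" for w
    proof -
      have l: "linear (?g' (f x))"
        using Ck_on_has_derivative[OF Suc.prems(2) fx] has_derivative_linear by blast
      have "?g' (f x) (\<Sum>b\<in>Basis. (w \<bullet> b) *\<^sub>R b) = (\<Sum>b\<in>Basis. ?g' (f x) ((w \<bullet> b) *\<^sub>R b))"
        by (rule linear_sum[OF l])
      then show ?thesis by (simp only: linear_cmul[OF l] euclidean_representation)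
    qed
    show "((\<lambda>x. g (f x)) has_derivative
        (\<lambda>v. \<Sum>b\<in>Basis. (?f' x v \<bullet> b) *\<^sub>R ?g' (f x) b)) (at x)"
      unfolding eq[symmetric] by (rule D)
  next
    fix v
    have "Ck_on k S (\<lambda>x. (?f' x v \<bullet> b))" for b
      by (rule Ck_on_bounded_linear[OF assms(1) bounded_linear_inner_left]) (use Suc.prems in simp)
    moreover have "Ck_on k S (\<lambda>x. ?g' (f x) b)" for b
      by (rule Suc.IH[OF Ck_on_Suc_imp[OF Suc.prems(1)], of "\<lambda>x. ?g' x b"]) (use Suc.prems(2) in simp)
    ultimately show "Ck_on k S (\<lambda>x. \<Sum>b\<in>Basis. (?f' x v \<bullet> b) *\<^sub>R ?g' (f x) b)"
      by (intro Ck_on_sum Ck_on_scaleR assms(1))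
  qed (rule assms(1))
qed

section \<open>Calculus of smooth maps between normed spaces\<close>

lemma smooth_on_subset: "smooth_on S f \<Longrightarrow> T \<subseteq> S \<Longrightarrow> smooth_on T f"
  by (auto simp: smooth_on_def intro: Ck_on_subset)

lemma smooth_on_cong:
  "open S \<Longrightarrow> smooth_on S f \<Longrightarrow> (\<And>x. x \<in> S \<Longrightarrow> f x = g x) \<Longrightarrow> smooth_on S g"
  unfolding smooth_on_def using Ck_on_cong[of S f g] by blast

lemma smooth_on_local:
  "(\<And>x. x \<in> S \<Longrightarrow> \<exists>T. open T \<and> x \<in> T \<and> smooth_on T f) \<Longrightarrow> smooth_on S f"
  unfolding smooth_on_def using Ck_on_local by meson

lemma smooth_on_compose:
  fixes g :: "'b::euclidean_space \<Rightarrow> 'c::real_normed_vector"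
  shows "open S \<Longrightarrow> smooth_on S f \<Longrightarrow> smooth_on T g \<Longrightarrow> f ` S \<subseteq> T \<Longrightarrow> smooth_on S (\<lambda>x. g (f x))"
  unfolding smooth_on_def using Ck_on_compose by blast

lemma smooth_on_Pair:
  "open S \<Longrightarrow> smooth_on S f \<Longrightarrow> smooth_on S g \<Longrightarrow> smooth_on S (\<lambda>x. (f x, g x))"
  unfolding smooth_on_def using Ck_on_Pair by blast

lemma smooth_on_linear: "open S \<Longrightarrow> bounded_linear h \<Longrightarrow> smooth_on S h"
  unfolding smooth_on_def using Ck_on_linear by blast

lemma smooth_on_bounded_linear:
  "open S \<Longrightarrow> bounded_linear h \<Longrightarrow> smooth_on S f \<Longrightarrow> smooth_on S (\<lambda>x. h (f x))"
  unfolding smooth_on_def using Ck_on_bounded_linear by blast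

lemma smooth_on_ident: "open S \<Longrightarrow> smooth_on S (\<lambda>x. x)"
  unfolding smooth_on_def using Ck_on_ident by blast

lemma smooth_on_imp_continuous_on: "smooth_on S f \<Longrightarrow> continuous_on S f"
  unfolding smooth_on_def using Ck_on_imp_continuous_on by blast

lemma smooth_on_imp_differentiable: "smooth_on S f \<Longrightarrow> x \<in> S \<Longrightarrow> f differentiable (at x)"
  unfolding smooth_on_def by (metis Ck_on.simps(2))

lemma smooth_on_has_derivative:
  "smooth_on S f \<Longrightarrow> x \<in> S \<Longrightarrow> (f has_derivative frechet_derivative f (at x)) (at x)"
  using smooth_on_imp_differentiable frechet_derivative_works by blast

lemma smooth_on_derivative: "smooth_on S f \<Longrightarrow> smooth_on S (\<lambda>x. frechet_derivative f (at x) v)"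
  unfolding smooth_on_def by (metis Ck_on.simps(2))

section \<open>Charts and smooth maps\<close>


lemma
  assumes "smooth_manifold A" "c \<in> A"
  shows chart_open: "open (fst c)"
    and chart_image_open: "open (snd c ` fst c)"
    and chart_homeomorphism: "homeomorphism (fst c) (snd c ` fst c) (snd c) (chart_inv c)"
  using assms unfolding smooth_manifold_def by blast+

lemma chart_transition:
  assumes "smooth_manifold A" "c \<in> A" "d \<in> A"
  shows "smooth_on (snd c ` (fst c \<inter> fst d)) (loc_rep c d id)"
  using assms unfolding smooth_manifold_def by blast

lemma chart_exists:
  assumes "smooth_manifold A"
  obtains c where "c \<in> A" "x \<in> fst c"
proof -
  have "x \<in> \<Union> (fst ` A)" using assms unfolding smooth_manifold_def by blast
  then show ?thesis using that by blast
qed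

lemma chart_inj: "smooth_manifold A \<Longrightarrow> c \<in> A \<Longrightarrow> inj_on (snd c) (fst c)"
  by (rule inj_on_inverseI[where g="chart_inv c"]) (rule homeomorphism_apply1[OF chart_homeomorphism])

lemma chart_inv_chart:
  "smooth_manifold A \<Longrightarrow> c \<in> A \<Longrightarrow> x \<in> fst c \<Longrightarrow> chart_inv c (snd c x) = x"
  using homeomorphism_apply1[OF chart_homeomorphism] .

lemma chart_open_image:
  assumes "smooth_manifold A" "c \<in> A" "open W" "W \<subseteq> fst c"
  shows "open (snd c ` W)"
proof -
  have "openin (top_of_set (fst c)) W"
    using assms by (simp add: open_openin_trans open_subset)
  then have "openin (top_of_set (snd c ` fst c)) (snd c ` W)"
    using homeomorphism_imp_open_map[OF chart_homeomorphism] assms(1,2) by blast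
  then show ?thesis
    using openin_open_trans chart_image_open assms(1,2) by blast
qed

lemma chart_continuous_on:
  assumes "smooth_manifold A" "c \<in> A" "W \<subseteq> fst c"
  shows "continuous_on W (snd c)"
  using homeomorphism_cont1[OF chart_homeomorphism[OF assms(1,2)]] assms(3) continuous_on_subset
  by blast

lemma chart_inv_continuous_on:
  assumes "smooth_manifold A" "c \<in> A" "W \<subseteq> snd c ` fst c"
  shows "continuous_on W (chart_inv c)"
  using homeomorphism_cont2[OF chart_homeomorphism[OF assms(1,2)]] assms(3) continuous_on_subset
  by blast

lemma loc_rep_apply:
  assumes "smooth_manifold A" "c \<in> A" "x \<in> fst c"
  shows "loc_rep c d f (snd c x) = snd d (f x)"
  using chart_inv_chart[OF assms] by (simp add: loc_rep_def)

lemma smooth_map_subset: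
  assumes "smooth_manifold A" "smooth_map A B U f" "open V" "V \<subseteq> U"
  shows "smooth_map A B V f"
  unfolding smooth_map_def
proof
  fix x assume x: "x \<in> V"
  then obtain c d W where W: "c \<in> A" "d \<in> B" "open W" "x \<in> W" "W \<subseteq> U \<inter> fst c" "f ` W \<subseteq> fst d"
      "smooth_on (snd c ` W) (loc_rep c d f)"
    using assms(2,4) unfolding smooth_map_def by blast
  have "smooth_on (snd c ` (W \<inter> V)) (loc_rep c d f)"
    by (rule smooth_on_subset[OF W(7)]) blast
  then show "\<exists>c\<in>A. \<exists>d\<in>B. \<exists>W. open W \<and> x \<in> W \<and> W \<subseteq> V \<inter> fst c \<and> f ` W \<subseteq> fst d \<and>
      smooth_on (snd c ` W) (loc_rep c d f)"
    using W x assms(3) by (intro bexI[of _ c] bexI[of _ d] exI[of _ "W \<inter> V"] conjI open_Int) auto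
qed

lemma smooth_map_continuous_on:
  assumes "smooth_manifold A" "smooth_manifold B" "smooth_map A B U f"
  shows "continuous_on U f"
proof (intro continuous_at_imp_continuous_on ballI)
  fix x assume x: "x \<in> U"
  then obtain c d W where W: "c \<in> A" "d \<in> B" "open W" "x \<in> W" "W \<subseteq> U \<inter> fst c" "f ` W \<subseteq> fst d"
      "smooth_on (snd c ` W) (loc_rep c d f)"
    using assms(3) unfolding smooth_map_def by blast
  have in_c: "y \<in> fst c" if "y \<in> W" for y using W(5) that by blast
  have im: "loc_rep c d f ` snd c ` W \<subseteq> snd d ` fst d"
    using W(6) loc_rep_apply[OF assms(1) W(1) in_c, of _ d f] by auto
  have "continuous_on W (\<lambda>y. chart_inv d (loc_rep c d f (snd c y)))"
    using im W(5)
    by (intro continuous_on_compose2[OF chart_inv_continuous_on[OF assms(2) W(2) order_refl]]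
        continuous_on_compose2[OF smooth_on_imp_continuous_on[OF W(7)]]
        chart_continuous_on[OF assms(1) W(1)]) auto
  then have "continuous_on W f"
    using W(6) loc_rep_apply[OF assms(1) W(1) in_c, of _ d f] chart_inv_chart[OF assms(2) W(2)]
    by (subst continuous_on_cong[OF refl, of _ _ "\<lambda>y. chart_inv d (loc_rep c d f (snd c y))"])
      (auto simp: image_subset_iff)
  then show "isCont f x" using W(3,4) continuous_on_eq_continuous_at by blast
qed

text \<open>The definition of \<^const>\<open>smooth_map\<close> only provides some charts; the transition maps being
  smooth, all charts will do.\<close>

lemma smooth_map_loc_rep:
  fixes A :: "('a::{t2_space,second_countable_topology}, 'ea::euclidean_space) atlas"
    and B :: "('b::{t2_space,second_countable_topology}, 'eb::euclidean_space) atlas"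
  assumes A: "smooth_manifold A" and B: "smooth_manifold B" and f: "smooth_map A B U f"
    and c: "c \<in> A" and d: "d \<in> B" and W: "open W" "W \<subseteq> U" "W \<subseteq> fst c" "f ` W \<subseteq> fst d"
  shows "smooth_on (snd c ` W) (loc_rep c d f)"
proof (rule smooth_on_local)
  fix z assume "z \<in> snd c ` W"
  then obtain x where x: "x \<in> W" "z = snd c x" by blast
  then obtain c' d' W' where W': "c' \<in> A" "d' \<in> B" "open W'" "x \<in> W'" "W' \<subseteq> U \<inter> fst c'"
      "f ` W' \<subseteq> fst d'" "smooth_on (snd c' ` W') (loc_rep c' d' f)"
    using f W(2) unfolding smooth_map_def by blast
  define T where "T = W \<inter> W'"
  have T: "open T" "T \<subseteq> fst c" "T \<subseteq> fst c'" "f ` T \<subseteq> fst d" "f ` T \<subseteq> fst d'" "x \<in> T"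
    using W W' x by (auto simp: T_def)
  have oT: "open (snd c ` T)" "open (snd c' ` T)"
    using chart_open_image[OF A c T(1,2)] chart_open_image[OF A W'(1) T(1,3)] by auto
  have s1: "smooth_on (snd c ` T) (loc_rep c c' id)"
    by (rule smooth_on_subset[OF chart_transition[OF A c W'(1)]]) (use T in blast)
  have s2: "smooth_on (snd c' ` T) (loc_rep c' d' f)"
    by (rule smooth_on_subset[OF W'(7)]) (auto simp: T_def)
  have s3: "smooth_on (snd d' ` (fst d' \<inter> fst d)) (loc_rep d' d id)"
    by (rule chart_transition[OF B W'(2) d])
  have e1: "loc_rep c c' id (snd c y) = snd c' y" if "y \<in> T" for y
    using loc_rep_apply[OF A c, of y c' id] that T(2) by auto
  have e2: "loc_rep c' d' f (snd c' y) = snd d' (f y)" if "y \<in> T" for y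
    using loc_rep_apply[OF A W'(1), of y d' f] that T(3) by auto
  have e3: "loc_rep d' d id (snd d' (f y)) = snd d (f y)" if "y \<in> T" for y
    using loc_rep_apply[OF B W'(2), of "f y" d id] that T(5) by auto
  have "smooth_on (snd c ` T) (\<lambda>z. loc_rep d' d id (loc_rep c' d' f (loc_rep c c' id z)))"
  proof (rule smooth_on_compose[OF oT(1) _ s3])
    show "smooth_on (snd c ` T) (\<lambda>z. loc_rep c' d' f (loc_rep c c' id z))"
      by (rule smooth_on_compose[OF oT(1) s1 s2]) (use e1 in auto)
    show "(\<lambda>z. loc_rep c' d' f (loc_rep c c' id z)) ` snd c ` T \<subseteq> snd d' ` (fst d' \<inter> fst d)"
      using e1 e2 T(4,5) by (auto simp: image_subset_iff)
  qed
  then have "smooth_on (snd c ` T) (loc_rep c d f)"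
    by (rule smooth_on_cong[OF oT(1)]) (use e1 e2 e3 loc_rep_apply[OF A c, of _ d f] T(2) in auto)
  then show "\<exists>T. open T \<and> z \<in> T \<and> smooth_on T (loc_rep c d f)"
    using oT(1) T(6) x(2) by blast
qed

text \<open>Converse of \<open>smooth_map_loc_rep\<close>. Continuity provides, around each point,
  an open \<open>W\<close> that \<open>f\<close> sends into a single chart domain.\<close>

lemma smooth_mapI:
  assumes A: "smooth_manifold A" and B: "smooth_manifold B" and "open U" and cont: "continuous_on U f"
    and sm: "\<And>c d W. c \<in> A \<Longrightarrow> d \<in> B \<Longrightarrow> open W \<Longrightarrow> W \<subseteq> U \<Longrightarrow> W \<subseteq> fst c \<Longrightarrow>
      f ` W \<subseteq> fst d \<Longrightarrow> smooth_on (snd c ` W) (loc_rep c d f)"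
  shows "smooth_map A B U f"
  unfolding smooth_map_def
proof
  fix x assume x: "x \<in> U"
  obtain c where c: "c \<in> A" "x \<in> fst c" using chart_exists[OF A] .
  obtain d where d: "d \<in> B" "f x \<in> fst d" using chart_exists[OF B] .
  define W where "W = (U \<inter> f -` fst d) \<inter> fst c"
  have W: "open W" "W \<subseteq> U" "W \<subseteq> fst c" "f ` W \<subseteq> fst d" "x \<in> W"
    unfolding W_def
    using continuous_open_preimage[OF cont assms(3) chart_open[OF B d(1)]] chart_open[OF A c(1)] x c d
    by auto
  show "\<exists>c\<in>A. \<exists>d\<in>B. \<exists>W. open W \<and> x \<in> W \<and> W \<subseteq> U \<inter> fst c \<and> f ` W \<subseteq> fst d \<and>
      smooth_on (snd c ` W) (loc_rep c d f)"
    using sm[OF c(1) d(1) W(1-4)] W c d by blast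
qed

lemma smooth_map_compose:
  fixes A :: "('a::{t2_space,second_countable_topology}, 'ea::euclidean_space) atlas"
    and B :: "('b::{t2_space,second_countable_topology}, 'eb::euclidean_space) atlas"
    and C :: "('c::{t2_space,second_countable_topology}, 'ec::euclidean_space) atlas"
  assumes A: "smooth_manifold A" and B: "smooth_manifold B" and C: "smooth_manifold C"
    and f: "smooth_map A B U f" and g: "smooth_map B C V g" and "open U" "open V" "f ` U \<subseteq> V"
  shows "smooth_map A C U (\<lambda>x. g (f x))"
proof (rule smooth_mapI[OF A C \<open>open U\<close>])
  have cf: "continuous_on U f" using smooth_map_continuous_on[OF A B f] .
  have cg: "continuous_on V g" using smooth_map_continuous_on[OF B C g] .
  show "continuous_on U (\<lambda>x. g (f x))"
    using continuous_on_compose2[OF cg cf assms(8)] .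
  fix c e W assume c: "c \<in> A" and e: "e \<in> C" and W: "open W" "W \<subseteq> U" "W \<subseteq> fst c"
    and gfW: "(\<lambda>x. g (f x)) ` W \<subseteq> fst e"
  show "smooth_on (snd c ` W) (loc_rep c e (\<lambda>x. g (f x)))"
  proof (rule smooth_on_local)
    fix z assume "z \<in> snd c ` W"
    then obtain x where x: "x \<in> W" "z = snd c x" by blast
    obtain d where d: "d \<in> B" "f x \<in> fst d" using chart_exists[OF B] .
    define N where "N = (V \<inter> g -` fst e) \<inter> fst d"
    have N: "open N" "N \<subseteq> V" "N \<subseteq> fst d" "g ` N \<subseteq> fst e"
      using continuous_open_preimage[OF cg assms(7) chart_open[OF C e]] chart_open[OF B d(1)]
      unfolding N_def by auto
    define T where "T = (U \<inter> f -` N) \<inter> W"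
    have T: "open T" "T \<subseteq> U" "T \<subseteq> fst c" "f ` T \<subseteq> fst d" "f ` T \<subseteq> N"
      using continuous_open_preimage[OF cf assms(6) N(1)] W N unfolding T_def by auto
    have xT: "x \<in> T" using x W(2) d gfW assms(8) unfolding T_def N_def by auto
    have oT: "open (snd c ` T)" using chart_open_image[OF A c T(1,3)] .
    have e1: "loc_rep c d f (snd c y) = snd d (f y)" if "y \<in> T" for y
      using loc_rep_apply[OF A c, of y d f] that T(3) by auto
    have e2: "loc_rep d e g (snd d (f y)) = snd e (g (f y))" if "y \<in> T" for y
      using loc_rep_apply[OF B d(1), of "f y" e g] that T(4) by auto
    have "smooth_on (snd c ` T) (\<lambda>z. loc_rep d e g (loc_rep c d f z))"
      by (rule smooth_on_compose[OF oT smooth_map_loc_rep[OF A B f c d(1) T(1-4)]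
            smooth_map_loc_rep[OF B C g d(1) e N]])
        (use e1 T(5) in auto)
    then have "smooth_on (snd c ` T) (loc_rep c e (\<lambda>x. g (f x)))"
      by (rule smooth_on_cong[OF oT]) (use e1 e2 loc_rep_apply[OF A c, of _ e "\<lambda>x. g (f x)"] T(3) in auto)
    then show "\<exists>T. open T \<and> z \<in> T \<and> smooth_on T (loc_rep c e (\<lambda>x. g (f x)))"
      using oT xT x(2) by blast
  qed
qed

lemma smooth_map_id:
  assumes A: "smooth_manifold A" and "open U"
  shows "smooth_map A A U (\<lambda>x. x)"
proof (rule smooth_mapI[OF A A assms(2)])
  fix c d W assume "c \<in> A" "d \<in> A" "open W" "W \<subseteq> U" "W \<subseteq> fst c" "(\<lambda>x. x) ` W \<subseteq> fst d"
  then show "smooth_on (snd c ` W) (loc_rep c d (\<lambda>x. x))"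
    unfolding id_def[symmetric] by (intro smooth_on_subset[OF chart_transition[OF A]]) auto
qed simp

subsection \<open>Products\<close>

definition prod_chart :: "('m, 'e) chart \<Rightarrow> ('p, 'f) chart \<Rightarrow> ('m \<times> 'p, 'e \<times> 'f) chart" where
  "prod_chart c d = (fst c \<times> fst d, map_prod (snd c) (snd d))"

lemma fst_prod_chart [simp]: "fst (prod_chart c d) = fst c \<times> fst d"
  and snd_prod_chart [simp]: "snd (prod_chart c d) = map_prod (snd c) (snd d)"
  by (simp_all add: prod_chart_def)

lemma prod_atlas_eq: "prod_atlas A B = {prod_chart c d | c d. c \<in> A \<and> d \<in> B}"
  unfolding prod_atlas_def prod_chart_def by fast

lemma prod_chart_in: "c \<in> A \<Longrightarrow> d \<in> B \<Longrightarrow> prod_chart c d \<in> prod_atlas A B"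
  unfolding prod_atlas_eq by blast

text \<open>Restricted to the chart images: elsewhere \<open>inv_into\<close> is an arbitrary value
  that need not split into components.\<close>

lemma chart_inv_prod:
  assumes A: "smooth_manifold A" and B: "smooth_manifold B" and "c \<in> A" "d \<in> B"
    and "z \<in> snd c ` fst c" "w \<in> snd d ` fst d"
  shows "chart_inv (prod_chart c d) (z, w) = (chart_inv c z, chart_inv d w)"
proof (rule inv_into_f_eq)
  show "inj_on (snd (prod_chart c d)) (fst (prod_chart c d))"
    using chart_inj[OF A assms(3)] chart_inj[OF B assms(4)] by (auto simp: inj_on_def)
  show "(chart_inv c z, chart_inv d w) \<in> fst (prod_chart c d)"
    using assms inv_into_into by (metis SigmaI fst_prod_chart)
  show "snd (prod_chart c d) (chart_inv c z, chart_inv d w) = (z, w)"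
    using assms f_inv_into_f by (simp add: f_inv_into_f)
qed

lemma image_map_prod: "map_prod f g ` (S \<times> T) = f ` S \<times> g ` T"
  by force

lemma smooth_manifold_prod:
  fixes A :: "('a::{t2_space,second_countable_topology}, 'ea::euclidean_space) atlas"
    and B :: "('b::{t2_space,second_countable_topology}, 'eb::euclidean_space) atlas"
  assumes A: "smooth_manifold A" and B: "smooth_manifold B"
  shows "smooth_manifold (prod_atlas A B)"
  unfolding smooth_manifold_def
proof (intro conjI ballI)
  show "\<exists>S::('ea \<times> 'eb) set. finite S \<and> span S = UNIV"
    using span_Basis by (intro exI[of _ Basis]) auto
  show "\<Union> (fst ` prod_atlas A B) = UNIV"
  proof -
    have "(x, y) \<in> \<Union> (fst ` prod_atlas A B)" for x y
    proof -
      obtain c where c: "c \<in> A" "x \<in> fst c" using chart_exists[OF A] .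
      obtain d where d: "d \<in> B" "y \<in> fst d" using chart_exists[OF B] .
      have "(x, y) \<in> fst (prod_chart c d)" using c d by simp
      then show ?thesis using prod_chart_in[OF c(1) d(1)] by blast
    qed
    then show ?thesis by auto
  qed
next
  fix p assume "p \<in> prod_atlas A B"
  then obtain c d where p: "p = prod_chart c d" and c: "c \<in> A" and d: "d \<in> B"
    unfolding prod_atlas_eq by blast
  show "open (fst p)" unfolding p using chart_open[OF A c] chart_open[OF B d] by (simp add: open_Times)
  show "open (snd p ` fst p)" unfolding p
    using chart_image_open[OF A c] chart_image_open[OF B d] by (simp add: open_Times image_map_prod)
  have inv: "chart_inv p zw = (chart_inv c (fst zw), chart_inv d (snd zw))" if "zw \<in> snd p ` fst p" for zw
    using that chart_inv_prod[OF A B c d, of "fst zw" "snd zw"] unfolding p by (auto simp: image_map_prod)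
  show "homeomorphism (fst p) (snd p ` fst p) (snd p) (chart_inv p)"
  proof (rule homeomorphismI)
    have "continuous_on (fst c \<times> fst d) (\<lambda>x. (snd c (fst x), snd d (snd x)))"
      by (intro continuous_on_Pair continuous_on_compose2[OF chart_continuous_on[OF A c order_refl]]
          continuous_on_compose2[OF chart_continuous_on[OF B d order_refl]] continuous_on_fst
          continuous_on_snd continuous_on_id) auto
    then show "continuous_on (fst p) (snd p)"
      unfolding p by (simp add: map_prod_def split_beta')
    have *: "continuous_on (snd c ` fst c \<times> snd d ` fst d) (\<lambda>x. (chart_inv c (fst x), chart_inv d (snd x)))"
      by (intro continuous_on_Pair continuous_on_compose2[OF chart_inv_continuous_on[OF A c order_refl]]
          continuous_on_compose2[OF chart_inv_continuous_on[OF B d order_refl]] continuous_on_fst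
          continuous_on_snd continuous_on_id) auto
    have im: "snd p ` fst p = snd c ` fst c \<times> snd d ` fst d" by (simp add: p image_map_prod)
    show "continuous_on (snd p ` fst p) (chart_inv p)"
      unfolding im by (rule continuous_on_eq[OF *]) (rule inv[symmetric], simp only: im)
    show "chart_inv p (snd p x) = x" if "x \<in> fst p" for x
      using that inv[of "snd p x"] chart_inv_chart[OF A c] chart_inv_chart[OF B d]
      unfolding p by (cases x) auto
    then show "chart_inv p ` snd p ` fst p \<subseteq> fst p"
      by auto
    show "snd p (chart_inv p y) = y" if "y \<in> snd p ` fst p" for y
      using that by (rule f_inv_into_f)
  qed simp
next
  fix p q assume "p \<in> prod_atlas A B" "q \<in> prod_atlas A B"
  then obtain c d c' d' where p: "p = prod_chart c d" and q: "q = prod_chart c' d'"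
    and c: "c \<in> A" "c' \<in> A" and d: "d \<in> B" "d' \<in> B"
    unfolding prod_atlas_eq by blast
  let ?S = "snd c ` (fst c \<inter> fst c')" and ?T = "snd d ` (fst d \<inter> fst d')"
  have S: "open ?S" "open ?T" 
    by (intro chart_open_image[OF A c(1)] chart_open_image[OF B d(1)] open_Int chart_open[OF A c(1)]
        chart_open[OF A c(2)] chart_open[OF B d(1)] chart_open[OF B d(2)] Int_lower1)+
  have eq: "snd p ` (fst p \<inter> fst q) = ?S \<times> ?T"
    unfolding p q by (simp add: Times_Int_Times image_map_prod)
  have "smooth_on (?S \<times> ?T) (\<lambda>z. (loc_rep c c' id (fst z), loc_rep d d' id (snd z)))"
    by (intro smooth_on_Pair smooth_on_compose[OF _ smooth_on_linear[OF _ bounded_linear_fst] chart_transition[OF A c]]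
       smooth_on_compose[OF _ smooth_on_linear[OF _ bounded_linear_snd] chart_transition[OF B d]] open_Times S) auto
  then show "smooth_on (snd p ` (fst p \<inter> fst q)) (loc_rep p q id)"
    unfolding eq
  proof (rule smooth_on_cong[OF open_Times[OF S]])
    fix z assume z: "z \<in> ?S \<times> ?T"
    then have "chart_inv p z = (chart_inv c (fst z), chart_inv d (snd z))"
      using chart_inv_prod[OF A B c(1) d(1), of "fst z" "snd z"] unfolding p by auto
    then show "(loc_rep c c' id (fst z), loc_rep d d' id (snd z)) = loc_rep p q id z"
      by (simp add: loc_rep_def q)
  qed
qed

lemma smooth_map_Pair:
  fixes A :: "('a::{t2_space,second_countable_topology}, 'ea::euclidean_space) atlas"
    and B :: "('b::{t2_space,second_countable_topology}, 'eb::euclidean_space) atlas"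
    and C :: "('c::{t2_space,second_countable_topology}, 'ec::euclidean_space) atlas"
  assumes A: "smooth_manifold A" and B: "smooth_manifold B" and C: "smooth_manifold C"
    and "open U" and f: "smooth_map A B U f" and g: "smooth_map A C U g"
  shows "smooth_map A (prod_atlas B C) U (\<lambda>x. (f x, g x))"
proof (rule smooth_mapI[OF A smooth_manifold_prod[OF B C] \<open>open U\<close>])
  show "continuous_on U (\<lambda>x. (f x, g x))"
    by (intro continuous_on_Pair smooth_map_continuous_on[OF A B f] smooth_map_continuous_on[OF A C g])
  fix c p W assume c: "c \<in> A" and p: "p \<in> prod_atlas B C" and W: "open W" "W \<subseteq> U" "W \<subseteq> fst c"
    and im: "(\<lambda>x. (f x, g x)) ` W \<subseteq> fst p"
  obtain d e where p_eq: "p = prod_chart d e" and d: "d \<in> B" and e: "e \<in> C"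
    using p unfolding prod_atlas_eq by blast
  have "f ` W \<subseteq> fst d" "g ` W \<subseteq> fst e" using im unfolding p_eq by auto
  then have "smooth_on (snd c ` W) (\<lambda>z. (loc_rep c d f z, loc_rep c e g z))"
    by (intro smooth_on_Pair chart_open_image[OF A c W(1,3)] smooth_map_loc_rep[OF A B f c d W]
        smooth_map_loc_rep[OF A C g c e W])
  then show "smooth_on (snd c ` W) (loc_rep c p (\<lambda>x. (f x, g x)))"
    by (simp add: loc_rep_def p_eq o_def)
qed

lemma smooth_map_fst:
  fixes A :: "('a::{t2_space,second_countable_topology}, 'ea::euclidean_space) atlas"
    and B :: "('b::{t2_space,second_countable_topology}, 'eb::euclidean_space) atlas"
  assumes A: "smooth_manifold A" and B: "smooth_manifold B" and "open U"
  shows "smooth_map (prod_atlas A B) A U fst"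
  unfolding smooth_map_def
proof
  fix x assume x: "x \<in> U"
  obtain c where c: "c \<in> A" "fst x \<in> fst c" using chart_exists[OF A] .
  obtain d where d: "d \<in> B" "snd x \<in> fst d" using chart_exists[OF B] .
  let ?p = "prod_chart c d"
  have p: "?p \<in> prod_atlas A B" using prod_chart_in[OF c(1) d(1)] .
  have M: "smooth_manifold (prod_atlas A B)" using smooth_manifold_prod[OF A B] .
  have U: "open (U \<inter> fst ?p)" using chart_open[OF M p] assms(3) by (rule open_Int[rotated])
  have o: "open (snd ?p ` (U \<inter> fst ?p))" by (rule chart_open_image[OF M p U Int_lower2])
  have "smooth_on (snd ?p ` (U \<inter> fst ?p)) (loc_rep ?p c fst)"
    by (rule smooth_on_cong[OF o smooth_on_linear[OF o bounded_linear_fst]])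
      (use loc_rep_apply[OF M p, of _ c fst] in auto)
  moreover have "x \<in> fst ?p" using c d by (simp add: mem_Times_iff)
  ultimately show "\<exists>p\<in>prod_atlas A B. \<exists>e\<in>A. \<exists>W. open W \<and> x \<in> W \<and> W \<subseteq> U \<inter> fst p \<and> fst ` W \<subseteq> fst e \<and>
      smooth_on (snd p ` W) (loc_rep p e fst)"
    using x U by (intro bexI[OF _ p] bexI[OF _ c(1)] exI[of _ "U \<inter> fst ?p"]) auto
qed

lemma smooth_manifold_real: "smooth_manifold real_atlas"
  unfolding smooth_manifold_def real_atlas_def
proof (intro conjI ballI)
  show "\<exists>S::real set. finite S \<and> span S = UNIV"
    using span_Basis[where 'a=real] by (intro exI[of _ Basis]) (auto simp del: Basis_real_def)
qed (auto simp: inv_id homeomorphism_ident[folded id_def] loc_rep_def id_def[symmetric] intro: smooth_on_ident[unfolded id_def[symmetric]])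

subsection \<open>Diffeomorphisms\<close>

lemma Diff_id: "smooth_manifold A \<Longrightarrow> id \<in> Diff A"
  using smooth_map_id[of A UNIV] by (simp add: Diff_def id_def[symmetric] inv_id)

lemma Diff_inv: "\<sigma> \<in> Diff A \<Longrightarrow> inv \<sigma> \<in> Diff A"
  by (simp add: Diff_def bij_imp_bij_inv inv_inv_eq)

lemma Diff_comp:
  fixes A :: "('a::{t2_space,second_countable_topology}, 'ea::euclidean_space) atlas"
  assumes A: "smooth_manifold A" and s: "\<sigma> \<in> Diff A" and t: "\<tau> \<in> Diff A"
  shows "\<sigma> \<circ> \<tau> \<in> Diff A"
proof -
  have b: "bij \<sigma>" "bij \<tau>" using s t by (auto simp: Diff_def)
  have sm: "smooth_map A A UNIV \<sigma>" "smooth_map A A UNIV \<tau>"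
      "smooth_map A A UNIV (inv \<sigma>)" "smooth_map A A UNIV (inv \<tau>)"
    using s t by (auto simp: Diff_def)
  have 1: "smooth_map A A UNIV (\<sigma> \<circ> \<tau>)"
    unfolding o_def by (rule smooth_map_compose[OF A A A sm(2,1)]) auto
  have "smooth_map A A UNIV (\<lambda>x. inv \<tau> (inv \<sigma> x))"
    by (rule smooth_map_compose[OF A A A sm(3,4)]) auto
  then have 2: "smooth_map A A UNIV (inv (\<sigma> \<circ> \<tau>))"
    unfolding o_inv_distrib[OF b] by (simp only: o_def)
  show ?thesis
    unfolding Diff_def using 1 2 bij_comp[OF b(2,1)] by blast
qed

lemma Diff_inv_simps:
  assumes "\<sigma> \<in> Diff A"
  shows "inv \<sigma> (\<sigma> x) = x" "\<sigma> (inv \<sigma> x) = x" "inv \<sigma> \<circ> \<sigma> = id" "\<sigma> \<circ> inv \<sigma> = id" "inv (inv \<sigma>) = \<sigma>"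
proof -
  have b: "bij \<sigma>" using assms by (simp add: Diff_def)
  show "inv \<sigma> (\<sigma> x) = x" "\<sigma> (inv \<sigma> x) = x"
    using bij_is_inj[OF b] bij_is_surj[OF b] by (simp_all add: surj_f_inv_f)
  show "inv \<sigma> \<circ> \<sigma> = id" "\<sigma> \<circ> inv \<sigma> = id"
    using bij_is_inj[OF b] bij_is_surj[OF b] by (simp_all add: surj_iff)
  show "inv (inv \<sigma>) = \<sigma>" by (rule inv_inv_eq[OF b])
qed

section \<open>Functions of jet coordinates, parametric inverses\<close>


text \<open>Chain rule through a function space without a norm, by induction on the finite set
  \<open>J\<close> of moving coordinates. One coordinate \<open>j\<close> is made an independent
  variable \<open>t\<close>. With \<open>t\<close> frozen, the induction hypothesis gives the
  derivative in \<open>y\<close>; continuity of the partial derivative in \<open>t\<close> combines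
  both into a total derivative. Substituting \<open>t = \<phi> y j\<close> restores the original
  map.\<close>

lemma has_derivative_coords:
  fixes G :: "('i \<Rightarrow> real) \<Rightarrow> 'b::real_normed_vector" and \<phi> :: "'a::real_normed_vector \<Rightarrow> 'i \<Rightarrow> real"
  assumes "finite J" and T: "open T"
    and diff: "\<And>j z. j \<in> J \<Longrightarrow> z \<in> T \<Longrightarrow> (\<lambda>t. G (z(j := t))) differentiable (at (z j))"
    and cont: "\<And>j. j \<in> J \<Longrightarrow> continuous_on T (coord_deriv j G)"
    and "open S" "x \<in> S" "\<phi> ` S \<subseteq> T" "continuous_on S \<phi>"
    and "\<And>i. i \<notin> J \<Longrightarrow> \<phi>' i = (\<lambda>v. 0) \<and> (\<forall>y\<in>S. \<phi> y i = \<phi> x i)"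
    and "\<And>i. i \<in> J \<Longrightarrow> ((\<lambda>y. \<phi> y i) has_derivative \<phi>' i) (at x)"
  shows "((\<lambda>y. G (\<phi> y)) has_derivative (\<lambda>v. \<Sum>j\<in>J. \<phi>' j v *\<^sub>R coord_deriv j G (\<phi> x))) (at x)"
  using assms(1,3-)
proof (induction J arbitrary: S \<phi> \<phi>' rule: finite_induct)
  case empty
  have "G (\<phi> x) = G (\<phi> y)" if "y \<in> S" for y
  proof -
    have "\<phi> x = \<phi> y" using empty.prems(7) that by (intro ext) simp
    then show ?thesis by simp
  qed
  then have "((\<lambda>y. G (\<phi> y)) has_derivative (\<lambda>v. 0)) (at x)"
    by (rule has_derivative_transform_within_open[OF has_derivative_const empty.prems(3,4)])
  then show ?case by simp
next
  case (insert j J)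
  define F where "F = (\<lambda>p::'a \<times> real. (\<phi> (fst p))(j := snd p))"
  have contF: "continuous_on (S \<times> UNIV) F"
  proof (rule continuous_on_coordinatewise_then_product)
    fix i
    have "continuous_on (S \<times> UNIV) (\<lambda>p. \<phi> (fst p) i)"
      by (intro continuous_on_compose2[OF continuous_on_product_then_coordinatewise[OF insert.prems(6)]]
          continuous_on_fst continuous_on_id) auto
    moreover have "continuous_on (S \<times> UNIV) (\<lambda>p::'a \<times> real. snd p)"
      by (intro continuous_on_snd continuous_on_id)
    ultimately show "continuous_on (S \<times> UNIV) (\<lambda>p. F p i)"
      by (cases "i = j") (simp_all add: F_def)
  qed
  have F_same: "F (y, \<phi> y j) = \<phi> y" for y by (simp add: F_def)
  have "open ((S \<times> UNIV) \<inter> F -` T)"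
    by (rule continuous_open_preimage[OF contF _ T]) (simp add: open_Times insert.prems(3))
  moreover have "(x, \<phi> x j) \<in> (S \<times> UNIV) \<inter> F -` T"
    using insert.prems(4,5) F_same by auto
  ultimately obtain X Y where XY: "open X" "open Y" "(x, \<phi> x j) \<in> X \<times> Y" "X \<times> Y \<subseteq> (S \<times> UNIV) \<inter> F -` T"
    by (rule open_prod_elim)
  \<comment> \<open>A ball is convex, which \<open>has_derivative_partialsI\<close> requires of the
    range of the second variable.\<close>
  obtain e where e: "e > 0" "ball (\<phi> x j) e \<subseteq> Y"
    using XY(2,3) open_contains_ball by (metis mem_Sigma_iff)
  let ?Y = "ball (\<phi> x j) e"
  have FT: "F (y, t) \<in> T" "y \<in> S" if "y \<in> X" "t \<in> ?Y" for y t
  proof -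
    have "(y, t) \<in> X \<times> Y" using e(2) that by blast
    then have "(y, t) \<in> (S \<times> UNIV) \<inter> F -` T" using XY(4) by blast
    then show "F (y, t) \<in> T" "y \<in> S" by auto
  qed
  let ?t = "\<phi> x j"
  let ?fy = "\<lambda>y t. blinfun_scaleR_left (coord_deriv j G (F (y, t)))"
  \<comment> \<open>With \<open>t\<close> frozen at its value for \<open>x\<close>, coordinate
    \<open>j\<close> is constant in \<open>y\<close> and counts among those outside
    \<open>J\<close>; hence the zero derivative put at \<open>j\<close>.\<close>
  have 1: "((\<lambda>y. G (F (y, ?t))) has_derivative
      (\<lambda>v. \<Sum>i\<in>J. (\<phi>'(j := \<lambda>v. 0)) i v *\<^sub>R coord_deriv i G (F (x, ?t)))) (at x)"
  proof (rule insert.IH[where S=X])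
    show "(\<lambda>y. F (y, ?t)) ` X \<subseteq> T" using FT(1) e(1) by auto
    show "continuous_on X (\<lambda>y. F (y, ?t))"
    proof (rule continuous_on_compose2[OF contF])
      show "(\<lambda>y. (y, ?t)) ` X \<subseteq> S \<times> UNIV" using FT(2)[of _ ?t] e(1) by auto
    qed (intro continuous_intros)
    show "(\<phi>'(j := \<lambda>v. 0)) i = (\<lambda>v. 0) \<and> (\<forall>y\<in>X. F (y, ?t) i = F (x, ?t) i)" if "i \<notin> J" for i
      using insert.prems(7)[of i] that FT(2)[of _ ?t] e(1) by (auto simp: F_def)
    show "((\<lambda>y. F (y, ?t) i) has_derivative (\<phi>'(j := \<lambda>v. 0)) i) (at x)" if "i \<in> J" for i
      using insert.prems(8)[of i] that insert.hyps(2) by (auto simp: F_def)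
  qed (use insert.prems(1,2) XY in auto)
  have 2: "((\<lambda>t. G (F (y, t))) has_derivative blinfun_apply (?fy y t)) (at t within ?Y)"
    if "y \<in> X" "t \<in> ?Y" for y t
  proof -
    have "F (y, t) \<in> T" using FT that by blast
    then have "(\<lambda>s. G ((F (y, t))(j := s))) differentiable (at (F (y, t) j))"
      using insert.prems(1)[of j] by blast
    then have "((\<lambda>s. G ((F (y, t))(j := s))) has_vector_derivative coord_deriv j G (F (y, t))) (at (F (y, t) j))"
      unfolding coord_deriv_def by (simp add: vector_derivative_works)
    then have "((\<lambda>s. G (F (y, s))) has_vector_derivative coord_deriv j G (F (y, t))) (at t)"
      by (simp add: F_def)
    then show ?thesis
      unfolding has_vector_derivative_def by (simp add: has_derivative_at_withinI)
  qed
  have 3: "continuous_on (X \<times> ?Y) (\<lambda>(y, t). ?fy y t)"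
  proof -
    have "continuous_on (X \<times> ?Y) (\<lambda>p. coord_deriv j G (F p))"
      by (rule continuous_on_compose2[OF insert.prems(2)[of j] continuous_on_subset[OF contF]])
        (use FT in auto)
    then show ?thesis
      using bounded_linear.continuous_on[OF bounded_linear_blinfun_scaleR_left] by (simp add: split_beta')
  qed
  have inX: "(x, ?t) \<in> X \<times> ?Y" using XY(3) e(1) by auto
  have "((\<lambda>(y, t). G (F (y, t))) has_derivative
      (\<lambda>(tx, ty). (\<Sum>i\<in>J. (\<phi>'(j := \<lambda>v. 0)) i tx *\<^sub>R coord_deriv i G (F (x, ?t))) + blinfun_apply (?fy x ?t) ty))
      (at (x, ?t) within X \<times> ?Y)"
  proof (rule has_derivative_partialsI)
    show "((\<lambda>y. G (F (y, ?t))) has_derivative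
      (\<lambda>v. \<Sum>i\<in>J. (\<phi>'(j := \<lambda>v. 0)) i v *\<^sub>R coord_deriv i G (F (x, ?t)))) (at x within X)"
      by (rule has_derivative_at_withinI[OF 1])
    show "continuous (at (x, ?t) within X \<times> ?Y) (\<lambda>(y, t). ?fy y t)"
      using 3 inX unfolding continuous_on_eq_continuous_within by blast
  qed (use 2 e in auto)
  moreover have "at (x, ?t) within X \<times> ?Y = at (x, ?t)"
    by (rule at_within_open[OF inX]) (simp add: XY(1) open_Times)
  ultimately have D: "((\<lambda>p. G (F p)) has_derivative
      (\<lambda>p. (\<Sum>i\<in>J. (\<phi>'(j := \<lambda>v. 0)) i (fst p) *\<^sub>R coord_deriv i G (\<phi> x)) + snd p *\<^sub>R coord_deriv j G (\<phi> x)))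
      (at (x, ?t))"
    by (simp add: split_beta' F_same)
  have "((\<lambda>y. (y, \<phi> y j)) has_derivative (\<lambda>v. (v, \<phi>' j v))) (at x)"
    using insert.prems(8)[of j] by (intro has_derivative_Pair has_derivative_ident) simp
  from diff_chain_at[OF this D] have "((\<lambda>y. G (\<phi> y)) has_derivative
      (\<lambda>v. (\<Sum>i\<in>J. (\<phi>'(j := \<lambda>v. 0)) i v *\<^sub>R coord_deriv i G (\<phi> x)) + \<phi>' j v *\<^sub>R coord_deriv j G (\<phi> x))) (at x)"
    by (simp add: o_def F_same)
  moreover have "(\<Sum>i\<in>J. (\<phi>'(j := \<lambda>v. 0)) i v *\<^sub>R coord_deriv i G (\<phi> x)) =
      (\<Sum>i\<in>J. \<phi>' i v *\<^sub>R coord_deriv i G (\<phi> x))" for v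
    by (rule sum.cong) (use insert.hyps(2) in auto)
  ultimately show ?case
    using insert.hyps by (simp add: add.commute)
qed

text \<open>The derivative of the composition is a finite sum of compositions of the same kind, with
  \<open>coord_deriv j G\<close> in place of \<open>G\<close>. Vanishing of the coordinates outside
  \<open>I\<close> makes \<open>\<phi>\<close> continuous into the product topology.\<close>

lemma Ck_on_coords:
  fixes G :: "('i \<Rightarrow> real) \<Rightarrow> 'b::real_normed_vector" and \<phi> :: "'a::real_normed_vector \<Rightarrow> 'i \<Rightarrow> real"
  assumes "finite I" and T: "open T" and S: "open S" and im: "\<phi> ` S \<subseteq> T"
    and const: "\<And>i y. i \<notin> I \<Longrightarrow> \<phi> y i = 0"
    and "Ck_coords k I T G" and "\<And>i. i \<in> I \<Longrightarrow> Ck_on k S (\<lambda>y. \<phi> y i)"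
  shows "Ck_on k S (\<lambda>y. G (\<phi> y))"
  using assms(6,7)
proof (induction k arbitrary: G)
  case 0
  have "continuous_on S (\<lambda>y. \<phi> y i)" for i
    using 0(2)[of i] const[of i] by (cases "i \<in> I") auto
  then have "continuous_on S \<phi>" by (rule continuous_on_coordinatewise_then_product)
  then show ?case using continuous_on_compose2[OF _ _ im, of G] 0(1) by simp
next
  case (Suc k)
  have cG: "continuous_on T (coord_deriv i G)" and CG: "Ck_coords k I T (coord_deriv i G)"
      and dG: "z \<in> T \<Longrightarrow> (\<lambda>t. G (z(i := t))) differentiable (at (z i))" if "i \<in> I" for i z
    using Suc.prems(1) that by (cases k; auto)+
  have "continuous_on S (\<lambda>y. \<phi> y i)" for i
    using Ck_on_imp_continuous_on[OF Suc.prems(2)[of i]] const[of i] by (cases "i \<in> I") auto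
  then have c\<phi>: "continuous_on S \<phi>" by (rule continuous_on_coordinatewise_then_product)
  let ?\<phi>' = "\<lambda>x i. if i \<in> I then frechet_derivative (\<lambda>y. \<phi> y i) (at x) else (\<lambda>v. 0)"
  show ?case
  proof (rule Ck_on_SucI[OF S])
    fix x assume x: "x \<in> S"
    show "((\<lambda>y. G (\<phi> y)) has_derivative (\<lambda>v. \<Sum>j\<in>I. ?\<phi>' x j v *\<^sub>R coord_deriv j G (\<phi> x))) (at x)"
    proof (rule has_derivative_coords[OF assms(1) T dG cG S x im c\<phi>])
      show "((\<lambda>y. \<phi> y i) has_derivative ?\<phi>' x i) (at x)" if "i \<in> I" for i
        using Ck_on_has_derivative[OF Suc.prems(2)[OF that] x] that by simp
    qed (use const in auto)
  next
    fix v
    show "Ck_on k S (\<lambda>x. \<Sum>j\<in>I. ?\<phi>' x j v *\<^sub>R coord_deriv j G (\<phi> x))"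
    proof (intro Ck_on_sum Ck_on_scaleR S)
      fix j assume j: "j \<in> I"
      show "Ck_on k S (\<lambda>x. ?\<phi>' x j v)" using Suc.prems(2)[OF j] j by simp
      show "Ck_on k S (\<lambda>x. coord_deriv j G (\<phi> x))"
        by (rule Suc.IH[OF CG[OF j]]) (rule Ck_on_Suc_imp[OF Suc.prems(2)])
    qed
  qed
qed

text \<open>Coordinates of \<open>\<phi>\<close> outside \<open>I\<close> have unknown regularity.
  By \<open>smooth_coords\<close> neither membership in \<open>T\<close> nor the value of
  \<open>G\<close> depends on them, so they are replaced by 0.\<close>

lemma smooth_on_coords:
  fixes G :: "('i \<Rightarrow> real) \<Rightarrow> 'b::real_normed_vector" and \<phi> :: "'a::real_normed_vector \<Rightarrow> 'i \<Rightarrow> real"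
  assumes G: "smooth_coords I T G" and S: "open S" and im: "\<phi> ` S \<subseteq> T"
    and \<phi>: "\<And>i. i \<in> I \<Longrightarrow> smooth_on S (\<lambda>y. \<phi> y i)"
  shows "smooth_on S (\<lambda>y. G (\<phi> y))"
proof -
  define \<phi>0 where "\<phi>0 = (\<lambda>y i. if i \<in> I then \<phi> y i else 0)"
  have GT: "finite I" "open T" "Ck_coords k I T G"
    "z \<in> T \<Longrightarrow> (\<And>i. i \<in> I \<Longrightarrow> w i = z i) \<Longrightarrow> w \<in> T \<and> G w = G z" for k z w
    using G unfolding smooth_coords_def by blast+
  have eq: "\<phi>0 y \<in> T \<and> G (\<phi>0 y) = G (\<phi> y)" if "y \<in> S" for y
    by (rule GT(4)) (use im that in \<open>auto simp: \<phi>0_def\<close>)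
  have "smooth_on S (\<lambda>y. G (\<phi>0 y))"
    unfolding smooth_on_def
  proof
    fix k
    show "Ck_on k S (\<lambda>y. G (\<phi>0 y))"
    proof (rule Ck_on_coords[OF GT(1,2) S _ _ GT(3)])
      show "Ck_on k S (\<lambda>y. \<phi>0 y i)" if "i \<in> I" for i
        using \<phi>[OF that] that by (simp add: \<phi>0_def smooth_on_def)
    qed (use eq in \<open>auto simp: \<phi>0_def\<close>)
  qed
  then show ?thesis by (rule smooth_on_cong[OF S]) (use eq in auto)
qed


section \<open>Linear systems and inverse maps depending on parameters\<close>

lemma Ck_on_det:
  fixes M :: "'a::real_normed_vector \<Rightarrow> real^'n^'n"
  assumes "open S" "\<And>i j. Ck_on k S (\<lambda>x. M x $ i $ j)"
  shows "Ck_on k S (\<lambda>x. det (M x))"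
  unfolding det_def
  by (intro Ck_on_sum Ck_on_mult Ck_on_prod Ck_on_const assms)

lemma Ck_on_vec:
  fixes f :: "'a::real_normed_vector \<Rightarrow> real^'n"
  assumes "open S" "\<And>i. Ck_on k S (\<lambda>x. f x $ i)"
  shows "Ck_on k S f"
proof -
  have "Ck_on k S (\<lambda>x. \<Sum>i\<in>UNIV. f x $ i *\<^sub>R (axis i 1 :: real^'n))"
    by (intro Ck_on_sum Ck_on_scaleR Ck_on_const assms)
  moreover have "(\<Sum>i\<in>UNIV. f x $ i *\<^sub>R axis i 1) = f x" for x
    using basis_expansion[of "f x"] by (simp add: scalar_mult_eq_scaleR)
  ultimately show ?thesis by simp
qed

text \<open>The regularity of \<open>w\<close> is deduced, not assumed: \<open>w\<close> is the
  unique solution of the system, hence a quotient of determinants with \<open>C^k\<close>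
  entries.\<close>

lemma Ck_on_cramer:
  fixes M :: "'a::real_normed_vector \<Rightarrow> real^'n^'n"
  assumes S: "open S" and M: "\<And>i j. Ck_on k S (\<lambda>x. M x $ i $ j)" and b: "Ck_on k S b"
    and det: "\<And>x. x \<in> S \<Longrightarrow> det (M x) \<noteq> 0" and w: "\<And>x. x \<in> S \<Longrightarrow> M x *v w x = b x"
  shows "Ck_on k S w"
proof -
  have b': "Ck_on k S (\<lambda>x. b x $ i)" for i
    by (rule Ck_on_bounded_linear[OF S bounded_linear_vec_nth b])
  have "Ck_on k S (\<lambda>x. \<chi> l. det (\<chi> i j. if j = l then b x $ i else M x $ i $ j) * inverse (det (M x)))"
  proof (rule Ck_on_vec[OF S])
    fix l
    have "Ck_on k S (\<lambda>x. (\<chi> i j. if j = l then b x $ i else M x $ i $ j) $ i $ j)" for i j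
      by (cases "j = l") (simp_all add: b' M)
    then have "Ck_on k S (\<lambda>x. det (\<chi> i j. if j = l then b x $ i else M x $ i $ j) * inverse (det (M x)))"
      by (intro Ck_on_mult Ck_on_inverse Ck_on_det S M det)
    then show "Ck_on k S (\<lambda>x. (\<chi> l. det (\<chi> i j. if j = l then b x $ i else M x $ i $ j) * inverse (det (M x))) $ l)"
      by simp
  qed
  then show ?thesis
  proof (rule Ck_on_cong[OF S, rotated])
    fix x assume x: "x \<in> S"
    show "(\<chi> l. det (\<chi> i j. if j = l then b x $ i else M x $ i $ j) * inverse (det (M x))) = w x"
      using cramer[OF det[OF x], of "w x" "b x"] w[OF x] by (simp add: divide_inverse)
  qed
qed

text \<open>Differentiability of the inverse comes from \<open>has_derivative_inverse_strong\<close>; its derivative solves a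
  linear system with coefficients as smooth as the inverse itself, so Cramer's rule gives smoothness
  by induction on the order.\<close>

lemma smooth_on_fibre_inverse:
  fixes f :: "'p::euclidean_space \<times> (real^'n) \<Rightarrow> real^'n" and \<Omega> :: "('p \<times> (real^'n)) set"
  defines "\<Phi> \<equiv> \<lambda>q. (fst q, f q)"
  assumes O: "open \<Omega>" and f: "smooth_on \<Omega> f"
    and det: "\<And>q. q \<in> \<Omega> \<Longrightarrow> det (matrix (\<lambda>h. frechet_derivative f (at q) (0, h))) \<noteq> 0"
    and g: "\<And>q. q \<in> \<Omega> \<Longrightarrow> g (\<Phi> q) = snd q"
  shows "open (\<Phi> ` \<Omega>)" "smooth_on (\<Phi> ` \<Omega>) g"
proof -
  define G where "G = (\<lambda>r. (fst r, g r))"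
  have G\<Phi>: "G (\<Phi> q) = q" if "q \<in> \<Omega>" for q
    using g[OF that] by (simp add: G_def \<Phi>_def)
  have "smooth_on \<Omega> \<Phi>"
    unfolding \<Phi>_def by (intro smooth_on_Pair O f smooth_on_linear bounded_linear_fst)
  then have cont: "continuous_on \<Omega> \<Phi>" by (rule smooth_on_imp_continuous_on)
  \<comment> \<open>The given \<open>g\<close> yields a left inverse \<open>G\<close> of
    \<open>\<Phi>\<close> on all of \<open>\<Omega>\<close>, so injectivity is at hand and
    invariance of domain applies.\<close>
  show V: "open (\<Phi> ` \<Omega>)"
    by (rule invariance_of_domain[OF cont O inj_on_inverseI[of _ G, OF G\<Phi>]])
  define D where "D = (\<lambda>q. frechet_derivative f (at q))"
  define M where "M = (\<lambda>q. matrix (\<lambda>h. D q (0, h)))"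
  \<comment> \<open>The future derivative of \<open>g\<close> at \<open>\<Phi> q\<close>:
    \<open>w q v\<close> is the \<open>h\<close> that solves \<open>D q (fst v, h) = snd v\<close>.
    The matrix of this system is \<open>M q\<close>, and \<open>SOME\<close> picks a right inverse
    of it.\<close>
  define w where "w = (\<lambda>q v. (SOME B. M q ** B = mat 1) *v (snd v - D q (fst v, 0)))"
  have lin: "linear (D q)" if "q \<in> \<Omega>" for q
    unfolding D_def using has_derivative_linear[OF smooth_on_has_derivative[OF f that]] .
  have Mh: "M q *v h = D q (0, h)" if "q \<in> \<Omega>" for q h
  proof -
    have "linear (\<lambda>h. D q (0, h))"
      using linear_compose[OF bounded_linear.linear[OF bounded_linear_Pair[OF bounded_linear_zero bounded_linear_ident]] lin[OF that]]
      by (simp add: o_def)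
    then show ?thesis unfolding M_def by (simp add: matrix_works)
  qed
  have Mw: "M q *v w q v = snd v - D q (fst v, 0)" if "q \<in> \<Omega>" for q v
  proof -
    have "invertible (M q)" using det[OF that] by (simp add: M_def D_def invertible_det_nz)
    then have "M q ** (SOME B. M q ** B = mat 1) = mat 1"
      unfolding invertible_def by (metis (mono_tags, lifting) someI_ex)
    then show ?thesis by (simp add: w_def matrix_vector_mul_assoc)
  qed
  have derg: "(g has_derivative w q) (at (\<Phi> q))" if q: "q \<in> \<Omega>" for q
  proof -
    have "(\<Phi> has_derivative (\<lambda>v. (fst v, D q v))) (at q)"
      unfolding \<Phi>_def D_def
      by (intro has_derivative_Pair has_derivative_fst has_derivative_ident smooth_on_has_derivative[OF f q])
    moreover have "(\<lambda>v. (fst v, D q v)) \<circ> (\<lambda>v. (fst v, w q v)) = id"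
    proof
      fix v
      have "D q (fst v, w q v) = D q (fst v, 0) + D q (0, w q v)"
        using linear_add[OF lin[OF q], of "(fst v, 0)" "(0, w q v)"] by simp
      then show "((\<lambda>v. (fst v, D q v)) \<circ> (\<lambda>v. (fst v, w q v))) v = id v"
        using Mw[OF q, of v] by (simp add: Mh[OF q])
    qed
    ultimately have "(G has_derivative (\<lambda>v. (fst v, w q v))) (at (\<Phi> q))"
      using has_derivative_inverse_strong[where f=\<Phi> and g=G, OF O q cont G\<Phi>, of "\<lambda>v. (fst v, D q v)"] by blast
    from has_derivative_snd[OF this] show ?thesis by (simp add: G_def)
  qed
  have G_in: "G r \<in> \<Omega>" "\<Phi> (G r) = r" if "r \<in> \<Phi> ` \<Omega>" for r
    using that G\<Phi> by auto
  have derg': "(g has_derivative w (G r)) (at r)" if "r \<in> \<Phi> ` \<Omega>" for r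
    using derg[OF G_in(1)[OF that]] G_in(2)[OF that] by simp
  show "smooth_on (\<Phi> ` \<Omega>) g"
    unfolding smooth_on_def
  proof
    fix k
    show "Ck_on k (\<Phi> ` \<Omega>) g"
    proof (induction k)
      case 0
      have "continuous_on (\<Phi> ` \<Omega>) g"
        by (intro continuous_at_imp_continuous_on ballI) (rule has_derivative_continuous[OF derg'])
      then show ?case by simp
    next
      case (Suc k)
      have CG: "Ck_on k (\<Phi> ` \<Omega>) G"
        unfolding G_def by (intro Ck_on_Pair V Suc Ck_on_linear bounded_linear_fst)
      have CD: "Ck_on k (\<Phi> ` \<Omega>) (\<lambda>r. D (G r) v)" for v
      proof (rule Ck_on_compose[OF V CG])
        show "Ck_on k \<Omega> (\<lambda>q. D q v)"
          using smooth_on_derivative[OF f, of v] by (simp add: D_def smooth_on_def)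
        show "G ` \<Phi> ` \<Omega> \<subseteq> \<Omega>" using G_in(1) by blast
      qed
      show ?case
      proof (rule Ck_on_SucI[OF V derg'])
        fix v
        show "Ck_on k (\<Phi> ` \<Omega>) (\<lambda>r. w (G r) v)"
        proof (rule Ck_on_cramer[OF V])
          show "M (G r) *v w (G r) v = snd v - D (G r) (fst v, 0)" if "r \<in> \<Phi> ` \<Omega>" for r
            by (rule Mw[OF G_in(1)[OF that]])
          show "det (M (G r)) \<noteq> 0" if "r \<in> \<Phi> ` \<Omega>" for r
            using det[OF G_in(1)[OF that]] by (simp add: M_def D_def)
          have "Ck_on k (\<Phi> ` \<Omega>) (\<lambda>r. snd v + - D (G r) (fst v, 0))"
            by (intro Ck_on_add V Ck_on_const Ck_on_bounded_linear[OF V bounded_linear_minus[OF bounded_linear_ident] CD])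
          then show "Ck_on k (\<Phi> ` \<Omega>) (\<lambda>r. snd v - D (G r) (fst v, 0))" by simp
          show "Ck_on k (\<Phi> ` \<Omega>) (\<lambda>r. M (G r) $ i $ j)" for i j
            unfolding M_def matrix_def
            using Ck_on_bounded_linear[OF V bounded_linear_vec_nth CD] by simp
        qed
      qed
    qed
  qed
qed

subsection \<open>Iterated partial derivatives\<close>

lemma partials_cong:
  assumes "open S" "z \<in> S" "\<And>y. y \<in> S \<Longrightarrow> f y = g y"
  shows "partials \<alpha> f z = partials \<alpha> g z"
  using assms(3)
proof (induction \<alpha> arbitrary: f g)
  case Nil
  then show ?case using assms(2) by simp
next
  case (Cons i \<alpha>)
  show ?case unfolding partials.simps
  proof (rule Cons.IH)
    show "frechet_derivative f (at y) (axis i 1) = frechet_derivative g (at y) (axis i 1)" if "y \<in> S" for y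
      using frechet_derivative_cong_open[OF assms(1) that, of f g] Cons.prems by simp
  qed
qed

text \<open>Applied to the projections of a product, this recovers the derivatives of the components
  from those of a pair.\<close>

lemma partials_bounded_linear:
  assumes "open S" "z \<in> S" "bounded_linear h" "smooth_on S f"
  shows "partials \<alpha> (\<lambda>z. h (f z)) z = h (partials \<alpha> f z)"
  using assms(4)
proof (induction \<alpha> arbitrary: f)
  case (Cons i \<alpha>)
  have "frechet_derivative (\<lambda>z. h (f z)) (at y) (axis i 1) = h (frechet_derivative f (at y) (axis i 1))"
    if "y \<in> S" for y
    using frechet_derivative_at[OF bounded_linear.has_derivative[OF assms(3)
          smooth_on_has_derivative[OF Cons.prems that]]] by metis
  then have "partials (i # \<alpha>) (\<lambda>z. h (f z)) z = partials \<alpha> (\<lambda>z. h (frechet_derivative f (at z) (axis i 1))) z"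
    unfolding partials.simps by (rule partials_cong[OF assms(1,2)])
  also have "\<dots> = h (partials (i # \<alpha>) f z)"
    unfolding partials.simps by (rule Cons.IH[OF smooth_on_derivative[OF Cons.prems]])
  finally show ?case .
qed simp

lemma has_derivative_slice:
  assumes "smooth_on \<Omega> F" "(p, z) \<in> \<Omega>"
  shows "((\<lambda>z. F (p, z)) has_derivative (\<lambda>h. frechet_derivative F (at (p, z)) (0, h))) (at z)"
proof -
  have "((\<lambda>z. (p, z)) has_derivative (\<lambda>h. (0, h))) (at z)"
    by (intro has_derivative_Pair has_derivative_const has_derivative_ident)
  from diff_chain_at[OF this smooth_on_has_derivative[OF assms]] show ?thesis by (simp add: o_def)
qed

lemma open_slice:
  assumes "open \<Omega>"
  shows "open {z. (p, z) \<in> \<Omega>}"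
proof -
  have "open (Pair p -` \<Omega>)"
    by (rule open_vimage[OF assms]) (intro continuous_intros)
  then show ?thesis by (simp add: vimage_def)
qed

text \<open>A partial derivative in \<open>z\<close> alone is a derivative of \<open>F\<close> in
  the direction \<open>(0, axis i 1)\<close>, hence smooth in both variables together. Thus the jets
  of a smooth family depend smoothly on the parameter.\<close>

lemma smooth_on_partials:
  fixes F :: "'p::real_normed_vector \<times> (real^'n) \<Rightarrow> 'b::real_normed_vector"
  assumes "open \<Omega>" "smooth_on \<Omega> F"
  shows "smooth_on \<Omega> (\<lambda>q. partials \<alpha> (\<lambda>z. F (fst q, z)) (snd q))"
  using assms(2)
proof (induction \<alpha> arbitrary: F)
  case (Cons i \<alpha>)
  let ?D = "\<lambda>q. frechet_derivative F (at q) (0, axis i 1)"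
  have "smooth_on \<Omega> (\<lambda>q. partials \<alpha> (\<lambda>z. ?D (fst q, z)) (snd q))"
    by (rule Cons.IH[OF smooth_on_derivative[OF Cons.prems]])
  then show ?case
  proof (rule smooth_on_cong[OF assms(1)])
    fix q assume q: "q \<in> \<Omega>"
    show "partials \<alpha> (\<lambda>z. ?D (fst q, z)) (snd q) = partials (i # \<alpha>) (\<lambda>z. F (fst q, z)) (snd q)"
      unfolding partials.simps
    proof (rule partials_cong[OF open_slice[OF assms(1), of "fst q"]])
      show "snd q \<in> {z. (fst q, z) \<in> \<Omega>}" using q by simp
      show "?D (fst q, y) = frechet_derivative (\<lambda>z. F (fst q, z)) (at y) (axis i 1)"
        if "y \<in> {z. (fst q, z) \<in> \<Omega>}" for y
        using frechet_derivative_at[OF has_derivative_slice[OF Cons.prems, of "fst q" y]] that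
        by (metis mem_Collect_eq)
    qed
  qed
qed simp

section \<open>Families of maps and Jacobians\<close>


lemma real_chart: "(UNIV, id) \<in> real_atlas"
  by (simp add: real_atlas_def)

text \<open>The real line has the single chart \<open>id\<close>, so in a product chart the
  parameter stays itself, and the representative of the whole family at
  \<open>(\<epsilon>, z)\<close> is that of its member \<open>s \<epsilon>\<close> at
  \<open>z\<close>. The set in question is the product chart image of the points whose values lie in
  the domain of \<open>d\<close>.\<close>

lemma
  fixes A :: "('a::{t2_space,second_countable_topology}, 'ea::euclidean_space) atlas"
    and B :: "('b::{t2_space,second_countable_topology}, 'eb::euclidean_space) atlas"
  assumes A: "smooth_manifold A" and B: "smooth_manifold B" and I: "open I"
    and s: "smooth_map (prod_atlas real_atlas A) B (I \<times> UNIV) (\<lambda>(\<epsilon>, x). s \<epsilon> x)"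
  shows family_open: "open N \<Longrightarrow> open {q. fst q \<in> I \<and> s (fst q) (snd q) \<in> N}"
    and family_loc_rep_open: "c \<in> A \<Longrightarrow> d \<in> B \<Longrightarrow>
      open {q. fst q \<in> I \<and> snd q \<in> snd c ` fst c \<and> s (fst q) (chart_inv c (snd q)) \<in> fst d}"
    and family_loc_rep: "c \<in> A \<Longrightarrow> d \<in> B \<Longrightarrow>
      smooth_on {q. fst q \<in> I \<and> snd q \<in> snd c ` fst c \<and> s (fst q) (chart_inv c (snd q)) \<in> fst d}
        (\<lambda>q. loc_rep c d (s (fst q)) (snd q))"
proof -
  let ?F = "\<lambda>(\<epsilon>, x). s \<epsilon> x"
  have M: "smooth_manifold (prod_atlas real_atlas A)"
    by (rule smooth_manifold_prod[OF smooth_manifold_real A])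
  have oI: "open (I \<times> (UNIV :: 'a set))" using I by (simp add: open_Times)
  show *: "open {q. fst q \<in> I \<and> s (fst q) (snd q) \<in> N}" if "open N" for N
  proof -
    have "open ((I \<times> UNIV) \<inter> ?F -` N)"
      by (rule continuous_open_preimage[OF smooth_map_continuous_on[OF M B s] oI that])
    moreover have "(I \<times> UNIV) \<inter> ?F -` N = {q. fst q \<in> I \<and> s (fst q) (snd q) \<in> N}" by auto
    ultimately show ?thesis by simp
  qed
  assume c: "c \<in> A" and d: "d \<in> B"
  let ?p = "prod_chart (UNIV, id) c :: (real \<times> 'a, real \<times> 'ea) chart"
  let ?\<Omega> = "{q. fst q \<in> I \<and> snd q \<in> snd c ` fst c \<and> s (fst q) (chart_inv c (snd q)) \<in> fst d}"
  define W where "W = {q. fst q \<in> I \<and> s (fst q) (snd q) \<in> fst d} \<inter> (UNIV \<times> fst c)"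
  have p: "?p \<in> prod_atlas real_atlas A" by (rule prod_chart_in[OF real_chart c])
  have W: "open W" "W \<subseteq> I \<times> UNIV" "W \<subseteq> fst ?p" "?F ` W \<subseteq> fst d"
    unfolding W_def using *[OF chart_open[OF B d]] chart_open[OF A c]
    by (auto intro!: open_Int open_Times)
  have im: "snd ?p ` W = ?\<Omega>"
  proof (intro subset_antisym subsetI)
    fix q assume "q \<in> snd ?p ` W"
    then obtain \<epsilon> x where q: "(\<epsilon>, x) \<in> W" "q = (\<epsilon>, snd c x)" by auto
    then have "x \<in> fst c" by (auto simp: W_def)
    then show "q \<in> ?\<Omega>" using q chart_inv_chart[OF A c, of x] by (auto simp: W_def)
  next
    fix q assume q: "q \<in> ?\<Omega>"
    then have "chart_inv c (snd q) \<in> fst c" "snd c (chart_inv c (snd q)) = snd q"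
      using inv_into_into[of "snd q" "snd c" "fst c"] f_inv_into_f[of "snd q" "snd c" "fst c"] by blast+
    then show "q \<in> snd ?p ` W"
      using q by (intro image_eqI[of _ _ "(fst q, chart_inv c (snd q))"]) (auto simp: W_def)
  qed
  show op: "open ?\<Omega>"
    unfolding im[symmetric] by (rule chart_open_image[OF M p W(1,3)])
  have "smooth_on ?\<Omega> (loc_rep ?p d ?F)"
    unfolding im[symmetric] by (rule smooth_map_loc_rep[OF M B s p d W])
  then show "smooth_on ?\<Omega> (\<lambda>q. loc_rep c d (s (fst q)) (snd q))"
  proof (rule smooth_on_cong[OF op])
    fix q assume "q \<in> ?\<Omega>"
    then obtain \<epsilon> x where q: "(\<epsilon>, x) \<in> W" "q = (\<epsilon>, snd c x)" unfolding im[symmetric] by auto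
    then have "x \<in> fst c" by (auto simp: W_def)
    then show "loc_rep ?p d ?F q = loc_rep c d (s (fst q)) (snd q)"
      using loc_rep_apply[OF M p, of "(\<epsilon>, x)" d ?F] loc_rep_apply[OF A c, of x d "s \<epsilon>"] q(2) by simp
  qed
qed

subsection \<open>Jacobians\<close>

lemma loc_rep_differentiable:
  fixes A :: "('a::{t2_space,second_countable_topology}, 'ea::euclidean_space) atlas"
    and B :: "('b::{t2_space,second_countable_topology}, 'eb::euclidean_space) atlas"
  assumes A: "smooth_manifold A" and B: "smooth_manifold B"
    and f: "smooth_map A B UNIV f" and c: "c \<in> A" "x \<in> fst c" and d: "d \<in> B" "f x \<in> fst d"
  shows "(loc_rep c d f has_derivative frechet_derivative (loc_rep c d f) (at (snd c x))) (at (snd c x))"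
proof -
  define W where "W = (UNIV \<inter> f -` fst d) \<inter> fst c"
  have "smooth_on (snd c ` W) (loc_rep c d f)"
    unfolding W_def
    by (intro smooth_map_loc_rep[OF A B f c(1) d(1)] open_Int chart_open[OF A c(1)]
      continuous_open_preimage[OF smooth_map_continuous_on[OF A B f] open_UNIV chart_open[OF B d(1)]]) auto
  then show ?thesis using c d by (intro smooth_on_has_derivative) (auto simp: W_def)
qed

lemma loc_rep_derivative_compose:
  fixes A :: "('a::{t2_space,second_countable_topology}, 'ea::euclidean_space) atlas"
    and B :: "('b::{t2_space,second_countable_topology}, 'eb::euclidean_space) atlas"
    and C :: "('c::{t2_space,second_countable_topology}, 'ec::euclidean_space) atlas"
  assumes A: "smooth_manifold A" and B: "smooth_manifold B" and C: "smooth_manifold C"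
    and f: "smooth_map A B UNIV f" and g: "smooth_map B C UNIV g"
    and c: "c \<in> A" "x \<in> fst c" and d: "d \<in> B" "f x \<in> fst d" and e: "e \<in> C" "g (f x) \<in> fst e"
  shows "frechet_derivative (loc_rep c e (g \<circ> f)) (at (snd c x)) =
    frechet_derivative (loc_rep d e g) (at (snd d (f x))) \<circ> frechet_derivative (loc_rep c d f) (at (snd c x))"
proof -
  define W where "W = (UNIV \<inter> f -` fst d) \<inter> fst c"
  have W: "open W" "W \<subseteq> fst c" "x \<in> W" unfolding W_def using c d
    by (auto intro!: open_Int chart_open[OF A c(1)]
      continuous_open_preimage[OF smooth_map_continuous_on[OF A B f] open_UNIV chart_open[OF B d(1)], simplified])
  have eq: "loc_rep c e (g \<circ> f) z = (loc_rep d e g \<circ> loc_rep c d f) z" if z: "z \<in> snd c ` W" for z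
  proof -
    obtain y where y: "y \<in> W" "z = snd c y" using z by (elim imageE)
    then have "y \<in> fst c" "f y \<in> fst d" by (auto simp: W_def)
    then show ?thesis
      using y loc_rep_apply[OF A c(1), of y e "g \<circ> f"] loc_rep_apply[OF A c(1), of y d f]
        loc_rep_apply[OF B d(1), of "f y" e g] by simp
  qed
  have "frechet_derivative (loc_rep c e (g \<circ> f)) (at (snd c x)) =
      frechet_derivative (loc_rep d e g \<circ> loc_rep c d f) (at (snd c x))"
    by (rule frechet_derivative_cong_open[OF chart_open_image[OF A c(1) W(1,2)] _ eq]) (use W in auto)
  also have "\<dots> = frechet_derivative (loc_rep d e g) (at (snd d (f x))) \<circ> frechet_derivative (loc_rep c d f) (at (snd c x))"
    using frechet_derivative_compose[of "loc_rep c d f" "snd c x" "loc_rep d e g"]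
      loc_rep_differentiable[OF A B f c d] loc_rep_differentiable[OF B C g d e]
      loc_rep_apply[OF A c, of d f] unfolding differentiable_def by auto
  finally show ?thesis .
qed

lemma jacobian_compose:
  fixes A :: "('a::{t2_space,second_countable_topology}, real^'n) atlas"
  assumes A: "smooth_manifold A"
    and f: "smooth_map A A UNIV f" and g: "smooth_map A A UNIV g"
    and c: "c \<in> A" "x \<in> fst c" and d: "d \<in> A" "f x \<in> fst d" and e: "e \<in> A" "g (f x) \<in> fst e"
  shows "jacobian (loc_rep c e (g \<circ> f)) (snd c x) =
    jacobian (loc_rep d e g) (snd d (f x)) * jacobian (loc_rep c d f) (snd c x)"
  unfolding jacobian_def loc_rep_derivative_compose[OF A A A f g c d e]
  by (subst matrix_compose) (auto intro!: has_derivative_linear[OF loc_rep_differentiable[OF A A f c d]]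
      has_derivative_linear[OF loc_rep_differentiable[OF A A g d e]] simp: det_mul)

lemma loc_rep_id_derivative:
  fixes A :: "('a::{t2_space,second_countable_topology}, 'e::euclidean_space) atlas"
  assumes A: "smooth_manifold A" and c: "c \<in> A" "x \<in> fst c"
  shows "frechet_derivative (loc_rep c c id) (at (snd c x)) = id"
proof -
  have "frechet_derivative (loc_rep c c id) (at (snd c x)) = frechet_derivative id (at (snd c x))"
  proof (rule frechet_derivative_cong_open[OF chart_image_open[OF A c(1)]])
    show "loc_rep c c id z = id z" if "z \<in> snd c ` fst c" for z
      using f_inv_into_f[OF that] by (simp add: loc_rep_def)
  qed (use c in simp)
  then show ?thesis by simp
qed

lemma jacobian_id:
  fixes A :: "('a::{t2_space,second_countable_topology}, real^'n) atlas"
  assumes "smooth_manifold A" "c \<in> A" "x \<in> fst c"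
  shows "jacobian (loc_rep c c id) (snd c x) = 1"
  unfolding jacobian_def loc_rep_id_derivative[OF assms] by (simp add: matrix_id_mat_1)

lemma DiffD:
  assumes "\<sigma> \<in> Diff A"
  shows "bij \<sigma>" "smooth_map A A UNIV \<sigma>" "smooth_map A A UNIV (inv \<sigma>)"
  using assms by (auto simp: Diff_def)

lemma jacobian_inv:
  fixes A :: "('a::{t2_space,second_countable_topology}, real^'n) atlas"
  assumes A: "smooth_manifold A" and s: "\<sigma> \<in> Diff A"
    and c: "c \<in> A" "x \<in> fst c" and d: "d \<in> A" "\<sigma> x \<in> fst d"
  shows "jacobian (loc_rep d c (inv \<sigma>)) (snd d (\<sigma> x)) * jacobian (loc_rep c d \<sigma>) (snd c x) = 1"
  using jacobian_compose[OF A DiffD(2,3)[OF s] c d c(1)] jacobian_id[OF A c] c Diff_inv_simps[OF s]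
  by simp

text \<open>Frees \<open>push_forward\<close> from the chart picked by \<open>SOME\<close>: changing
  it multiplies the component of the form by a transition Jacobian, which the chain rule absorbs
  into the Jacobian of \<open>inv \<sigma>\<close>.\<close>

lemma push_forward_eq:
  fixes A :: "('a::{t2_space,second_countable_topology}, real^'n) atlas"
  assumes A: "smooth_manifold A" and s: "\<sigma> \<in> Diff A" and \<omega>: "\<omega> (inv \<sigma> y) \<in> top_forms_at A (inv \<sigma> y)"
    and d: "d \<in> A" "y \<in> fst d" and c: "c \<in> A" "inv \<sigma> y \<in> fst c"
  shows "push_forward A \<sigma> \<omega> y d = \<omega> (inv \<sigma> y) c * jacobian (loc_rep d c (inv \<sigma>)) (snd d y)"
proof -
  define c' where "c' = (SOME c. c \<in> A \<and> inv \<sigma> y \<in> fst c)"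
  have c': "c' \<in> A" "inv \<sigma> y \<in> fst c'"
    using someI[of "\<lambda>c. c \<in> A \<and> inv \<sigma> y \<in> fst c" c] c unfolding c'_def by blast+
  have "\<omega> (inv \<sigma> y) c' = \<omega> (inv \<sigma> y) c * jacobian (loc_rep c' c id) (snd c' (inv \<sigma> y))"
    using \<omega> c c' unfolding top_forms_at_def by blast
  moreover have "jacobian (loc_rep d c (inv \<sigma>)) (snd d y) =
      jacobian (loc_rep c' c id) (snd c' (inv \<sigma> y)) * jacobian (loc_rep d c' (inv \<sigma>)) (snd d y)"
    using jacobian_compose[OF A DiffD(3)[OF s] DiffD(2)[OF Diff_id[OF A]] d c' c(1)] c by simp
  ultimately show ?thesis
    using d unfolding push_forward_def c'_def[symmetric] by simp
qed

text \<open>The Jacobian never vanishes, since \<open>s \<epsilon>\<close> is invertible, and at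
  \<epsilon> = 0 it is 1 when both charts coincide; so its sign cannot change along the connected
  interval. As \<open>s \<epsilon> x\<close> may leave any single chart, the sign is followed
  instead of the Jacobian: in an oriented atlas it does not depend on the target chart.\<close>

lemma jacobian_family_pos:
  fixes A :: "('a::{t2_space,second_countable_topology}, real^'n) atlas"
  assumes or: "oriented_manifold A" and \<delta>: "0 < \<delta>"
    and s: "smooth_map (prod_atlas real_atlas A) A ({-\<delta><..<\<delta>} \<times> UNIV) (\<lambda>(\<epsilon>, x). s \<epsilon> x)"
    and D: "\<And>\<epsilon>. \<epsilon> \<in> {-\<delta><..<\<delta>} \<Longrightarrow> s \<epsilon> \<in> Diff A" and s0: "s 0 = id"
    and \<epsilon>: "\<epsilon> \<in> {-\<delta><..<\<delta>}" and c: "c \<in> A" "x \<in> fst c" and d: "d \<in> A" "s \<epsilon> x \<in> fst d"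
  shows "jacobian (loc_rep c d (s \<epsilon>)) (snd c x) > 0"
proof -
  let ?I = "{-\<delta><..<\<delta>}"
  have A: "smooth_manifold A" using or by (simp add: oriented_manifold_def)
  have chg: "sgn (jacobian (loc_rep c e (s \<epsilon>)) (snd c x)) = sgn (jacobian (loc_rep c d (s \<epsilon>)) (snd c x))"
    if "\<epsilon> \<in> ?I" "d \<in> A" "s \<epsilon> x \<in> fst d" "e \<in> A" "s \<epsilon> x \<in> fst e" for \<epsilon> d e
  proof -
    have "jacobian (loc_rep d e id) (snd d (s \<epsilon> x)) > 0"
      using or that unfolding oriented_manifold_def by blast
    moreover have "jacobian (loc_rep c e (s \<epsilon>)) (snd c x) =
        jacobian (loc_rep d e id) (snd d (s \<epsilon> x)) * jacobian (loc_rep c d (s \<epsilon>)) (snd c x)"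
      using jacobian_compose[OF A DiffD(2)[OF D[OF that(1)]] DiffD(2)[OF Diff_id[OF A]] c that(2,3,4)]
        that by simp
    ultimately show ?thesis by (simp add: sgn_mult)
  qed
  define h where "h = (\<lambda>\<epsilon>. sgn (jacobian (loc_rep c (SOME d. d \<in> A \<and> s \<epsilon> x \<in> fst d) (s \<epsilon>)) (snd c x)))"
  have h: "h \<epsilon> = sgn (jacobian (loc_rep c d (s \<epsilon>)) (snd c x))"
    if "\<epsilon> \<in> ?I" "d \<in> A" "s \<epsilon> x \<in> fst d" for \<epsilon> d
  proof -
    have "(SOME d. d \<in> A \<and> s \<epsilon> x \<in> fst d) \<in> A \<and> s \<epsilon> x \<in> fst (SOME d. d \<in> A \<and> s \<epsilon> x \<in> fst d)"
      using someI[of "\<lambda>d. d \<in> A \<and> s \<epsilon> x \<in> fst d" d] that by blast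
    then show ?thesis unfolding h_def using chg[OF that(1,2,3)] by blast
  qed
  have "h constant_on ?I"
  proof (rule locally_constant_imp_constant)
    show "connected ?I" by simp
    fix \<epsilon>0 assume \<epsilon>0: "\<epsilon>0 \<in> ?I"
    obtain d where d: "d \<in> A" "s \<epsilon>0 x \<in> fst d" using chart_exists[OF A] .
    define \<Omega> where "\<Omega> = {q. fst q \<in> ?I \<and> snd q \<in> snd c ` fst c \<and> s (fst q) (chart_inv c (snd q)) \<in> fst d}"
    define F where "F = (\<lambda>q. loc_rep c d (s (fst q)) (snd q))"
    have \<Omega>: "open \<Omega>" and F: "smooth_on \<Omega> F"
      unfolding \<Omega>_def F_def
      using family_loc_rep_open[OF A A _ s c(1) d(1)] family_loc_rep[OF A A _ s c(1) d(1)] by auto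
    \<comment> \<open>The parameters for which \<open>d\<close> still serves as target chart. On
      them the Jacobian is the continuous function \<open>J\<close> below, which gives local
      constancy of the sign.\<close>
    define I' where "I' = (\<lambda>\<epsilon>. (\<epsilon>, snd c x)) -` \<Omega>"
    have I': "open I'" unfolding I'_def by (rule open_vimage[OF \<Omega>]) (intro continuous_intros)
    have I'_iff: "\<epsilon> \<in> I' \<longleftrightarrow> \<epsilon> \<in> ?I \<and> s \<epsilon> x \<in> fst d" for \<epsilon>
      using c chart_inv_chart[OF A c] by (auto simp: I'_def \<Omega>_def)
    define J where "J = (\<lambda>\<epsilon>. det (matrix (\<lambda>h. frechet_derivative F (at (\<epsilon>, snd c x)) (0, h))))"
    have J: "jacobian (loc_rep c d (s \<epsilon>)) (snd c x) = J \<epsilon>" if "\<epsilon> \<in> I'" for \<epsilon>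
      unfolding jacobian_def J_def
      using frechet_derivative_at[OF has_derivative_slice[OF F, of \<epsilon> "snd c x"]] that
      by (simp add: I'_def F_def)
    have "continuous_on I' (\<lambda>\<epsilon>. frechet_derivative F (at (\<epsilon>, snd c x)) (0, axis j 1))" for j
      by (rule continuous_on_compose2[OF smooth_on_imp_continuous_on[OF smooth_on_derivative[OF F]]])
        (auto simp: I'_def intro!: continuous_intros)
    then have contJ: "continuous_on I' J"
      unfolding J_def matrix_def det_def vec_lambda_beta
      by (intro continuous_on_sum continuous_on_mult continuous_on_const continuous_on_prod
          continuous_on_component)
    have nz: "J \<epsilon> \<noteq> 0" if "\<epsilon> \<in> I'" for \<epsilon>
    proof -
      have "\<epsilon> \<in> ?I" "s \<epsilon> x \<in> fst d" using that unfolding I'_iff by simp_all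
      from jacobian_inv[OF A D[OF this(1)] c d(1) this(2)] show ?thesis using J[OF that] by auto
    qed
    have "\<epsilon>0 \<in> I'" using \<epsilon>0 d I'_iff by simp
    define T where "T = I' \<inter> (\<lambda>\<epsilon>. J \<epsilon> * J \<epsilon>0) -` {0<..}"
    have "open T" unfolding T_def
      by (intro continuous_open_preimage I' continuous_on_mult contJ continuous_on_const open_greaterThan)
    moreover have "\<epsilon>0 \<in> T" using \<open>\<epsilon>0 \<in> I'\<close> nz[of \<epsilon>0] by (auto simp: T_def zero_less_mult_iff)
    moreover have "h \<epsilon> = h \<epsilon>0" if "\<epsilon> \<in> T" for \<epsilon>
    proof -
      have "\<epsilon> \<in> I'" "J \<epsilon> * J \<epsilon>0 > 0" using that by (auto simp: T_def)
      then have "sgn (J \<epsilon>) = sgn (J \<epsilon>0)" by (auto simp: zero_less_mult_iff)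
      moreover have "h \<epsilon> = sgn (J \<epsilon>)" if "\<epsilon> \<in> I'" for \<epsilon>
        using h[OF _ d(1), of \<epsilon>] J[OF that] that unfolding I'_iff by simp
      ultimately show ?thesis using \<open>\<epsilon> \<in> I'\<close> \<open>\<epsilon>0 \<in> I'\<close> by simp
    qed
    moreover have "T \<subseteq> ?I"
    proof
      fix \<epsilon> assume "\<epsilon> \<in> T"
      then have "\<epsilon> \<in> I'" unfolding T_def by (rule IntD1)
      then show "\<epsilon> \<in> ?I" unfolding I'_iff by (rule conjunct1)
    qed
    ultimately show "\<exists>T. openin (top_of_set ?I) T \<and> \<epsilon>0 \<in> T \<and> (\<forall>\<epsilon>\<in>T. h \<epsilon> = h \<epsilon>0)"
      by (intro exI[of _ T] conjI open_subset ballI)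
  qed
  then obtain y where "\<forall>\<epsilon>\<in>?I. h \<epsilon> = y" unfolding constant_on_def by blast
  moreover have "0 \<in> ?I" using \<delta> by simp
  ultimately have "h \<epsilon> = h 0" using \<epsilon> by metis
  also have "h 0 = sgn (jacobian (loc_rep c c id) (snd c x))"
    using h[of 0 c] c \<delta> s0 by simp
  also have "\<dots> = 1" using jacobian_id[OF A c] by simp
  finally show ?thesis using h[OF \<epsilon> d] by (simp add: sgn_1_pos)
qed

section \<open>Transformation of integrals of top forms\<close>


text \<open>The theorem on vector-valued functions is applied to \<open>vec (f x)\<close> in
  \<open>real^1\<close>. It is an equivalence about a prescribed value of the integral; prescribing
  the integral of \<open>f\<close> over the image gives both conclusions.\<close>

lemma change_of_variables_real:
  fixes f :: "real^'n::{finite,wellorder} \<Rightarrow> real" and g :: "real^'n::_ \<Rightarrow> real^'n::_"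
  assumes "S \<in> sets lebesgue"
    and "\<And>x. x \<in> S \<Longrightarrow> (g has_derivative g' x) (at x within S)"
    and "inj_on g S"
    and "f absolutely_integrable_on (g ` S)"
  shows "(\<lambda>x. \<bar>det (matrix (g' x))\<bar> * f (g x)) absolutely_integrable_on S"
    and "integral S (\<lambda>x. \<bar>det (matrix (g' x))\<bar> * f (g x)) = integral (g ` S) f"
proof -
  have "(\<lambda>x. \<bar>det (matrix (g' x))\<bar> *\<^sub>R (vec (f (g x)) :: real^1)) absolutely_integrable_on S \<and>
      integral S (\<lambda>x. \<bar>det (matrix (g' x))\<bar> *\<^sub>R vec (f (g x))) = (vec (integral (g ` S) f) :: real^1) \<longleftrightarrow>
    (\<lambda>x. vec (f x) :: real^1) absolutely_integrable_on (g ` S) \<and>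
      integral (g ` S) (\<lambda>x. vec (f x)) = (vec (integral (g ` S) f) :: real^1)"
    by (rule has_absolute_integral_change_of_variables[OF assms(1-3)])
  moreover have "(\<lambda>x. vec (f x) :: real^1) absolutely_integrable_on (g ` S) \<and>
      integral (g ` S) (\<lambda>x. vec (f x)) = (vec (integral (g ` S) f) :: real^1)"
    using assms(4) by (simp add: absolutely_integrable_on_1_iff integral_on_1_eq)
  ultimately have "(\<lambda>x. \<bar>det (matrix (g' x))\<bar> *\<^sub>R (vec (f (g x)) :: real^1)) absolutely_integrable_on S \<and>
      integral S (\<lambda>x. \<bar>det (matrix (g' x))\<bar> *\<^sub>R vec (f (g x))) = (vec (integral (g ` S) f) :: real^1)"
    by (rule iffD2)
  then show "(\<lambda>x. \<bar>det (matrix (g' x))\<bar> * f (g x)) absolutely_integrable_on S"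
    "integral S (\<lambda>x. \<bar>det (matrix (g' x))\<bar> * f (g x)) = integral (g ` S) f"
    by (simp_all add: absolutely_integrable_on_1_iff integral_on_1_eq vec_eq_iff)
qed

text \<open>On a chart domain, the image under the chart is the preimage under its continuous
  inverse, and such preimages of Borel sets are Borel.\<close>

lemma chart_image_borel:
  assumes A: "smooth_manifold A" and c: "c \<in> A" and E: "E \<in> sets borel" "E \<subseteq> fst c"
  shows "snd c ` E \<in> sets borel"
proof -
  let ?S = "snd c ` fst c"
  have S: "?S \<in> sets borel" using chart_image_open[OF A c] by (rule borel_open)
  have "chart_inv c \<in> borel_measurable (restrict_space borel ?S)"
    by (rule borel_measurable_continuous_on_restrict[OF chart_inv_continuous_on[OF A c order_refl]])
  then have "chart_inv c -` E \<inter> space (restrict_space borel ?S) \<in> sets (restrict_space borel ?S)"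
    using E(1) by (rule measurable_sets)
  then have "chart_inv c -` E \<inter> ?S \<in> sets borel"
    using S by (simp add: sets_restrict_space_iff space_restrict_space)
  moreover have "chart_inv c -` E \<inter> ?S = snd c ` E"
  proof (intro subset_antisym subsetI)
    fix z assume "z \<in> chart_inv c -` E \<inter> ?S"
    then have "chart_inv c z \<in> E" "z \<in> ?S" by auto
    moreover from this(2) have "snd c (chart_inv c z) = z" by (rule f_inv_into_f)
    ultimately show "z \<in> snd c ` E" by (metis imageI)
  next
    fix z assume "z \<in> snd c ` E"
    then show "z \<in> chart_inv c -` E \<inter> ?S" using E(2) chart_inv_chart[OF A c] by auto
  qed
  ultimately show ?thesis by simp
qed

text \<open>Greedy choice: one set takes everything of \<open>K\<close> inside it, the remaining
  sets share what is left. With chart domains for \<open>U\<close>, a compact set is cut into Borel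
  pieces that each lie in one chart.\<close>

lemma borel_disjoint_refinement:
  fixes U :: "'i \<Rightarrow> 'a::topological_space set"
  assumes "finite D" "K \<in> sets borel" "\<And>d. d \<in> D \<Longrightarrow> open (U d)" "K \<subseteq> (\<Union>d\<in>D. U d)"
  shows "\<exists>Q. disjoint_family_on Q D \<and> (\<forall>d\<in>D. Q d \<in> sets borel \<and> Q d \<subseteq> U d) \<and> (\<Union>d\<in>D. Q d) = K"
  using assms
proof (induction D arbitrary: K rule: finite_induct)
  case empty
  then show ?case by (auto simp: disjoint_family_on_def)
next
  case (insert d D)
  have Ud: "U d \<in> sets borel" using insert.prems(2)[of d] by (simp add: borel_open)
  have "\<exists>Q. disjoint_family_on Q D \<and> (\<forall>d\<in>D. Q d \<in> sets borel \<and> Q d \<subseteq> U d) \<and> (\<Union>d\<in>D. Q d) = K - U d"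
  proof (rule insert.IH)
    show "K - U d \<in> sets borel" using insert.prems(1) Ud by (rule sets.Diff)
    show "open (U e)" if "e \<in> D" for e using insert.prems(2) that by blast
    show "K - U d \<subseteq> (\<Union>d\<in>D. U d)" using insert.prems(3) by blast
  qed
  then obtain Q where Q: "disjoint_family_on Q D" "\<forall>d\<in>D. Q d \<in> sets borel \<and> Q d \<subseteq> U d"
    "(\<Union>d\<in>D. Q d) = K - U d" by blast
  have ne: "e \<noteq> d" if "e \<in> D" for e using that insert.hyps by blast
  show ?case
  proof (intro exI[of _ "Q(d := K \<inter> U d)"] conjI ballI)
    show "disjoint_family_on (Q(d := K \<inter> U d)) (insert d D)"
      using Q(1,3) ne unfolding disjoint_family_on_def by auto
    show "(\<Union>e\<in>insert d D. (Q(d := K \<inter> U d)) e) = K"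
      using Q(3) ne by auto
    fix e assume e: "e \<in> insert d D"
    show "(Q(d := K \<inter> U d)) e \<in> sets borel"
      using e Q(2) insert.prems(1) Ud by (cases "e = d") (auto intro: sets.Int)
    show "(Q(d := K \<inter> U d)) e \<subseteq> U e" using e Q(2) by auto
  qed
qed

text \<open>Change of variables between two charts for a single piece. Positivity of the Jacobian
  removes the absolute value from the formula, which leaves exactly the component of the pulled back
  form.\<close>

lemma form_integral_piece:
  fixes A :: "('a::{t2_space,second_countable_topology}, real^'n::{finite,wellorder}) atlas"
  assumes A: "smooth_manifold A" and g: "g \<in> Diff A" and c: "c \<in> A" and d: "d \<in> A"
    and R: "R \<in> sets borel" "R \<subseteq> fst d" "g ` R \<subseteq> fst c"
    and pos: "\<And>y. y \<in> R \<Longrightarrow> jacobian (loc_rep d c g) (snd d y) > 0"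
    and rel: "\<And>y. y \<in> R \<Longrightarrow> \<omega>' y d = \<omega> (g y) c * jacobian (loc_rep d c g) (snd d y)"
    and int: "(\<lambda>z. \<omega> (chart_inv c z) c) absolutely_integrable_on (snd c ` g ` R)"
  shows "(\<lambda>z. \<omega>' (chart_inv d z) d) absolutely_integrable_on (snd d ` R)"
    and "integral (snd d ` R) (\<lambda>z. \<omega>' (chart_inv d z) d) = integral (snd c ` g ` R) (\<lambda>z. \<omega> (chart_inv c z) c)"
proof -
  let ?G = "loc_rep d c g" and ?S = "snd d ` R" and ?f = "\<lambda>z. \<omega> (chart_inv c z) c"
  let ?G' = "\<lambda>z. frechet_derivative ?G (at z)"
  have G: "?G (snd d y) = snd c (g y)" if "y \<in> R" for y
    using loc_rep_apply[OF A d, of y c g] R(2) that by blast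
  have im: "?G ` ?S = snd c ` g ` R" unfolding image_image by (rule image_cong[OF refl G])
  have S: "?S \<in> sets lebesgue" using chart_image_borel[OF A d R(1,2)] by simp
  have der: "(?G has_derivative ?G' z) (at z within ?S)" if z: "z \<in> ?S" for z
  proof -
    obtain y where "y \<in> R" "z = snd d y" using z by (elim imageE)
    then show ?thesis
      using loc_rep_differentiable[OF A A DiffD(2)[OF g] d _ c, of y] R(2,3)
      by (auto intro: has_derivative_at_withinI)
  qed
  have inj: "inj_on ?G ?S"
  proof (rule inj_on_imageI)
    have "inj_on (snd c \<circ> g) R"
      using chart_inj[OF A c] R(3) DiffD(1)[OF g]
      by (intro comp_inj_on) (auto intro: inj_on_subset simp: bij_def)
    moreover have "(?G \<circ> snd d) y = (snd c \<circ> g) y" if "y \<in> R" for y using G[OF that] by simp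
    ultimately show "inj_on (?G \<circ> snd d) R" using inj_on_cong by blast
  qed
  note cv = change_of_variables_real[OF S der inj, of ?f]
  have eq: "\<bar>det (matrix (?G' z))\<bar> * ?f (?G z) = \<omega>' (chart_inv d z) d" if z: "z \<in> ?S" for z
  proof -
    obtain y where y: "y \<in> R" "z = snd d y" using z by (elim imageE)
    have "chart_inv d z = y" using chart_inv_chart[OF A d] y R(2) by blast
    moreover have "chart_inv c (?G z) = g y" using G[OF y(1)] chart_inv_chart[OF A c, of "g y"] y R(3) by auto
    moreover have "det (matrix (?G' z)) = jacobian ?G (snd d y)" using y(2) by (simp add: jacobian_def)
    ultimately show ?thesis using pos[OF y(1)] rel[OF y(1)] by simp
  qed
  have ai: "(\<lambda>z. \<bar>det (matrix (?G' z))\<bar> * ?f (?G z)) absolutely_integrable_on ?S"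
    and i: "integral ?S (\<lambda>z. \<bar>det (matrix (?G' z))\<bar> * ?f (?G z)) = integral (snd c ` g ` R) ?f"
    using cv int unfolding im by blast+
  show "(\<lambda>z. \<omega>' (chart_inv d z) d) absolutely_integrable_on ?S"
  proof -
    have "(\<lambda>z. \<bar>det (matrix (?G' z))\<bar> * ?f (?G z)) absolutely_integrable_on ?S \<longleftrightarrow>
        (\<lambda>z. \<omega>' (chart_inv d z) d) absolutely_integrable_on ?S"
      by (rule set_integrable_cong[OF refl refl]) (rule eq)
    then show ?thesis using ai by blast
  qed
  show "integral ?S (\<lambda>z. \<omega>' (chart_inv d z) d) = integral (snd c ` g ` R) ?f"
    unfolding i[symmetric] by (rule integral_cong) (rule eq[symmetric])
qed

text \<open>Assumption \<open>rel\<close> says that \<open>\<omega>'\<close> is the pull-back of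
  \<open>\<omega>\<close> along \<open>g\<close>. The preimages of a partition for
  \<open>\<omega>\<close> need not lie in single charts, so they are cut further by a Borel
  partition \<open>Q\<close> of \<open>K\<close> subordinate to finitely many charts. The resulting
  pieces witness the same value \<open>J\<close>.\<close>

lemma has_form_integral_transform:
  fixes A :: "('a::{t2_space,second_countable_topology}, real^'n::{finite,wellorder}) atlas"
  assumes A: "smooth_manifold A" and g: "g \<in> Diff A" and K: "compact K" "g ` K = K"
    and pos: "\<And>c d y. c \<in> A \<Longrightarrow> d \<in> A \<Longrightarrow> y \<in> fst d \<Longrightarrow> g y \<in> fst c \<Longrightarrow>
      jacobian (loc_rep d c g) (snd d y) > 0"
    and rel: "\<And>c d y. c \<in> A \<Longrightarrow> d \<in> A \<Longrightarrow> y \<in> fst d \<Longrightarrow> g y \<in> fst c \<Longrightarrow>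
      \<omega>' y d = \<omega> (g y) c * jacobian (loc_rep d c g) (snd d y)"
    and int: "has_form_integral A K \<omega> J"
  shows "has_form_integral A K \<omega>' J"
proof -
  obtain P where P: "finite P" "disjoint_family_on snd P" "(\<Union>(c, E)\<in>P. E) = K"
    and Pc: "\<forall>(c, E)\<in>P. c \<in> A \<and> E \<in> sets borel \<and> E \<subseteq> fst c \<and>
      (\<lambda>z. \<omega> (chart_inv c z) c) absolutely_integrable_on (snd c ` E)"
    and J: "J = (\<Sum>(c, E)\<in>P. integral (snd c ` E) (\<lambda>z. \<omega> (chart_inv c z) c))"
    using int unfolding has_form_integral_def by blast
  have PA: "fst p \<in> A" "snd p \<in> sets borel" "snd p \<subseteq> fst (fst p)" "snd p \<subseteq> K"
    "(\<lambda>z. \<omega> (chart_inv (fst p) z) (fst p)) absolutely_integrable_on (snd (fst p) ` snd p)" if "p \<in> P" for p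
    using bspec[OF Pc that] P(3) that by (auto simp: case_prod_beta)
  have "K \<subseteq> (\<Union>d\<in>A. fst d)" using A unfolding smooth_manifold_def by blast
  then obtain D where D: "D \<subseteq> A" "finite D" "K \<subseteq> (\<Union>d\<in>D. fst d)"
    using compactE_image[OF K(1), of A fst] chart_open[OF A] by blast
  have Kb: "K \<in> sets borel" using compact_imp_closed[OF K(1)] by (rule borel_closed)
  obtain Q where Q: "disjoint_family_on Q D" "\<And>d. d \<in> D \<Longrightarrow> Q d \<in> sets borel"
    "\<And>d. d \<in> D \<Longrightarrow> Q d \<subseteq> fst d" "(\<Union>d\<in>D. Q d) = K"
    using borel_disjoint_refinement[OF D(2) Kb _ D(3)] chart_open[OF A] D(1) by (metis subsetD)
  have bij: "bij g" by (rule DiffD(1)[OF g])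
  have gK: "g y \<in> K \<longleftrightarrow> y \<in> K" for y
    using K(2) inj_image_mem_iff[OF bij_is_inj[OF bij], of y K] by simp
  \<comment> \<open>For an index \<open>((c, E), d)\<close>, the chart \<open>c\<close> serves for
    the image of the piece under \<open>g\<close>, and \<open>d\<close> for the piece
    itself.\<close>
  define R where "R = (\<lambda>i::(('a, real^'n::_) chart \<times> 'a set) \<times> ('a, real^'n::_) chart. g -` snd (fst i) \<inter> Q (snd i))"
  define h where "h = (\<lambda>i. (snd i, R i))"
  let ?I = "P \<times> D"
  have finI: "finite ?I" using P(1) D(2) by simp
  have R: "R i \<in> sets borel" "R i \<subseteq> fst (snd i)" "g ` R i \<subseteq> fst (fst (fst i))" if "i \<in> ?I" for i
  proof -
    have i: "fst i \<in> P" "snd i \<in> D" using that by auto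
    have "continuous_on UNIV g" by (rule smooth_map_continuous_on[OF A A DiffD(2)[OF g]])
    then have "g \<in> borel_measurable borel" by (rule borel_measurable_continuous_onI)
    then have "g -` snd (fst i) \<inter> space borel \<in> sets borel" using PA(2)[OF i(1)] by (rule measurable_sets)
    then show "R i \<in> sets borel" unfolding R_def using Q(2)[OF i(2)] by (simp add: sets.Int)
    show "R i \<subseteq> fst (snd i)" unfolding R_def using Q(3)[OF i(2)] by blast
    show "g ` R i \<subseteq> fst (fst (fst i))" unfolding R_def using PA(3)[OF i(1)] by blast
  qed
  have Rdisj: "R i \<inter> R j = {}" if "i \<in> ?I" "j \<in> ?I" "i \<noteq> j" for i j
  proof (cases "fst i = fst j")
    case True
    then have "snd i \<noteq> snd j" using that(3) prod_eqI by blast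
    then have "Q (snd i) \<inter> Q (snd j) = {}"
      using that(1,2) Q(1) unfolding disjoint_family_on_def mem_Times_iff by blast
    then show ?thesis unfolding R_def by blast
  next
    case False
    then have "snd (fst i) \<inter> snd (fst j) = {}"
      using that P(2) unfolding disjoint_family_on_def by (metis mem_Times_iff)
    then show ?thesis unfolding R_def by blast
  qed
  have piece: "(\<lambda>z. \<omega>' (chart_inv (snd i) z) (snd i)) absolutely_integrable_on (snd (snd i) ` R i)"
    "(\<lambda>z. \<omega> (chart_inv (fst (fst i)) z) (fst (fst i))) absolutely_integrable_on (snd (fst (fst i)) ` g ` R i)"
    "integral (snd (snd i) ` R i) (\<lambda>z. \<omega>' (chart_inv (snd i) z) (snd i)) =
      integral (snd (fst (fst i)) ` g ` R i) (\<lambda>z. \<omega> (chart_inv (fst (fst i)) z) (fst (fst i)))"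
    if i: "i \<in> ?I" for i
  proof -
    let ?c = "fst (fst i)" and ?d = "snd i"
    have iP: "fst i \<in> P" "?d \<in> A" using i D(1) by auto
    have c: "?c \<in> A" by (rule PA(1)[OF iP(1)])
    \<comment> \<open>Images under \<open>g\<close> are Borel because they are preimages under its
      continuous inverse.\<close>
    have "g ` R i = (inv g) -` R i" using bij_vimage_eq_inv_image[OF bij_imp_bij_inv[OF bij], of "R i"] inv_inv_eq[OF bij] by simp
    moreover have "continuous_on UNIV (inv g)" by (rule smooth_map_continuous_on[OF A A DiffD(3)[OF g]])
    then have "inv g \<in> borel_measurable borel" by (rule borel_measurable_continuous_onI)
    then have "inv g -` R i \<inter> space borel \<in> sets borel" using R(1)[OF i] by (rule measurable_sets)
    ultimately have "g ` R i \<in> sets borel" by simp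
    then have "snd ?c ` g ` R i \<in> sets lebesgue"
      using chart_image_borel[OF A c _ R(3)[OF i]] by simp
    moreover have "g ` R i \<subseteq> snd (fst i)" unfolding R_def by blast
    ultimately show int: "(\<lambda>z. \<omega> (chart_inv ?c z) ?c) absolutely_integrable_on (snd ?c ` g ` R i)"
      using set_integrable_subset[OF PA(5)[OF iP(1)]] image_mono by metis
    have y: "y \<in> fst ?d" "g y \<in> fst ?c" if "y \<in> R i" for y
      using R(2,3)[OF i] that by auto
    show "(\<lambda>z. \<omega>' (chart_inv ?d z) ?d) absolutely_integrable_on (snd ?d ` R i)"
      "integral (snd ?d ` R i) (\<lambda>z. \<omega>' (chart_inv ?d z) ?d) = integral (snd ?c ` g ` R i) (\<lambda>z. \<omega> (chart_inv ?c z) ?c)"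
      by (rule form_integral_piece[where \<omega>=\<omega> and \<omega>'=\<omega>', OF A g c iP(2) R[OF i] _ _ int];
          use pos[OF c iP(2) y] rel[OF c iP(2) y] in blast)+
  qed
  \<comment> \<open>For fixed \<open>p\<close> the images of the pieces under \<open>g\<close> tile
    \<open>snd p\<close>; they exhaust it because \<open>g\<close> maps \<open>K\<close> onto itself
    and \<open>Q\<close> covers \<open>K\<close>.\<close>
  have part: "integral (snd (fst p) ` snd p) (\<lambda>z. \<omega> (chart_inv (fst p) z) (fst p)) =
      (\<Sum>d\<in>D. integral (snd d ` R (p, d)) (\<lambda>z. \<omega>' (chart_inv d z) d))" if p: "p \<in> P" for p
  proof -
    let ?c = "fst p"
    have "((\<lambda>z. \<omega> (chart_inv ?c z) ?c) has_integral
        (\<Sum>d\<in>D. integral (snd ?c ` g ` R (p, d)) (\<lambda>z. \<omega> (chart_inv ?c z) ?c))) (\<Union>d\<in>D. snd ?c ` g ` R (p, d))"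
    proof (rule has_integral_UN[OF D(2)])
      show "((\<lambda>z. \<omega> (chart_inv ?c z) ?c) has_integral
          integral (snd ?c ` g ` R (p, d)) (\<lambda>z. \<omega> (chart_inv ?c z) ?c)) (snd ?c ` g ` R (p, d))" if "d \<in> D" for d
        using piece(2)[of "(p, d)"] p that set_lebesgue_integral_eq_integral(1) integrable_integral by auto
      have "snd ?c ` g ` R (p, d) \<inter> snd ?c ` g ` R (p, e) = {}" if "d \<in> D" "e \<in> D" "d \<noteq> e" for d e
      proof -
        have sub: "g ` R (p, d) \<subseteq> fst ?c" "g ` R (p, e) \<subseteq> fst ?c"
          using R(3)[of "(p, d)"] R(3)[of "(p, e)"] p that by auto
        have "R (p, d) \<inter> R (p, e) = {}" using Rdisj[of "(p, d)" "(p, e)"] p that by auto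
        then have "g ` R (p, d) \<inter> g ` R (p, e) = {}"
          using image_Int[OF bij_is_inj[OF bij]] by (metis image_empty)
        then show ?thesis
          using inj_on_image_Int[OF chart_inj[OF A PA(1)[OF p]] sub] by simp
      qed
      then show "pairwise (\<lambda>d e. negligible (snd ?c ` g ` R (p, d) \<inter> snd ?c ` g ` R (p, e))) D"
        by (simp add: pairwise_def)
    qed
    moreover have "(\<Union>d\<in>D. snd ?c ` g ` R (p, d)) = snd ?c ` snd p"
    proof -
      have "(\<Union>d\<in>D. g ` R (p, d)) = snd p"
      proof (intro subset_antisym subsetI)
        fix x assume x: "x \<in> snd p"
        then have "inv g x \<in> K" using PA(4)[OF p] gK[of "inv g x"] Diff_inv_simps(2)[OF g, of x] by auto
        then obtain d where "d \<in> D" "inv g x \<in> Q d" using Q(4) by blast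
        then show "x \<in> (\<Union>d\<in>D. g ` R (p, d))"
          using x Diff_inv_simps(2)[OF g, of x]
          by (intro UN_I[of d] image_eqI[of _ _ "inv g x"]) (auto simp: R_def)
      qed (auto simp: R_def)
      then show ?thesis unfolding image_UN[symmetric] by simp
    qed
    ultimately have "integral (snd ?c ` snd p) (\<lambda>z. \<omega> (chart_inv ?c z) ?c) =
        (\<Sum>d\<in>D. integral (snd ?c ` g ` R (p, d)) (\<lambda>z. \<omega> (chart_inv ?c z) ?c))"
      by (simp only: integral_unique)
    also have "\<dots> = (\<Sum>d\<in>D. integral (snd d ` R (p, d)) (\<lambda>z. \<omega>' (chart_inv d z) d))"
    proof (rule sum.cong[OF refl])
      fix d assume "d \<in> D"
      then have "(p, d) \<in> ?I" using p by blast
      from piece(3)[OF this] show "integral (snd ?c ` g ` R (p, d)) (\<lambda>z. \<omega> (chart_inv ?c z) ?c) =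
          integral (snd d ` R (p, d)) (\<lambda>z. \<omega>' (chart_inv d z) d)" by simp
    qed
    finally show ?thesis .
  qed
  have "J = (\<Sum>p\<in>P. \<Sum>d\<in>D. integral (snd d ` R (p, d)) (\<lambda>z. \<omega>' (chart_inv d z) d))"
    unfolding J case_prod_beta by (rule sum.cong[OF refl part])
  also have "\<dots> = (\<Sum>i\<in>?I. integral (snd (fst (h i)) ` snd (h i)) (\<lambda>z. \<omega>' (chart_inv (fst (h i)) z) (fst (h i))))"
    unfolding sum.cartesian_product h_def by (rule sum.cong) auto
  \<comment> \<open>\<open>h\<close> need not be injective, as it forgets the index
    \<open>p\<close>. Pieces with different indices are disjoint, so only empty ones can collide,
    and these contribute 0.\<close>
  also have "\<dots> = (\<Sum>p\<in>h ` ?I. integral (snd (fst p) ` snd p) (\<lambda>z. \<omega>' (chart_inv (fst p) z) (fst p)))"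
  proof (subst sum.reindex_nontrivial[OF finI])
    fix i j assume ij: "i \<in> ?I" "j \<in> ?I" "i \<noteq> j" "h i = h j"
    then have "snd (h i) = {}" using Rdisj[OF ij(1-3)] by (auto simp: h_def)
    then show "integral (snd (fst (h i)) ` snd (h i)) (\<lambda>z. \<omega>' (chart_inv (fst (h i)) z) (fst (h i))) = 0"
      by simp
  qed (simp add: o_def)
  finally have J': "J = (\<Sum>(d, E)\<in>h ` ?I. integral (snd d ` E) (\<lambda>z. \<omega>' (chart_inv d z) d))"
    unfolding case_prod_beta .
  show ?thesis
    unfolding has_form_integral_def
  proof (intro exI[of _ "h ` ?I"] conjI J')
    show "finite (h ` ?I)" using finI by simp
    show "disjoint_family_on snd (h ` ?I)"
      unfolding disjoint_family_on_def
    proof (intro ballI impI)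
      fix a b assume "a \<in> h ` ?I" "b \<in> h ` ?I" "a \<noteq> b"
      then obtain i j where "i \<in> ?I" "j \<in> ?I" "a = h i" "b = h j" by (elim imageE)
      then show "snd a \<inter> snd b = {}" using Rdisj[of i j] \<open>a \<noteq> b\<close> by (auto simp: h_def)
    qed
    show "(\<Union>(d, E)\<in>h ` ?I. E) = K"
    proof -
      have "(\<Union>(d, E)\<in>h ` ?I. E) = (\<Union>i\<in>?I. R i)" by (auto simp: h_def)
      also have "\<dots> = K"
      proof (intro subset_antisym subsetI)
        fix y assume "y \<in> (\<Union>i\<in>?I. R i)"
        then show "y \<in> K" using Q(4) by (auto simp: R_def)
      next
        fix y assume y: "y \<in> K"
        then have "g y \<in> (\<Union>(c, E)\<in>P. E)" using gK P(3) by simp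
        then obtain p where p: "p \<in> P" "g y \<in> snd p" by auto
        obtain d where d: "d \<in> D" "y \<in> Q d" using y Q(4) by blast
        have "y \<in> R (p, d)" using p d by (simp add: R_def)
        then show "y \<in> (\<Union>i\<in>?I. R i)" using p d by blast
      qed
      finally show ?thesis .
    qed
    show "\<forall>(d, E)\<in>h ` ?I. d \<in> A \<and> E \<in> sets borel \<and> E \<subseteq> fst d \<and>
        (\<lambda>z. \<omega>' (chart_inv d z) d) absolutely_integrable_on (snd d ` E)"
      unfolding case_prod_beta
    proof
      fix q assume "q \<in> h ` ?I"
      then obtain i where i: "i \<in> ?I" "q = h i" by (elim imageE)
      have "snd i \<in> A" using i(1) D(1) by auto
      then show "fst q \<in> A \<and> snd q \<in> sets borel \<and> snd q \<subseteq> fst (fst q) \<and>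
          (\<lambda>z. \<omega>' (chart_inv (fst q) z) (fst q)) absolutely_integrable_on (snd (fst q) ` snd q)"
        using R(1,2)[OF i(1)] piece(1)[OF i(1)] i(2) by (simp add: h_def)
    qed
  qed
qed

section \<open>Families of diffeomorphisms\<close>


text \<open>In charts, \<open>(\<epsilon>, z)\<close> goes to \<epsilon> together with the value of
  \<open>s \<epsilon>\<close> at \<open>z\<close>, and the derivative in \<open>z\<close> is
  invertible because each \<open>s \<epsilon>\<close> is a diffeomorphism. The inverse is known
  beforehand from \<open>inv (s \<epsilon>)\<close>; \<open>smooth_on_fibre_inverse\<close> supplies
  its smoothness and an open set on which it is represented in the chosen charts.\<close>

lemma smooth_map_family_inv:
  fixes A :: "('a::{t2_space,second_countable_topology}, real^'n) atlas"
  assumes A: "smooth_manifold A" and I: "open I"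
    and s: "smooth_map (prod_atlas real_atlas A) A (I \<times> UNIV) (\<lambda>(\<epsilon>, x). s \<epsilon> x)"
    and D: "\<And>\<epsilon>. \<epsilon> \<in> I \<Longrightarrow> s \<epsilon> \<in> Diff A"
  shows "smooth_map (prod_atlas real_atlas A) A (I \<times> UNIV) (\<lambda>(\<epsilon>, y). inv (s \<epsilon>) y)"
  unfolding smooth_map_def
proof
  fix q0 :: "real \<times> 'a" assume "q0 \<in> I \<times> UNIV"
  then obtain \<epsilon>0 y0 where q0: "q0 = (\<epsilon>0, y0)" "\<epsilon>0 \<in> I" by blast
  define x0 where "x0 = inv (s \<epsilon>0) y0"
  have sx0: "s \<epsilon>0 x0 = y0" using Diff_inv_simps(2)[OF D[OF q0(2)]] by (simp add: x0_def)
  obtain c where c: "c \<in> A" "x0 \<in> fst c" using chart_exists[OF A] .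
  obtain d where d: "d \<in> A" "y0 \<in> fst d" using chart_exists[OF A] .
  define \<Omega> where "\<Omega> = {q. fst q \<in> I \<and> snd q \<in> snd c ` fst c \<and> s (fst q) (chart_inv c (snd q)) \<in> fst d}"
  define F where "F = (\<lambda>q. loc_rep c d (s (fst q)) (snd q))"
  define \<Phi> where "\<Phi> = (\<lambda>q. (fst q, F q))"
  define g where "g = (\<lambda>r. snd c (inv (s (fst r)) (chart_inv d (snd r))))"
  have \<Omega>: "open \<Omega>" and F: "smooth_on \<Omega> F"
    unfolding \<Omega>_def F_def
    using family_loc_rep_open[OF A A I s c(1) d(1)] family_loc_rep[OF A A I s c(1) d(1)] by auto
  have \<Omega>D: "\<exists>x. x \<in> fst c \<and> snd q = snd c x \<and> s (fst q) x \<in> fst d \<and> fst q \<in> I \<and> F q = snd d (s (fst q) x)"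
    if q: "q \<in> \<Omega>" for q
  proof -
    have "snd q \<in> snd c ` fst c" using q by (simp add: \<Omega>_def)
    then obtain x where x: "x \<in> fst c" "snd q = snd c x" by (elim imageE)
    then have "s (fst q) x \<in> fst d" "fst q \<in> I" using q chart_inv_chart[OF A c(1) x(1)] by (simp_all add: \<Omega>_def)
    then show ?thesis using x loc_rep_apply[OF A c(1) x(1), of d "s (fst q)"] by (auto simp: F_def)
  qed
  have det: "det (matrix (\<lambda>h. frechet_derivative F (at q) (0, h))) \<noteq> 0" if q: "q \<in> \<Omega>" for q
  proof -
    obtain x where x: "x \<in> fst c" "snd q = snd c x" "s (fst q) x \<in> fst d" "fst q \<in> I"
      using \<Omega>D[OF q] by blast
    have "(fst q, snd q) \<in> \<Omega>" using q by simp
    from frechet_derivative_at[OF has_derivative_slice[OF F this]]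
    have "det (matrix (\<lambda>h. frechet_derivative F (at q) (0, h))) = jacobian (loc_rep c d (s (fst q))) (snd c x)"
      unfolding jacobian_def prod.collapse by (simp add: F_def x(2))
    then show ?thesis using jacobian_inv[OF A D[OF x(4)] c(1) x(1) d(1) x(3)] by auto
  qed
  have g: "g (fst q, F q) = snd q" if q: "q \<in> \<Omega>" for q
  proof -
    obtain x where x: "snd q = snd c x" "s (fst q) x \<in> fst d" "fst q \<in> I" "F q = snd d (s (fst q) x)"
      using \<Omega>D[OF q] by blast
    then show ?thesis
      using chart_inv_chart[OF A d(1) x(2)] Diff_inv_simps(1)[OF D[OF x(3)]] by (simp add: g_def)
  qed
  note inverse = smooth_on_fibre_inverse[OF \<Omega> F det g, folded \<Phi>_def]
  define p :: "(real \<times> 'a, real \<times> (real^'n)) chart" where "p = prod_chart (UNIV, id) d"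
  have M: "smooth_manifold (prod_atlas real_atlas A)"
    by (rule smooth_manifold_prod[OF smooth_manifold_real A])
  have p: "p \<in> prod_atlas real_atlas A" unfolding p_def by (rule prod_chart_in[OF real_chart d(1)])
  have fp: "fst p = UNIV \<times> fst d" and sp: "snd p r = (fst r, snd d (snd r))" for r
    unfolding p_def by (auto simp: map_prod_def split_beta')
  \<comment> \<open>Coordinates in the image of \<open>\<Phi>\<close> belong to a value
    \<open>s \<epsilon> x\<close> with \<open>x\<close> in the domain of \<open>c\<close>; by
    injectivity of the chart \<open>d\<close> this value is the given point, so
    \<open>inv (s \<epsilon>)\<close> lands in that domain on all of \<open>W\<close>.\<close>
  define W where "W = fst p \<inter> snd p -` (\<Phi> ` \<Omega>)"
  have W: "open W"
    unfolding W_def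
    by (rule continuous_open_preimage[OF chart_continuous_on[OF M p order_refl] chart_open[OF M p] inverse(1)])
  have WD: "fst r \<in> I" "inv (s (fst r)) (snd r) \<in> fst c" "r \<in> fst p" if r: "r \<in> W" for r
  proof -
    show "r \<in> fst p" using r by (simp add: W_def)
    have "snd p r \<in> \<Phi> ` \<Omega>" using r by (simp add: W_def)
    then obtain q where q: "q \<in> \<Omega>" "snd p r = \<Phi> q" by (elim imageE)
    obtain x where x: "x \<in> fst c" "s (fst q) x \<in> fst d" "fst q \<in> I" "F q = snd d (s (fst q) x)"
      using \<Omega>D[OF q(1)] by blast
    have e: "fst q = fst r" "snd d (snd r) = snd d (s (fst q) x)" using q(2) x(4) by (simp_all add: sp \<Phi>_def)
    have "snd r \<in> fst d" using \<open>r \<in> fst p\<close> unfolding fp by auto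
    then have "snd r = s (fst r) x" using inj_onD[OF chart_inj[OF A d(1)] e(2)] x(2) e(1) by simp
    then show "inv (s (fst r)) (snd r) \<in> fst c"
      using Diff_inv_simps(1)[OF D[OF x(3)]] x(1) e(1) by simp
    show "fst r \<in> I" using x(3) e(1) by simp
  qed
  have q0W: "q0 \<in> W"
  proof -
    have "(\<epsilon>0, snd c x0) \<in> \<Omega>"
      using q0(2) c d sx0 chart_inv_chart[OF A c] by (simp add: \<Omega>_def)
    moreover have "\<Phi> (\<epsilon>0, snd c x0) = (\<epsilon>0, snd d y0)"
      using loc_rep_apply[OF A c, of d "s \<epsilon>0"] sx0 by (simp add: \<Phi>_def F_def)
    ultimately have "snd p q0 \<in> \<Phi> ` \<Omega>"
      by (intro image_eqI[of _ _ "(\<epsilon>0, snd c x0)"]) (simp_all add: sp q0)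
    then show ?thesis using d q0 by (simp add: W_def fp)
  qed
  have "smooth_on (snd p ` W) (loc_rep p c (\<lambda>(\<epsilon>, y). inv (s \<epsilon>) y))"
  proof (rule smooth_on_cong)
    show "open (snd p ` W)" by (rule chart_open_image[OF M p W]) (use WD in blast)
    show "smooth_on (snd p ` W) g"
      by (rule smooth_on_subset[OF inverse(2)]) (auto simp: W_def)
    fix z assume "z \<in> snd p ` W"
    then obtain r where r: "r \<in> W" "z = snd p r" by (elim imageE)
    have "snd r \<in> fst d" using WD(3)[OF r(1)] unfolding fp by auto
    then have "g z = snd c (inv (s (fst r)) (snd r))"
      using chart_inv_chart[OF A d(1)] by (simp add: r(2) sp g_def)
    then show "g z = loc_rep p c (\<lambda>(\<epsilon>, y). inv (s \<epsilon>) y) z"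
      using loc_rep_apply[OF M p WD(3)[OF r(1)], of c "\<lambda>(\<epsilon>, y). inv (s \<epsilon>) y"] r(2)
      by (simp add: split_beta')
  qed
  then show "\<exists>p\<in>prod_atlas real_atlas A. \<exists>c\<in>A. \<exists>W. open W \<and> q0 \<in> W \<and> W \<subseteq> I \<times> UNIV \<inter> fst p \<and>
      (\<lambda>(\<epsilon>, y). inv (s \<epsilon>) y) ` W \<subseteq> fst c \<and> smooth_on (snd p ` W) (loc_rep p c (\<lambda>(\<epsilon>, y). inv (s \<epsilon>) y))"
    using p c(1) W q0W WD
    by (intro bexI[OF _ p] bexI[OF _ c(1)] exI[of _ W] conjI) (auto simp: split_beta')
qed

text \<open>In charts, \<open>act (s \<epsilon>) v\<close> is \<open>G\<close> of the jet
  coordinates of \<open>s \<epsilon>\<close> at the base point of \<open>v\<close> and of the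
  coordinates of \<open>v\<close>. The base point is a smooth function of \<open>v\<close>, so
  \<open>smooth_on_partials\<close> makes all these coordinates jointly smooth in \<epsilon> and
  \<open>v\<close>, and \<open>smooth_on_coords\<close> applies.\<close>

lemma smooth_map_family_action:
  fixes AX :: "('x::{t2_space,second_countable_topology}, real^'n) atlas"
    and AV :: "('v::{t2_space,second_countable_topology}, 'ev::euclidean_space) atlas"
  assumes X: "smooth_manifold AX" and V: "smooth_manifold AV" and pV: "smooth_map AV AX UNIV pV" and I: "open I"
    and s: "smooth_map (prod_atlas real_atlas AX) AX (I \<times> UNIV) (\<lambda>(\<epsilon>, x). s \<epsilon> x)"
    and D: "\<And>\<epsilon>. \<epsilon> \<in> I \<Longrightarrow> s \<epsilon> \<in> Diff AX"
    and ind: "differential_index_le AX AV pV act k"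
  shows "smooth_map (prod_atlas real_atlas AV) AV (I \<times> UNIV) (\<lambda>(\<epsilon>, v). act (s \<epsilon>) v)"
  unfolding smooth_map_def
proof
  fix q0 :: "real \<times> 'v" assume "q0 \<in> I \<times> UNIV"
  then obtain \<epsilon>0 v0 where q0: "q0 = (\<epsilon>0, v0)" "\<epsilon>0 \<in> I" by blast
  obtain c d e e' S G where c: "c \<in> AX" and d: "d \<in> AX" and e: "e \<in> AV" and e': "e' \<in> AV"
    and in0: "pV v0 \<in> fst c" "s \<epsilon>0 (pV v0) \<in> fst d" "v0 \<in> fst e"
    and G: "smooth_coords (jet_index k) S (G :: _ \<Rightarrow> 'ev)"
    and inS: "jet_coords c d e (s \<epsilon>0) (pV v0) v0 \<in> S"
    and actG: "\<And>\<sigma> v. \<sigma> \<in> Diff AX \<Longrightarrow> pV v \<in> fst c \<Longrightarrow> \<sigma> (pV v) \<in> fst d \<Longrightarrow> v \<in> fst e \<Longrightarrow>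
      jet_coords c d e \<sigma> (pV v) v \<in> S \<Longrightarrow>
      act \<sigma> v \<in> fst e' \<and> snd e' (act \<sigma> v) = G (jet_coords c d e \<sigma> (pV v) v)"
    using ind D[OF q0(2)] unfolding differential_index_le_def by metis
  define \<Omega> where "\<Omega> = {q. fst q \<in> I \<and> snd q \<in> snd c ` fst c \<and> s (fst q) (chart_inv c (snd q)) \<in> fst d}"
  define F where "F = (\<lambda>q. loc_rep c d (s (fst q)) (snd q))"
  have \<Omega>: "open \<Omega>" and F: "smooth_on \<Omega> F"
    unfolding \<Omega>_def F_def
    using family_loc_rep_open[OF X X I s c d] family_loc_rep[OF X X I s c d] by auto
  have P: "smooth_on \<Omega> (\<lambda>q. partials \<alpha> (loc_rep c d (s (fst q))) (snd q))" for \<alpha>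
    using smooth_on_partials[OF \<Omega> F, of \<alpha>] by (simp add: F_def)
  define p :: "(real \<times> 'v, real \<times> 'ev) chart" where "p = prod_chart (UNIV, id) e"
  have M: "smooth_manifold (prod_atlas real_atlas AV)"
    by (rule smooth_manifold_prod[OF smooth_manifold_real V])
  have p: "p \<in> prod_atlas real_atlas AV" unfolding p_def by (rule prod_chart_in[OF real_chart e])
  have fp: "fst p = UNIV \<times> fst e" and sp: "snd p r = (fst r, snd e (snd r))" for r
    unfolding p_def by (auto simp: map_prod_def split_beta')
  define N where "N = fst e \<inter> pV -` fst c"
  have cp: "continuous_on UNIV pV" by (rule smooth_map_continuous_on[OF V X pV])
  have N: "open N" "N \<subseteq> fst e" "pV ` N \<subseteq> fst c"
    unfolding N_def using open_vimage[OF chart_open[OF X c] cp] chart_open[OF V e] by auto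
  \<comment> \<open>Where the charts \<open>c\<close>, \<open>d\<close> and \<open>e\<close> apply.
    The set \<open>W\<close> below also asks that the jet coordinates lie in the domain
    \<open>S\<close> of \<open>G\<close>, an open condition because they are continuous.\<close>
  define W0 where "W0 = (\<lambda>r. (fst r, pV (snd r))) -` {q. fst q \<in> I \<and> s (fst q) (snd q) \<in> fst d} \<inter> UNIV \<times> N"
  have W0_iff: "r \<in> W0 \<longleftrightarrow> fst r \<in> I \<and> s (fst r) (pV (snd r)) \<in> fst d \<and> snd r \<in> fst e \<and> pV (snd r) \<in> fst c" for r
    unfolding W0_def N_def by (cases r) auto
  have W0: "open W0" "W0 \<subseteq> fst p"
  proof -
    have "continuous_on UNIV (\<lambda>r::real \<times> 'v. (fst r, pV (snd r)))"
      by (intro continuous_on_Pair continuous_on_fst continuous_on_id continuous_on_compose2[OF cp]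
          continuous_on_snd) auto
    then show "open W0"
      unfolding W0_def
      by (intro open_Int open_vimage family_open[OF X X I s chart_open[OF X d]] open_Times open_UNIV N(1))
    show "W0 \<subseteq> fst p" unfolding W0_def fp using N(2) by auto
  qed
  define Z0 where "Z0 = snd p ` W0"
  have Z0: "open Z0" unfolding Z0_def by (rule chart_open_image[OF M p W0])
  define \<phi> where "\<phi> = (\<lambda>z. jet_coords c d e (s (fst (chart_inv p z))) (pV (snd (chart_inv p z))) (snd (chart_inv p z)))"
  have \<phi>_apply: "\<phi> (snd p r) = jet_coords c d e (s (fst r)) (pV (snd r)) (snd r)" if "r \<in> W0" for r
    using chart_inv_chart[OF M p, of r] W0(2) that by (auto simp: \<phi>_def)
  have \<phi>: "smooth_on Z0 (\<lambda>z. \<phi> z i)" for i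
  proof (cases i)
    case (Inl au)
    obtain \<alpha> u where au: "au = (\<alpha>, u)" by (cases au)
    have lp: "smooth_on (snd e ` N) (loc_rep e c pV)"
      by (rule smooth_map_loc_rep[OF V X pV e c N(1) subset_UNIV N(2,3)])
    have Z0D: "fst z = fst r \<and> snd z = snd e (snd r) \<and> snd r \<in> N \<and> loc_rep e c pV (snd z) = snd c (pV (snd r)) \<and>
        (fst r, snd c (pV (snd r))) \<in> \<Omega>" if "r \<in> W0" "z = snd p r" for z r
    proof -
      have r: "fst r \<in> I" "s (fst r) (pV (snd r)) \<in> fst d" "snd r \<in> fst e" "pV (snd r) \<in> fst c"
        using that(1) unfolding W0_iff by simp_all
      show ?thesis
        using r that(2) loc_rep_apply[OF V e r(3), of c pV] chart_inv_chart[OF X c r(4)]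
        by (simp add: sp \<Omega>_def N_def)
    qed
    have pair: "smooth_on Z0 (\<lambda>z. (fst z, loc_rep e c pV (snd z)))"
    proof (rule smooth_on_Pair[OF Z0 smooth_on_linear[OF Z0 bounded_linear_fst]])
      have "snd ` Z0 \<subseteq> snd e ` N"
      proof (rule image_subsetI)
        fix z assume "z \<in> Z0"
        then obtain r where r: "r \<in> W0" "z = snd p r" unfolding Z0_def by (elim imageE)
        then show "snd z \<in> snd e ` N" using Z0D[OF r] by blast
      qed
      then show "smooth_on Z0 (\<lambda>z. loc_rep e c pV (snd z))"
        by (rule smooth_on_compose[OF Z0 smooth_on_linear[OF Z0 bounded_linear_snd] lp])
    qed
    have "smooth_on Z0 (\<lambda>z. partials \<alpha> (loc_rep c d (s (fst z))) (loc_rep e c pV (snd z)))"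
    proof -
      have "(\<lambda>z. (fst z, loc_rep e c pV (snd z))) ` Z0 \<subseteq> \<Omega>"
      proof (rule image_subsetI)
        fix z assume "z \<in> Z0"
        then obtain r where r: "r \<in> W0" "z = snd p r" unfolding Z0_def by (elim imageE)
        from Z0D[OF r] have "fst z = fst r" "loc_rep e c pV (snd z) = snd c (pV (snd r))"
          "(fst r, snd c (pV (snd r))) \<in> \<Omega>" by blast+
        then show "(fst z, loc_rep e c pV (snd z)) \<in> \<Omega>" by (simp only:)
      qed
      from smooth_on_compose[OF Z0 pair P[of \<alpha>] this] show ?thesis by simp
    qed
    then have "smooth_on Z0 (\<lambda>z. partials \<alpha> (loc_rep c d (s (fst z))) (loc_rep e c pV (snd z)) \<bullet> u)"
      by (rule smooth_on_bounded_linear[OF Z0 bounded_linear_inner_left])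
    then show ?thesis
    proof (rule smooth_on_cong[OF Z0])
      fix z assume "z \<in> Z0"
      then obtain r where r: "r \<in> W0" "z = snd p r" unfolding Z0_def by (elim imageE)
      from Z0D[OF r] have "fst z = fst r" "loc_rep e c pV (snd z) = snd c (pV (snd r))" by blast+
      moreover have "\<phi> z i = partials \<alpha> (loc_rep c d (s (fst r))) (snd c (pV (snd r))) \<bullet> u"
        unfolding r(2) \<phi>_apply[OF r(1)] by (simp add: jet_coords_def Inl au)
      ultimately show "partials \<alpha> (loc_rep c d (s (fst z))) (loc_rep e c pV (snd z)) \<bullet> u = \<phi> z i"
        by (simp only:)
    qed
  next
    case (Inr u)
    have "smooth_on Z0 (\<lambda>z. snd z \<bullet> u)"
      by (rule smooth_on_bounded_linear[OF Z0 bounded_linear_inner_left smooth_on_linear[OF Z0 bounded_linear_snd]])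
    then show ?thesis
    proof (rule smooth_on_cong[OF Z0])
      fix z assume "z \<in> Z0"
      then obtain r where r: "r \<in> W0" "z = snd p r" unfolding Z0_def by (elim imageE)
      then show "snd z \<bullet> u = \<phi> z i"
        using \<phi>_apply[OF r(1)] by (simp add: jet_coords_def Inr sp)
    qed
  qed
  have S: "open S" using G unfolding smooth_coords_def by blast
  have "continuous_on Z0 \<phi>"
    by (rule continuous_on_coordinatewise_then_product) (rule smooth_on_imp_continuous_on[OF \<phi>])
  then have "continuous_on W0 (\<lambda>r. \<phi> (snd p r))"
    by (rule continuous_on_compose2[OF _ chart_continuous_on[OF M p W0(2)]]) (simp add: Z0_def)
  then have oW: "open (W0 \<inter> (\<lambda>r. \<phi> (snd p r)) -` S)"
    by (rule continuous_open_preimage[OF _ W0(1) S])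
  define W where "W = W0 \<inter> (\<lambda>r. \<phi> (snd p r)) -` S"
  have W: "open W" "W \<subseteq> fst p" "W \<subseteq> W0" using oW W0(2) by (auto simp: W_def)
  have WD: "act (s (fst r)) (snd r) \<in> fst e' \<and> snd e' (act (s (fst r)) (snd r)) = G (\<phi> (snd p r))"
    if r: "r \<in> W" for r
  proof -
    have r0: "r \<in> W0" "\<phi> (snd p r) \<in> S" using r by (simp_all add: W_def)
    then have "fst r \<in> I" "s (fst r) (pV (snd r)) \<in> fst d" "snd r \<in> fst e" "pV (snd r) \<in> fst c"
      unfolding W0_iff by simp_all
    then show ?thesis
      using actG[OF D, of "fst r" "snd r"] r0 \<phi>_apply[OF r0(1)] by simp
  qed
  have q0W: "q0 \<in> W"
  proof -
    have "q0 \<in> W0" unfolding W0_iff using q0 in0 by simp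
    then show ?thesis using \<phi>_apply[of q0] inS by (simp add: W_def q0)
  qed
  have o: "open (snd p ` W)" by (rule chart_open_image[OF M p W(1,2)])
  have "smooth_on (snd p ` W) (loc_rep p e' (\<lambda>(\<epsilon>, v). act (s \<epsilon>) v))"
  proof (rule smooth_on_cong[OF o])
    show "smooth_on (snd p ` W) (\<lambda>z. G (\<phi> z))"
    proof (rule smooth_on_coords[OF G o])
      show "\<phi> ` snd p ` W \<subseteq> S" by (auto simp: W_def)
      show "smooth_on (snd p ` W) (\<lambda>z. \<phi> z i)" for i
        by (rule smooth_on_subset[OF \<phi>]) (auto simp: W_def Z0_def)
    qed
    fix z assume "z \<in> snd p ` W"
    then obtain r where r: "r \<in> W" "z = snd p r" by (elim imageE)
    have rp: "r \<in> fst p" using r(1) W(2) by blast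
    show "G (\<phi> z) = loc_rep p e' (\<lambda>(\<epsilon>, v). act (s \<epsilon>) v) z"
      using loc_rep_apply[OF M p rp, of e' "\<lambda>(\<epsilon>, v). act (s \<epsilon>) v"] WD[OF r(1)] r(2)
      by (simp add: split_beta')
  qed
  moreover have "W \<subseteq> I \<times> UNIV \<inter> fst p"
  proof
    fix r assume r: "r \<in> W"
    then have "fst r \<in> I" using W(3) W0_iff by blast
    then show "r \<in> I \<times> UNIV \<inter> fst p" using r W(2) by (auto simp: mem_Times_iff)
  qed
  moreover have "(\<lambda>(\<epsilon>, v). act (s \<epsilon>) v) ` W \<subseteq> fst e'" using WD by (auto simp: split_beta')
  ultimately show "\<exists>p\<in>prod_atlas real_atlas AV. \<exists>e'\<in>AV. \<exists>W. open W \<and> q0 \<in> W \<and> W \<subseteq> I \<times> UNIV \<inter> fst p \<and>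
      (\<lambda>(\<epsilon>, v). act (s \<epsilon>) v) ` W \<subseteq> fst e' \<and> smooth_on (snd p ` W) (loc_rep p e' (\<lambda>(\<epsilon>, v). act (s \<epsilon>) v))"
    using W(1) q0W by (intro bexI[OF _ p] bexI[OF _ e'] exI[of _ W] conjI)
qed

text \<open>The charts and \<open>G\<close> are taken around \<open>\<sigma>\<close> and
  \<open>v\<close>. On \<open>jet_index k\<close> the jet coordinates of \<open>\<tau>\<close>
  coincide with those of \<open>\<sigma>\<close>, so they lie in \<open>S\<close> too and give the
  same value of \<open>G\<close>. This serves both the well-definedness of the modified Lagrangian
  and the locality of the action on \<open>V\<close>.\<close>

lemma action_determined_by_jet:
  fixes AX :: "('x::{t2_space,second_countable_topology}, real^'n) atlas"
    and AV :: "('v::{t2_space,second_countable_topology}, 'ev::euclidean_space) atlas"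
  assumes V: "smooth_manifold AV" and ind: "differential_index_le AX AV p act k"
    and s: "\<sigma> \<in> Diff AX" and t: "\<tau> \<in> Diff AX" and agree: "jet_agree AX AX k (p v) \<sigma> \<tau>"
  shows "act \<sigma> v = act \<tau> v"
proof -
  obtain c d e e' S G where c: "c \<in> AX" and d: "d \<in> AX" and e: "e \<in> AV" and e': "e' \<in> AV"
    and in0: "p v \<in> fst c" "\<sigma> (p v) \<in> fst d" "v \<in> fst e"
    and G: "smooth_coords (jet_index k) S (G :: _ \<Rightarrow> 'ev)"
    and inS: "jet_coords c d e \<sigma> (p v) v \<in> S"
    and actG: "\<And>\<sigma> v. \<sigma> \<in> Diff AX \<Longrightarrow> p v \<in> fst c \<Longrightarrow> \<sigma> (p v) \<in> fst d \<Longrightarrow> v \<in> fst e \<Longrightarrow>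
      jet_coords c d e \<sigma> (p v) v \<in> S \<Longrightarrow>
      act \<sigma> v \<in> fst e' \<and> snd e' (act \<sigma> v) = G (jet_coords c d e \<sigma> (p v) v)"
    using ind s unfolding differential_index_le_def by metis
  let ?js = "jet_coords c d e \<sigma> (p v) v" and ?jt = "jet_coords c d e \<tau> (p v) v"
  have eq: "\<tau> (p v) = \<sigma> (p v)" using agree by (simp add: jet_agree_def)
  have "?jt i = ?js i" if "i \<in> jet_index k" for i
    using that agree c d in0 unfolding jet_index_def jet_agree_def jet_coords_def by auto
  then have "?jt \<in> S" "G ?jt = G ?js" using G inS unfolding smooth_coords_def by metis+
  then show ?thesis
    using actG[OF s in0 inS] actG[OF t in0(1) _ in0(3)] eq in0(2) inj_onD[OF chart_inj[OF V e']] by metis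
qed

section \<open>Jets of sections and the modified Lagrangian\<close>


lemma smooth_section_local: "smooth_section AX AV p s \<Longrightarrow> local_section AX AV p x s"
  unfolding smooth_section_def local_section_def by (intro exI[of _ UNIV]) simp

lemma jet_agreeD:
  assumes "jet_agree AX AV r x s t" "c \<in> AX" "x \<in> fst c" "d \<in> AV" "s x \<in> fst d" "length \<alpha> \<le> r"
  shows "partials \<alpha> (loc_rep c d s) (snd c x) = partials \<alpha> (loc_rep c d t) (snd c x)"
  using assms unfolding jet_agree_def by blast

lemma jet_agree_mono:
  assumes "jet_agree AX AV r x s t" "k \<le> r"
  shows "jet_agree AX AV k x s t"
  unfolding jet_agree_def
proof (intro conjI ballI allI impI)
  show "s x = t x" using assms(1) by (simp add: jet_agree_def)
qed (use assms(2) in \<open>auto intro!: jet_agreeD[OF assms(1)]\<close>)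

text \<open>A local section belongs to its own jet class; equality of the classes puts it into that
  of \<open>s\<close>.\<close>

lemma jet_eqD:
  assumes "jet AX AV p r s x = jet AX AV p r t y" "local_section AX AV p y t"
  shows "jet_agree AX AV r x s t"
proof -
  have "t \<in> snd (jet AX AV p r t y)" using assms(2) by (simp add: jet_def jet_agree_def)
  then show "jet_agree AX AV r x s t" unfolding assms(1)[symmetric] by (simp add: jet_def)
qed

lemma jet_eqI:
  assumes "jet_agree AX AV r x s t"
  shows "jet AX AV p r s x = jet AX AV p r t x"
proof -
  have "jet_agree AX AV r x s u \<longleftrightarrow> jet_agree AX AV r x t u" for u
    using assms unfolding jet_agree_def by metis
  then show ?thesis by (simp add: jet_def)
qed

lemma loc_rep_smooth_near:
  fixes A :: "('a::{t2_space,second_countable_topology}, 'ea::euclidean_space) atlas"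
    and B :: "('b::{t2_space,second_countable_topology}, 'eb::euclidean_space) atlas"
  assumes A: "smooth_manifold A" and B: "smooth_manifold B" and f: "smooth_map A B U f"
    and U: "open U" "x \<in> U" and c: "c \<in> A" "x \<in> fst c" and d: "d \<in> B" "f x \<in> fst d"
  shows "\<exists>S. open S \<and> snd c x \<in> S \<and> smooth_on S (loc_rep c d f)"
proof -
  define W where "W = (U \<inter> f -` fst d) \<inter> fst c"
  have W: "open W" "W \<subseteq> U" "W \<subseteq> fst c" "f ` W \<subseteq> fst d" "x \<in> W"
    unfolding W_def
    using continuous_open_preimage[OF smooth_map_continuous_on[OF A B f] U(1) chart_open[OF B d(1)]]
      chart_open[OF A c(1)] U(2) c d by auto
  show ?thesis
    using smooth_map_loc_rep[OF A B f c(1) d(1) W(1-4)] chart_open_image[OF A c(1) W(1,3)] W(5) by blast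
qed

text \<open>A chart of one factor is completed to a product chart by any chart around the value of
  the other component. The projections then commute with \<open>partials\<close>, all maps being
  smooth near \<open>x\<close>.\<close>

lemma jet_agree_Pair:
  fixes AX :: "('x::{t2_space,second_countable_topology}, real^'n) atlas"
    and B :: "('b::{t2_space,second_countable_topology}, 'eb::euclidean_space) atlas"
    and C :: "('c::{t2_space,second_countable_topology}, 'ec::euclidean_space) atlas"
  assumes X: "smooth_manifold AX" and B: "smooth_manifold B" and C: "smooth_manifold C"
    and U: "open U" "x \<in> U"
    and f: "smooth_map AX B U f" "smooth_map AX B U f'" and g: "smooth_map AX C U g" "smooth_map AX C U g'"
    and agree: "jet_agree AX (prod_atlas B C) r x (\<lambda>x. (f x, g x)) (\<lambda>x. (f' x, g' x))"
  shows "jet_agree AX B r x f f'" "jet_agree AX C r x g g'"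
proof -
  have eq: "f x = f' x" "g x = g' x" using agree by (auto simp: jet_agree_def)
  have BC: "smooth_manifold (prod_atlas B C)" by (rule smooth_manifold_prod[OF B C])
  have *: "partials \<alpha> (loc_rep c d f) (snd c x) = partials \<alpha> (loc_rep c d f') (snd c x) \<and>
      partials \<alpha> (loc_rep c e g) (snd c x) = partials \<alpha> (loc_rep c e g') (snd c x)"
    if c: "c \<in> AX" "x \<in> fst c" and d: "d \<in> B" "f x \<in> fst d" and e: "e \<in> C" "g x \<in> fst e"
      and \<alpha>: "length \<alpha> \<le> r" for c d e \<alpha>
  proof -
    let ?p = "prod_chart d e"
    have p: "?p \<in> prod_atlas B C" by (rule prod_chart_in[OF d(1) e(1)])
    have proj: "partials \<alpha> (loc_rep c d h) (snd c x) = fst (partials \<alpha> (loc_rep c ?p (\<lambda>x. (h x, k x))) (snd c x)) \<and>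
        partials \<alpha> (loc_rep c e k) (snd c x) = snd (partials \<alpha> (loc_rep c ?p (\<lambda>x. (h x, k x))) (snd c x))"
      if h: "smooth_map AX B U h" "h x \<in> fst d" and k: "smooth_map AX C U k" "k x \<in> fst e" for h k
    proof -
      have "smooth_map AX (prod_atlas B C) U (\<lambda>x. (h x, k x))"
        by (rule smooth_map_Pair[OF X B C U(1) h(1) k(1)])
      then obtain S where S: "open S" "snd c x \<in> S" "smooth_on S (loc_rep c ?p (\<lambda>x. (h x, k x)))"
        using loc_rep_smooth_near[OF X BC _ U c p, of "\<lambda>x. (h x, k x)"] h(2) k(2) by auto
      have "loc_rep c d h = (\<lambda>z. fst (loc_rep c ?p (\<lambda>x. (h x, k x)) z))"
        "loc_rep c e k = (\<lambda>z. snd (loc_rep c ?p (\<lambda>x. (h x, k x)) z))"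
        by (simp_all add: loc_rep_def o_def)
      then show ?thesis
        using partials_bounded_linear[OF S(1,2) bounded_linear_fst S(3), of \<alpha>]
          partials_bounded_linear[OF S(1,2) bounded_linear_snd S(3), of \<alpha>] by simp
    qed
    have "partials \<alpha> (loc_rep c ?p (\<lambda>x. (f x, g x))) (snd c x) =
        partials \<alpha> (loc_rep c ?p (\<lambda>x. (f' x, g' x))) (snd c x)"
      by (rule jet_agreeD[OF agree c p _ \<alpha>]) (use d e in simp)
    then show ?thesis
      using proj[OF f(1) d(2) g(1) e(2)] proj[OF f(2) d(2)[unfolded eq] g(2) e(2)[unfolded eq]] by simp
  qed
  obtain d where d: "d \<in> B" "f x \<in> fst d" using chart_exists[OF B] .
  obtain e where e: "e \<in> C" "g x \<in> fst e" using chart_exists[OF C] .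
  show "jet_agree AX B r x f f'" unfolding jet_agree_def using *[OF _ _ _ _ e] eq by blast
  show "jet_agree AX C r x g g'" unfolding jet_agree_def using *[OF _ _ d] eq by blast
qed

text \<open>The derivative of an inverse is the inverse of the derivative; as the derivatives of
  \<open>\<sigma>\<close> and \<open>\<tau>\<close> at \<open>x\<close> agree, so do those of their
  inverses at the common image. At order 1 there is only the value besides.\<close>

lemma jet_agree_inv:
  fixes A :: "('x::{t2_space,second_countable_topology}, real^'n) atlas"
  assumes A: "smooth_manifold A" and s: "\<sigma> \<in> Diff A" and t: "\<tau> \<in> Diff A"
    and agree: "jet_agree A A 1 x \<sigma> \<tau>"
  shows "jet_agree A A 1 (\<sigma> x) (inv \<sigma>) (inv \<tau>)"
  unfolding jet_agree_def
proof (intro conjI ballI allI impI)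
  have eq: "\<tau> x = \<sigma> x" using agree by (simp add: jet_agree_def)
  have inv_s: "inv \<sigma> (\<sigma> x) = x" and inv_t: "inv \<tau> (\<sigma> x) = x"
    using Diff_inv_simps(1)[OF s, of x] Diff_inv_simps(1)[OF t, of x] eq by simp_all
  then show "inv \<sigma> (\<sigma> x) = inv \<tau> (\<sigma> x)" by simp
  fix c d \<alpha> assume c: "c \<in> A" and d: "d \<in> A" and cd: "\<sigma> x \<in> fst c \<and> inv \<sigma> (\<sigma> x) \<in> fst d"
    and len: "length (\<alpha> :: 'n list) \<le> 1"
  have cd: "\<sigma> x \<in> fst c" "x \<in> fst d" using cd inv_s by auto
  let ?D = "\<lambda>\<rho>. frechet_derivative (loc_rep d c \<rho>) (at (snd d x))"
  let ?E = "\<lambda>\<rho>. frechet_derivative (loc_rep c d (inv \<rho>)) (at (snd c (\<sigma> x)))"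
  have lin: "linear (?D \<rho>)" if "\<rho> \<in> Diff A" "\<rho> x \<in> fst c" for \<rho>
    by (rule has_derivative_linear[OF loc_rep_differentiable[OF A A DiffD(2)[OF that(1)] d cd(2) c that(2)]])
  have D_axis: "?D \<sigma> (axis i 1) = ?D \<tau> (axis i 1)" for i
  proof -
    have "partials [i] (loc_rep d c \<sigma>) (snd d x) = partials [i] (loc_rep d c \<tau>) (snd d x)"
      by (rule jet_agreeD[OF agree d cd(2) c cd(1)]) simp
    then show ?thesis by simp
  qed
  have D: "?D \<sigma> = ?D \<tau>"
  proof (rule linear_eq_stdbasis)
    show "linear (?D \<sigma>)" "linear (?D \<tau>)" using lin[OF s] lin[OF t] cd eq by simp_all
    show "?D \<sigma> b = ?D \<tau> b" if "b \<in> Basis" for b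
      using that D_axis by (auto simp: Basis_vec_def)
  qed
  have ED: "?E \<rho> \<circ> ?D \<rho> = id" and DE: "?D \<rho> \<circ> ?E \<rho> = id"
    if r: "\<rho> \<in> Diff A" "\<rho> x = \<sigma> x" for \<rho>
  proof -
    have x: "inv \<rho> (\<sigma> x) = x" using Diff_inv_simps(1)[OF r(1), of x] r(2) by simp
    show "?E \<rho> \<circ> ?D \<rho> = id"
      using loc_rep_derivative_compose[OF A A A DiffD(2,3)[OF r(1)] d cd(2) c _ d]
        loc_rep_id_derivative[OF A d cd(2)] x cd r(2) Diff_inv_simps(3)[OF r(1)] by simp
    show "?D \<rho> \<circ> ?E \<rho> = id"
      using loc_rep_derivative_compose[OF A A A DiffD(3,2)[OF r(1)] c cd(1) d _ c]
        loc_rep_id_derivative[OF A c cd(1)] x cd r(2) Diff_inv_simps(4)[OF r(1)] by simp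
  qed
  \<comment> \<open>A left inverse of the common derivative, coming from \<open>\<sigma>\<close>,
    equals a right inverse of it, coming from \<open>\<tau>\<close>.\<close>
  have "?E \<sigma> = ?E \<sigma> \<circ> (?D \<tau> \<circ> ?E \<tau>)" using DE[OF t eq] by simp
  also have "\<dots> = (?E \<sigma> \<circ> ?D \<sigma>) \<circ> ?E \<tau>" unfolding D by (rule comp_assoc[symmetric])
  also have "\<dots> = ?E \<tau>" using ED[OF s refl] by simp
  finally have E: "?E \<sigma> = ?E \<tau>" .
  show "partials \<alpha> (loc_rep c d (inv \<sigma>)) (snd c (\<sigma> x)) = partials \<alpha> (loc_rep c d (inv \<tau>)) (snd c (\<sigma> x))"
  proof (cases \<alpha>)
    case Nil
    then show ?thesis
      using loc_rep_apply[OF A c cd(1), of d "inv \<sigma>"] loc_rep_apply[OF A c cd(1), of d "inv \<tau>"] inv_s inv_t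
      by simp
  next
    case (Cons i \<beta>)
    then show ?thesis using len fun_cong[OF E, of "axis i 1"] by simp
  qed
qed

text \<open>The description in \<open>tilde_lagrangian\<close> ranges over all representatives of
  the jet, whose second component may be a merely local section; so the comparison takes place on a
  common neighbourhood \<open>U\<close>. The order \<open>max 1 r\<close> covers both the
  \<open>r\<close>-jet of \<open>\<psi>\<close> that \<open>L\<close> reads and the one derivative
  of \<open>\<eta>\<close> that enters the background.\<close>

lemma tilde_lagrangian_eq:
  fixes AX :: "('x::{t2_space,second_countable_topology}, real^'n) atlas"
    and AV :: "('v::{t2_space,second_countable_topology}, 'ev::euclidean_space) atlas"
    and AB :: "('b::{t2_space,second_countable_topology}, 'eb::euclidean_space) atlas"
  assumes X: "smooth_manifold AX" and V: "smooth_manifold AV" and B: "smooth_manifold AB"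
    and ind: "differential_index_le AX AB pB actB 1" and chi: "\<And>x. pB (chi x) = x"
    and eta: "\<eta> \<in> Diff AX" and psi: "local_section AX AV pV x \<psi>"
  shows "tilde_lagrangian AX AV pV actB r L chi (tilde_jet AX AV pV (tilde_order r) \<eta> \<psi> x) =
    L (jet AX AV pV r \<psi> x) (act_section actB (inv \<eta>) chi x)"
  unfolding tilde_lagrangian_def
proof (rule the_equality)
  fix w assume "\<exists>x' \<eta>' \<psi>'. \<eta>' \<in> Diff AX \<and> local_section AX AV pV x' \<psi>' \<and>
      tilde_jet AX AV pV (tilde_order r) \<eta> \<psi> x = tilde_jet AX AV pV (tilde_order r) \<eta>' \<psi>' x' \<and>
      w = L (jet AX AV pV r \<psi>' x') (act_section actB (inv \<eta>') chi x')"
  then obtain x' \<eta>' \<psi>' where eta': "\<eta>' \<in> Diff AX" and psi': "local_section AX AV pV x' \<psi>'"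
    and j: "tilde_jet AX AV pV (tilde_order r) \<eta> \<psi> x = tilde_jet AX AV pV (tilde_order r) \<eta>' \<psi>' x'"
    and w: "w = L (jet AX AV pV r \<psi>' x') (act_section actB (inv \<eta>') chi x')" by blast
  have x': "x' = x" using arg_cong[OF j, of fst] by (simp add: jet_def)
  obtain U1 where U1: "open U1" "x \<in> U1" "smooth_map AX AV U1 \<psi>"
    using psi unfolding local_section_def by blast
  obtain U2 where U2: "open U2" "x \<in> U2" "smooth_map AX AV U2 \<psi>'" "\<forall>y\<in>U2. pV (\<psi>' y) = y"
    using psi' unfolding local_section_def x' by blast
  define U where "U = U1 \<inter> U2"
  have U: "open U" "x \<in> U" using U1 U2 by (auto simp: U_def)
  have sU: "smooth_map AX AV U \<psi>" "smooth_map AX AV U \<psi>'"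
    by (rule smooth_map_subset[OF X U1(3) U(1)], simp add: U_def)
      (rule smooth_map_subset[OF X U2(3) U(1)], simp add: U_def)
  have eU: "smooth_map AX AX U \<eta>" "smooth_map AX AX U \<eta>'"
    by (rule smooth_map_subset[OF X DiffD(2)[OF eta] U(1) subset_UNIV])
      (rule smooth_map_subset[OF X DiffD(2)[OF eta'] U(1) subset_UNIV])
  have "local_section AX (prod_atlas AX AV) (pV \<circ> snd) x' (\<lambda>x. (\<eta>' x, \<psi>' x))"
    unfolding local_section_def x'
  proof (intro exI[of _ U] conjI U)
    show "smooth_map AX (prod_atlas AX AV) U (\<lambda>x. (\<eta>' x, \<psi>' x))"
      by (rule smooth_map_Pair[OF X X V U(1) eU(2) sU(2)])
    show "\<forall>y\<in>U. (pV \<circ> snd) (\<eta>' y, \<psi>' y) = y" using U2(4) by (simp add: U_def)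
  qed
  from jet_eqD[OF j this]
  have agree: "jet_agree AX (prod_atlas AX AV) (tilde_order r) x (\<lambda>x. (\<eta> x, \<psi> x)) (\<lambda>x. (\<eta>' x, \<psi>' x))" .
  note ag = jet_agree_Pair[OF X X V U eU sU agree]
  have "jet_agree AX AV r x \<psi> \<psi>'"
    by (rule jet_agree_mono[OF ag(2)]) (simp add: tilde_order_def)
  then have 1: "jet AX AV pV r \<psi> x = jet AX AV pV r \<psi>' x" by (rule jet_eqI)
  have ag1: "jet_agree AX AX 1 x \<eta> \<eta>'"
    by (rule jet_agree_mono[OF ag(1)]) (simp add: tilde_order_def)
  then have eq: "\<eta>' x = \<eta> x" by (simp add: jet_agree_def)
  \<comment> \<open>The background value at \<open>x\<close> is \<open>actB (inv \<eta>)\<close>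
    applied to a point over \<open>\<eta> x\<close>, so the jet that matters is that of
    \<open>inv \<eta>\<close> at \<open>\<eta> x\<close>.\<close>
  have "jet_agree AX AX 1 (pB (chi (\<eta> x))) (inv \<eta>) (inv \<eta>')"
    unfolding chi by (rule jet_agree_inv[OF X eta eta' ag1])
  then have "actB (inv \<eta>) (chi (\<eta> x)) = actB (inv \<eta>') (chi (\<eta> x))"
    by (rule action_determined_by_jet[OF B ind Diff_inv[OF eta] Diff_inv[OF eta']])
  then have "act_section actB (inv \<eta>) chi x = act_section actB (inv \<eta>') chi x"
    using eq Diff_inv_simps(5)[OF eta] Diff_inv_simps(5)[OF eta'] by (simp add: act_section_def)
  then show "w = L (jet AX AV pV r \<psi> x) (act_section actB (inv \<eta>) chi x)"
    unfolding w x' 1 by simp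
qed (use eta psi in blast)

subsection \<open>Group actions on sections\<close>

text \<open>Compatibility with composition makes \<open>act id\<close> idempotent, and an injective
  idempotent map is the identity.\<close>

lemma action_id:
  assumes "smooth_manifold AX" "bundle_action AX AV p act"
  shows "act id = id"
proof -
  have i: "id \<in> Diff AX" by (rule Diff_id[OF assms(1)])
  have "act (id \<circ> id) = act id \<circ> act id"
    using assms(2) i unfolding bundle_action_def by blast
  then have "act id \<circ> act id = act id" by simp
  then have "act id (act id v) = act id v" for v by (metis comp_apply)
  moreover have "inj (act id)"
    using assms(2) i unfolding bundle_action_def Diff_def bij_def by blast
  ultimately have "act id v = v" for v using injD by metis
  then show ?thesis by (intro ext) simp
qed

lemma act_section_comp:
  assumes "bundle_action AX AV p act" "\<sigma> \<in> Diff AX" "\<tau> \<in> Diff AX"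
  shows "act_section act (\<sigma> \<circ> \<tau>) s = act_section act \<sigma> (act_section act \<tau> s)"
proof -
  have "act (\<sigma> \<circ> \<tau>) = act \<sigma> \<circ> act \<tau>" using assms unfolding bundle_action_def by blast
  then show ?thesis
    unfolding act_section_def using o_inv_distrib[OF DiffD(1)[OF assms(2)] DiffD(1)[OF assms(3)]]
    by (simp add: comp_assoc)
qed

lemma act_section_id:
  assumes "smooth_manifold AX" "bundle_action AX AV p act"
  shows "act_section act id s = s"
  by (simp add: act_section_def action_id[OF assms] inv_id)

lemma smooth_section_act:
  fixes AX :: "('x::{t2_space,second_countable_topology}, 'e::euclidean_space) atlas"
    and AV :: "('v::{t2_space,second_countable_topology}, 'ev::euclidean_space) atlas"
  assumes X: "smooth_manifold AX" and V: "smooth_manifold AV" and act: "bundle_action AX AV p act"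
    and s: "\<sigma> \<in> Diff AX" and psi: "smooth_section AX AV p \<psi>"
  shows "smooth_section AX AV p (act_section act \<sigma> \<psi>)"
proof -
  have a: "act \<sigma> \<in> Diff AV" "\<And>v. p (act \<sigma> v) = \<sigma> (p v)"
    using act s unfolding bundle_action_def by blast+
  have ps: "smooth_map AX AV UNIV \<psi>" "\<And>x. p (\<psi> x) = x" using psi by (auto simp: smooth_section_def)
  have "smooth_map AX AV UNIV (\<lambda>x. \<psi> (inv \<sigma> x))"
    by (rule smooth_map_compose[OF X X V DiffD(3)[OF s] ps(1)]) auto
  then have "smooth_map AX AV UNIV (\<lambda>x. act \<sigma> (\<psi> (inv \<sigma> x)))"
    by (rule smooth_map_compose[OF X V V _ DiffD(2)[OF a(1)]]) auto
  then show ?thesis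
    unfolding smooth_section_def act_section_def
    using a(2) ps(2) Diff_inv_simps(2)[OF s] by (simp add: o_def)
qed

text \<open>A variation is constrained only for \<epsilon> within \<open>\<delta>\<close> of 0, so
  integrals can be compared only there; this determines the derivative at 0.\<close>

lemma has_real_derivative_cong_near:
  assumes "(f has_real_derivative D) (at 0)" "0 < \<delta>" "\<And>\<epsilon>. \<epsilon> \<in> {-\<delta><..<\<delta>} \<Longrightarrow> f \<epsilon> = g \<epsilon>"
  shows "(g has_real_derivative D) (at 0)"
  using assms(1) unfolding has_field_derivative_def
  by (rule has_derivative_transform_within_open[of _ _ _ _ "{-\<delta><..<\<delta>}"]) (use assms(2,3) in auto)


text \<open>Support: \<open>K\<close> is closed, so around a point outside \<open>K\<close> the map
  \<open>s \<epsilon>\<close> is the identity on a neighbourhood, has the jets of the identity to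
  every order and acts trivially on the fibre. Smoothness: the map sending
  \<open>(\<epsilon>, x)\<close> to \<epsilon> and \<open>\<psi> (inv (s \<epsilon>) x)\<close> is
  followed by the smooth family of actions.\<close>

lemma section_variation_act:
  fixes AX :: "('x::{t2_space,second_countable_topology}, real^'n) atlas"
    and AV :: "('v::{t2_space,second_countable_topology}, 'ev::euclidean_space) atlas"
  assumes X: "smooth_manifold AX" and V: "smooth_manifold AV" and pV: "smooth_map AV AX UNIV pV"
    and act: "bundle_action AX AV pV act" and ind: "differential_index_le AX AV pV act k"
    and psi: "smooth_section AX AV pV \<psi>" and var: "diff_variation AX id \<delta> K s"
  shows "section_variation AX AV pV \<psi> \<delta> K (\<lambda>\<epsilon>. act_section act (s \<epsilon>) \<psi>)"
proof -
  let ?I = "{-\<delta><..<\<delta>}"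
  have \<delta>: "0 < \<delta>" and K: "compact K" and s0: "s 0 = id"
    using var unfolding diff_variation_def by auto
  have s: "s \<epsilon> \<in> Diff AX" "x \<notin> K \<Longrightarrow> s \<epsilon> x = x" if "\<epsilon> \<in> ?I" for \<epsilon> x
    using var that unfolding diff_variation_def by auto
  have sm: "smooth_map (prod_atlas real_atlas AX) AX (?I \<times> UNIV) (\<lambda>(\<epsilon>, x). s \<epsilon> x)"
    using var unfolding diff_variation_def by blast
  have ps: "smooth_map AX AV UNIV \<psi>" "\<And>x. pV (\<psi> x) = x" using psi by (auto simp: smooth_section_def)
  have supp: "act_section act (s \<epsilon>) \<psi> x = \<psi> x" if \<epsilon>: "\<epsilon> \<in> ?I" and x: "x \<notin> K" for \<epsilon> x
  proof -
    have sx: "s \<epsilon> x = x" by (rule s(2)[OF \<epsilon> x])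
    then have ix: "inv (s \<epsilon>) x = x" using Diff_inv_simps(1)[OF s(1)[OF \<epsilon>], of x] by simp
    have "jet_agree AX AX k x (s \<epsilon>) id"
      unfolding jet_agree_def
    proof (intro conjI ballI allI impI)
      fix c d and \<alpha> :: "'n list" assume c: "c \<in> AX" and d: "d \<in> AX" and xc: "x \<in> fst c \<and> s \<epsilon> x \<in> fst d"
      define T where "T = fst c \<inter> - K"
      have T: "open T" "T \<subseteq> fst c" "x \<in> T"
        unfolding T_def using chart_open[OF X c] compact_imp_closed[OF K] x xc by (auto simp: open_Compl)
      show "partials \<alpha> (loc_rep c d (s \<epsilon>)) (snd c x) = partials \<alpha> (loc_rep c d id) (snd c x)"
      proof (rule partials_cong[OF chart_open_image[OF X c T(1,2)]])
        fix z assume "z \<in> snd c ` T"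
        then obtain y where y: "y \<in> T" "z = snd c y" by (elim imageE)
        then have "y \<in> fst c" "y \<notin> K" by (auto simp: T_def)
        then show "loc_rep c d (s \<epsilon>) z = loc_rep c d id z"
          using loc_rep_apply[OF X c, of y d "s \<epsilon>"] loc_rep_apply[OF X c, of y d id] s(2)[OF \<epsilon>, of y] y(2) by simp
      qed (use T in simp)
    qed (simp add: sx)
    then have "act (s \<epsilon>) (\<psi> x) = act id (\<psi> x)"
      by (intro action_determined_by_jet[OF V ind s(1)[OF \<epsilon>] Diff_id[OF X]]) (simp add: ps(2))
    then show ?thesis by (simp add: act_section_def ix action_id[OF X act])
  qed
  have RX: "smooth_manifold (prod_atlas real_atlas AX)" and RV: "smooth_manifold (prod_atlas real_atlas AV)"
    by (rule smooth_manifold_prod[OF smooth_manifold_real X]) (rule smooth_manifold_prod[OF smooth_manifold_real V])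
  have oI: "open (?I \<times> (UNIV :: 'x set))" "open (?I \<times> (UNIV :: 'v set))" by (simp_all add: open_Times)
  have inv: "smooth_map (prod_atlas real_atlas AX) AX (?I \<times> UNIV) (\<lambda>r. inv (s (fst r)) (snd r))"
    using smooth_map_family_inv[OF X _ sm s(1)] by (simp add: split_beta')
  have fam: "smooth_map (prod_atlas real_atlas AV) AV (?I \<times> UNIV) (\<lambda>r. act (s (fst r)) (snd r))"
    using smooth_map_family_action[OF X V pV _ sm s(1) ind] by (simp add: split_beta')
  have "smooth_map (prod_atlas real_atlas AX) AV (?I \<times> UNIV) (\<lambda>r. \<psi> (inv (s (fst r)) (snd r)))"
    by (rule smooth_map_compose[OF RX X V inv ps(1) oI(1)]) auto
  then have "smooth_map (prod_atlas real_atlas AX) (prod_atlas real_atlas AV) (?I \<times> UNIV)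
      (\<lambda>r. (fst r, \<psi> (inv (s (fst r)) (snd r))))"
    by (rule smooth_map_Pair[OF RX smooth_manifold_real V oI(1) smooth_map_fst[OF smooth_manifold_real X oI(1)]])
  from smooth_map_compose[OF RX RV V this fam oI]
  have "smooth_map (prod_atlas real_atlas AX) AV (?I \<times> UNIV) (\<lambda>r. act (s (fst r)) (\<psi> (inv (s (fst r)) (snd r))))"
    by (auto simp: image_subset_iff)
  then have "smooth_map (prod_atlas real_atlas AX) AV (?I \<times> UNIV) (\<lambda>(\<epsilon>, x). act_section act (s \<epsilon>) \<psi> x)"
    by (simp add: act_section_def split_beta')
  then show ?thesis
    unfolding section_variation_def
    using \<delta> K s0 act_section_id[OF X act] smooth_section_act[OF X V act s(1) psi] supp by simp
qed

theorem mainTheorem5: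
  fixes AX :: "('x::{t2_space,second_countable_topology}, real^'n::{finite,wellorder}) atlas"
    and AV :: "('v::{t2_space,second_countable_topology}, 'ev::euclidean_space) atlas"
    and FV :: "('fv::{t2_space,second_countable_topology}, 'efv::real_normed_vector) atlas"
    and AB :: "('b::{t2_space,second_countable_topology}, 'eb::euclidean_space) atlas"
    and FB :: "('fb::{t2_space,second_countable_topology}, 'efb::real_normed_vector) atlas"
    and pV :: "'v \<Rightarrow> 'x" and pB :: "'b \<Rightarrow> 'x"
    and actV :: "('x \<Rightarrow> 'x) \<Rightarrow> 'v \<Rightarrow> 'v" and actB :: "('x \<Rightarrow> 'x) \<Rightarrow> 'b \<Rightarrow> 'b"
    and r :: nat
    and L :: "('x, 'v) jet \<Rightarrow> 'b \<Rightarrow> ('x, 'n) top_form"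
    and chibar :: "'x \<Rightarrow> 'b" and \<eta> :: "'x \<Rightarrow> 'x" and \<psi> :: "'x \<Rightarrow> 'v"
  assumes "oriented_manifold AX"
    and "fibre_bundle AX AV FV pV"
    and "fibre_bundle AX AB FB pB"
    and "bundle_action AX AV pV actV"
    and "bundle_action AX AB pB actB"
    and "\<exists>k. differential_index_le AX AV pV actV k"
    and "differential_index_le AX AB pB actB 1"
    and "lagrangian AX AV pV AB pB r L"
    and "covariant AX AV pV actV AB pB actB r L"
    and "smooth_section AX AB pB chibar"
    and "\<eta> \<in> Diff AX"
    and "smooth_section AX AV pV \<psi>"
  shows "(tilde_EL_psi AX AV pV (tilde_order r) (tilde_lagrangian AX AV pV actB r L chibar) \<eta> \<psi> \<longleftrightarrow>
            EL_psi AX AV pV r L \<psi> (act_section actB (inv \<eta>) chibar)) \<and>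
         (tilde_EL_psi AX AV pV (tilde_order r) (tilde_lagrangian AX AV pV actB r L chibar) \<eta> \<psi> \<longrightarrow>
            tilde_EL_eta AX AV pV (tilde_order r) (tilde_lagrangian AX AV pV actB r L chibar) \<eta> \<psi>)"
proof -
  note or = assms(1) and actV = assms(4) and actB = assms(5) and indB = assms(7) and lag = assms(8)
    and cov = assms(9) and chibar = assms(10) and eta = assms(11) and psi = assms(12)
  have X: "smooth_manifold AX" and V: "smooth_manifold AV" and B: "smooth_manifold AB"
    and pV: "smooth_map AV AX UNIV pV"
    using assms(2,3) unfolding fibre_bundle_def by blast+
  define chi0 where "chi0 = act_section actB (inv \<eta>) chibar"
  have pchi: "pB (chibar x) = x" for x using chibar by (simp add: smooth_section_def)
  have tilde: "tilde_lagrangian AX AV pV actB r L chibar (tilde_jet AX AV pV (tilde_order r) \<eta>' \<psi>' x) =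
      L (jet AX AV pV r \<psi>' x) (act_section actB (inv \<eta>') chibar x)"
    if "\<eta>' \<in> Diff AX" "smooth_section AX AV pV \<psi>'" for \<eta>' \<psi>' x
    by (rule tilde_lagrangian_eq[OF X V B indB pchi that(1) smooth_section_local[OF that(2)]])
  have integral_eq: "form_integral AX K (\<lambda>x. tilde_lagrangian AX AV pV actB r L chibar
        (tilde_jet AX AV pV (tilde_order r) \<eta> (\<Psi> \<epsilon>) x)) =
      form_integral AX K (\<lambda>x. L (jet AX AV pV r (\<Psi> \<epsilon>) x) (chi0 x))"
    if "section_variation AX AV pV \<psi> \<delta> K \<Psi>" "\<epsilon> \<in> {-\<delta><..<\<delta>}" for \<delta> K \<Psi> \<epsilon>
  proof -
    have "smooth_section AX AV pV (\<Psi> \<epsilon>)" using that unfolding section_variation_def by blast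
    then show ?thesis by (simp add: tilde[OF eta] chi0_def)
  qed
  have part_i: "tilde_EL_psi AX AV pV (tilde_order r) (tilde_lagrangian AX AV pV actB r L chibar) \<eta> \<psi> \<longleftrightarrow>
      EL_psi AX AV pV r L \<psi> chi0"
    unfolding tilde_EL_psi_def EL_psi_def
  proof (intro iff_allI imp_cong refl)
    fix \<delta> K \<Psi> assume var: "section_variation AX AV pV \<psi> \<delta> K \<Psi>"
    then have "0 < \<delta>" by (simp add: section_variation_def)
    then show "((\<lambda>\<epsilon>. form_integral AX K (\<lambda>x. tilde_lagrangian AX AV pV actB r L chibar
          (tilde_jet AX AV pV (tilde_order r) \<eta> (\<Psi> \<epsilon>) x))) has_real_derivative 0) (at 0) \<longleftrightarrow>
        ((\<lambda>\<epsilon>. form_integral AX K (\<lambda>x. L (jet AX AV pV r (\<Psi> \<epsilon>) x) (chi0 x))) has_real_derivative 0) (at 0)"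
      by (intro iffI) (erule has_real_derivative_cong_near, assumption, simp add: integral_eq[OF var])+
  qed
  have part_ii: "tilde_EL_eta AX AV pV (tilde_order r) (tilde_lagrangian AX AV pV actB r L chibar) \<eta> \<psi>"
    if EL: "EL_psi AX AV pV r L \<psi> chi0"
    unfolding tilde_EL_eta_def
  proof (intro allI impI)
    fix \<delta> K H assume var: "diff_variation AX \<eta> \<delta> K H"
    let ?I = "{-\<delta><..<\<delta>}"
    have \<delta>: "0 < \<delta>" and K: "compact K" and H0: "H 0 = \<eta>"
      using var unfolding diff_variation_def by auto
    have H: "H \<epsilon> \<in> Diff AX" "x \<notin> K \<Longrightarrow> H \<epsilon> x = \<eta> x" if "\<epsilon> \<in> ?I" for \<epsilon> x
      using var that unfolding diff_variation_def by auto
    define s where "s = (\<lambda>\<epsilon>. inv \<eta> \<circ> H \<epsilon>)"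
    have s0: "s 0 = id" unfolding s_def H0 by (rule Diff_inv_simps(3)[OF eta])
    have s: "s \<epsilon> \<in> Diff AX" if "\<epsilon> \<in> ?I" for \<epsilon>
      unfolding s_def by (rule Diff_comp[OF X Diff_inv[OF eta] H(1)[OF that]])
    have sK: "s \<epsilon> x = x" if "\<epsilon> \<in> ?I" "x \<notin> K" for \<epsilon> x
      using H(2)[OF that] Diff_inv_simps(1)[OF eta] by (simp add: s_def)
    have RX: "smooth_manifold (prod_atlas real_atlas AX)"
      by (rule smooth_manifold_prod[OF smooth_manifold_real X])
    have sm: "smooth_map (prod_atlas real_atlas AX) AX (?I \<times> UNIV) (\<lambda>(\<epsilon>, x). s \<epsilon> x)"
    proof -
      have "smooth_map (prod_atlas real_atlas AX) AX (?I \<times> UNIV) (\<lambda>(\<epsilon>, x). H \<epsilon> x)"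
        using var unfolding diff_variation_def by blast
      from smooth_map_compose[OF RX X X this DiffD(3)[OF eta]] show ?thesis
        by (simp add: s_def split_beta' open_Times)
    qed
    have svar: "diff_variation AX id \<delta> K s"
      unfolding diff_variation_def using \<delta> K s0 s sK sm by simp
    obtain k where k: "differential_index_le AX AV pV actV k" using assms(6) by blast
    define \<Psi> where "\<Psi> = (\<lambda>\<epsilon>. act_section actV (s \<epsilon>) \<psi>)"
    have psivar: "section_variation AX AV pV \<psi> \<delta> K \<Psi>"
      unfolding \<Psi>_def by (rule section_variation_act[OF X V pV actV k psi svar])
    have eq: "form_integral AX K (\<lambda>x. L (jet AX AV pV r (\<Psi> \<epsilon>) x) (chi0 x)) =
        form_integral AX K (\<lambda>x. tilde_lagrangian AX AV pV actB r L chibar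
          (tilde_jet AX AV pV (tilde_order r) (H \<epsilon>) \<psi> x))" if \<epsilon>: "\<epsilon> \<in> ?I" for \<epsilon>
    proof -
      let ?\<sigma> = "s \<epsilon>"
      have sD: "?\<sigma> \<in> Diff AX" by (rule s[OF \<epsilon>])
      have iD: "inv ?\<sigma> \<in> Diff AX" by (rule Diff_inv[OF sD])
      have inv_inv: "inv (inv ?\<sigma>) = ?\<sigma>" by (rule Diff_inv_simps(5)[OF sD])
      \<comment> \<open>This is also the background belonging to \<open>H \<epsilon>\<close>,
        because \<open>inv ?\<sigma> \<circ> inv \<eta> = inv (H \<epsilon>)\<close>.\<close>
      define chi1 where "chi1 = act_section actB (inv ?\<sigma>) chi0"
      define \<omega> where "\<omega> = (\<lambda>x. L (jet AX AV pV r (\<Psi> \<epsilon>) x) (chi0 x))"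
      define \<omega>' where "\<omega>' = (\<lambda>x. L (jet AX AV pV r \<psi> x) (chi1 x))"
      have "inv ?\<sigma> \<circ> inv \<eta> = inv (\<eta> \<circ> ?\<sigma>)"
        by (rule o_inv_distrib[OF DiffD(1)[OF eta] DiffD(1)[OF sD], symmetric])
      also have "\<eta> \<circ> ?\<sigma> = H \<epsilon>"
        unfolding s_def comp_assoc[symmetric] by (simp add: Diff_inv_simps(4)[OF eta])
      finally have inv_H: "inv ?\<sigma> \<circ> inv \<eta> = inv (H \<epsilon>)" .
      have chi1: "chi1 = act_section actB (inv (H \<epsilon>)) chibar"
        unfolding chi1_def chi0_def act_section_comp[OF actB iD Diff_inv[OF eta], symmetric] inv_H
        by (rule refl)
      have sec: "smooth_section AX AV pV (\<Psi> \<epsilon>)" "smooth_section AX AB pB chi0" "smooth_section AX AB pB chi1"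
        unfolding \<Psi>_def chi1_def chi0_def
        by (intro smooth_section_act[OF X V actV sD psi] smooth_section_act[OF X B actB] chibar iD Diff_inv[OF eta])+
      have cancel: "act_section actV (inv ?\<sigma>) (\<Psi> \<epsilon>) = \<psi>" "act_section actB ?\<sigma> chi1 = chi0"
        unfolding \<Psi>_def chi1_def act_section_comp[OF actV iD sD, symmetric] act_section_comp[OF actB sD iD, symmetric]
          Diff_inv_simps(3,4)[OF sD] act_section_id[OF X actV] act_section_id[OF X actB] by (rule refl)+
      have form: "\<omega> x \<in> top_forms_at AX x" "\<omega>' x \<in> top_forms_at AX x" for x
        using lag sec smooth_section_local[OF sec(1), of x] smooth_section_local[OF psi, of x]
        unfolding lagrangian_def \<omega>_def \<omega>'_def smooth_section_def by blast+
      \<comment> \<open>\<open>has_form_integral_transform\<close> carries a value of the integral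
        in one direction only, so each form is presented as a push-forward of the other, by
        covariance under \<sigma> and under its inverse.\<close>
      have push: "\<omega>' = push_forward AX (inv ?\<sigma>) \<omega>" "\<omega> = push_forward AX ?\<sigma> \<omega>'"
      proof -
        have "(\<lambda>x. L (jet AX AV pV r (act_section actV (inv ?\<sigma>) (\<Psi> \<epsilon>)) x) (act_section actB (inv ?\<sigma>) chi0 x)) =
            push_forward AX (inv ?\<sigma>) \<omega>"
          using cov iD sec(1,2) unfolding covariant_def \<omega>_def by blast
        then show "\<omega>' = push_forward AX (inv ?\<sigma>) \<omega>" unfolding cancel \<omega>'_def chi1_def .
        have "(\<lambda>x. L (jet AX AV pV r (act_section actV ?\<sigma> \<psi>) x) (act_section actB ?\<sigma> chi1 x)) =
            push_forward AX ?\<sigma> \<omega>'"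
          using cov sD psi sec(3) unfolding covariant_def \<omega>'_def by blast
        then show "\<omega> = push_forward AX ?\<sigma> \<omega>'" unfolding cancel \<omega>_def \<Psi>_def .
      qed
      have pos: "jacobian (loc_rep d c ?\<sigma>) (snd d y) > 0"
        if "c \<in> AX" "d \<in> AX" "y \<in> fst d" "?\<sigma> y \<in> fst c" for c d y
        by (rule jacobian_family_pos[OF or \<delta> sm s s0 \<epsilon> that(2,3,1,4)])
      have pos': "jacobian (loc_rep d c (inv ?\<sigma>)) (snd d y) > 0"
        if "c \<in> AX" "d \<in> AX" "y \<in> fst d" "inv ?\<sigma> y \<in> fst c" for c d y
      proof -
        have y: "?\<sigma> (inv ?\<sigma> y) = y" by (rule Diff_inv_simps(2)[OF sD])
        have "jacobian (loc_rep d c (inv ?\<sigma>)) (snd d y) * jacobian (loc_rep c d ?\<sigma>) (snd c (inv ?\<sigma> y)) = 1"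
          using jacobian_inv[OF X sD that(1,4,2)] that(3) unfolding y by blast
        moreover have "jacobian (loc_rep c d ?\<sigma>) (snd c (inv ?\<sigma> y)) > 0"
          using pos[OF that(2,1,4)] that(3) unfolding y by blast
        ultimately show ?thesis by (metis zero_less_mult_pos2 zero_less_one)
      qed
      \<comment> \<open>Points outside \<open>K\<close> are fixed, and by injectivity no point of
        \<open>K\<close> can be sent to one of them.\<close>
      have in_K: "?\<sigma> x \<in> K \<longleftrightarrow> x \<in> K" for x
        using sK[OF \<epsilon>] Diff_inv_simps(1)[OF sD] by metis
      have sK_eq: "?\<sigma> ` K = K"
      proof (intro subset_antisym subsetI)
        fix y assume "y \<in> K"
        then show "y \<in> ?\<sigma> ` K"
          using in_K[of "inv ?\<sigma> y"] Diff_inv_simps(2)[OF sD, of y] by (metis imageI)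
      qed (use in_K in blast)
      have iK: "inv ?\<sigma> ` K = K"
        by (subst sK_eq[symmetric]) (simp add: image_image Diff_inv_simps(1)[OF sD])
      have "has_form_integral AX K \<omega> J \<longleftrightarrow> has_form_integral AX K \<omega>' J" for J
      proof
        assume "has_form_integral AX K \<omega> J"
        then show "has_form_integral AX K \<omega>' J"
        proof (rule has_form_integral_transform[OF X sD K sK_eq pos, rotated -1])
          \<comment> \<open>Push-forward along \<open>inv ?\<sigma>\<close> is pull-back along
            \<sigma>, the relation required between the two forms.\<close>
          show "\<omega>' y d = \<omega> (?\<sigma> y) c * jacobian (loc_rep d c ?\<sigma>) (snd d y)"
            if "c \<in> AX" "d \<in> AX" "y \<in> fst d" "?\<sigma> y \<in> fst c" for c d y
            using push_forward_eq[where \<omega>=\<omega> and y=y, OF X iD form(1) that(2,3,1)] that(4)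
            unfolding inv_inv push(1)[symmetric] by blast
        qed
      next
        assume "has_form_integral AX K \<omega>' J"
        then show "has_form_integral AX K \<omega> J"
        proof (rule has_form_integral_transform[OF X iD K iK pos', rotated -1])
          show "\<omega> y d = \<omega>' (inv ?\<sigma> y) c * jacobian (loc_rep d c (inv ?\<sigma>)) (snd d y)"
            if "c \<in> AX" "d \<in> AX" "y \<in> fst d" "inv ?\<sigma> y \<in> fst c" for c d y
            using push_forward_eq[where \<omega>=\<omega>' and y=y, OF X sD form(2) that(2,3,1,4)]
            unfolding push(2)[symmetric] .
        qed
      qed
      then have "form_integral AX K \<omega> = form_integral AX K \<omega>'" by (simp add: form_integral_def)
      moreover have "\<omega>' = (\<lambda>x. tilde_lagrangian AX AV pV actB r L chibar
          (tilde_jet AX AV pV (tilde_order r) (H \<epsilon>) \<psi> x))"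
        unfolding \<omega>'_def tilde[OF H(1)[OF \<epsilon>] psi] chi1 ..
      ultimately show ?thesis unfolding \<omega>_def by simp
    qed
    have "((\<lambda>\<epsilon>. form_integral AX K (\<lambda>x. L (jet AX AV pV r (\<Psi> \<epsilon>) x) (chi0 x))) has_real_derivative 0) (at 0)"
      using EL psivar unfolding EL_psi_def by blast
    then show "((\<lambda>\<epsilon>. form_integral AX K (\<lambda>x. tilde_lagrangian AX AV pV actB r L chibar
        (tilde_jet AX AV pV (tilde_order r) (H \<epsilon>) \<psi> x))) has_real_derivative 0) (at 0)"
      by (rule has_real_derivative_cong_near[OF _ \<delta> eq])
  qed
  show ?thesis using part_i part_ii unfolding chi0_def by blast
qed

end
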